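(* Let $k$ be a field of characteristic zero and let $H$ be a Hopf $k$-algebra such that its coradical $H_0$ is a central Hopf subalgebra of $H$. Then $H$ has a PBW basis over $H_0$.
   Context: The coradical $H_0$ of a Hopf algebra $H$ is the sum of all simple subcoalgebras of $H$. "Central" means that $H_0$ is contained in the center of $H$ (as an algebra). PBW basis: let $A$ be a $k$-algebra, $B$ a commutative $k$-algebra, and $B\to A$ a $B$-algebra structure on $A$ (i.e. the image of $B$ in $A$ is central). For a well-ordered set $\Lambda$ and a subset $\mathcal{A}_\Lambda=\{a_\lambda\}_{\lambda\in\Lambda}$ of $A$, the PBW set associated to the generating set $\mathcal{A}_\Lambda$ is $$\mathcal{P}_\Lambda:=\left\{a_{\lambda_1}^{k_1}\cdots a_{\lambda_n}^{k_n}~\middle|~ n,k_1,\dots,k_n\geq 0,\ \lambda_1<\dots<\lambda_n\right\}$$ (with $\lambda_1,\dots,\lambda_n\in\Lambda$, and the empty product equal to $1$). One says that $A$ has a PBW basis over $B$ if there exist a well-ordered set $\Lambda$ and a generating set $\mathcal{A}_\Lambda$ such that the PBW set associated to $\mathcal{A}_\Lambda$ is a basis of $A$ as a $B$-module. Here this is applied with $A=H$, $B=H_0$ and the inclusion $H_0\to H$. *)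

theory Defs
  imports Complex_Main "HOL-Library.Poly_Mapping"
begin

section \<open>Tensor powers of a vector space\<close>

text \<open>
  The space \<open>V \<otimes> V\<close> is the quotient of the space of formal linear combinations of pairs,
  \<open>('v \<times> 'v) \<Rightarrow>\<^sub>0 'k\<close>, by the subspace spanned by the bilinearity relations; its elements
  are equivalence classes. A formal sum \<open>t\<close> in the class \<open>x\<close> is an expression
  \<open>x = \<Sum>\<^sub>i u\<^sub>i \<otimes> v\<^sub>i\<close>. Likewise for \<open>V \<otimes> V \<otimes> V\<close>, with triples.
\<close>

definition formal_scale :: "'k::field \<Rightarrow> ('i \<Rightarrow>\<^sub>0 'k) \<Rightarrow> ('i \<Rightarrow>\<^sub>0 'k)" where
  "formal_scale c t = Poly_Mapping.map ((*) c) t"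

lemma lookup_formal_scale [simp]:
  "Poly_Mapping.lookup (formal_scale c t) i = c * Poly_Mapping.lookup t i"
  by (simp add: formal_scale_def Poly_Mapping.map.rep_eq when_def)

interpretation formal: vector_space "formal_scale :: 'k::field \<Rightarrow> ('i \<Rightarrow>\<^sub>0 'k) \<Rightarrow> _"
  by unfold_locales (auto intro!: poly_mapping_eqI simp: lookup_add algebra_simps)

text \<open>The linear extension \<open>\<Sum>\<^sub>i c\<^sub>i i \<mapsto> \<Sum>\<^sub>i c\<^sub>i f(i)\<close> of \<open>f\<close> to formal sums.\<close>

definition lin_ext ::
    "('k::field \<Rightarrow> 'w::ab_group_add \<Rightarrow> 'w) \<Rightarrow> ('i \<Rightarrow> 'w) \<Rightarrow> ('i \<Rightarrow>\<^sub>0 'k) \<Rightarrow> 'w" where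
  "lin_ext scale f t =
     (\<Sum>i\<in>Poly_Mapping.keys t. scale (Poly_Mapping.lookup t i) (f i))"

text \<open>\<open>linearity_relators scale \<iota>\<close> expresses that the slot into which \<open>\<iota>\<close> inserts is linear.\<close>

definition linearity_relators ::
    "('k::field \<Rightarrow> 'v::ab_group_add \<Rightarrow> 'v) \<Rightarrow> ('v \<Rightarrow> 'i) \<Rightarrow> ('i \<Rightarrow>\<^sub>0 'k) set" where
  "linearity_relators scale \<iota> =
     {Poly_Mapping.single (\<iota> (x + y)) 1
        - Poly_Mapping.single (\<iota> x) 1 - Poly_Mapping.single (\<iota> y) 1 | x y. True}
   \<union> {Poly_Mapping.single (\<iota> (scale c x)) 1 - Poly_Mapping.single (\<iota> x) c | c x. True}"

definition tensor2_null ::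
    "('k::field \<Rightarrow> 'v::ab_group_add \<Rightarrow> 'v) \<Rightarrow> ('v \<times> 'v \<Rightarrow>\<^sub>0 'k) set" where
  "tensor2_null scale = formal.span (\<Union>z.
     linearity_relators scale (\<lambda>x. (x, z)) \<union> linearity_relators scale (\<lambda>x. (z, x)))"

definition tensor3_null ::
    "('k::field \<Rightarrow> 'v::ab_group_add \<Rightarrow> 'v) \<Rightarrow> ('v \<times> 'v \<times> 'v \<Rightarrow>\<^sub>0 'k) set" where
  "tensor3_null scale = formal.span (\<Union>y z.
     linearity_relators scale (\<lambda>x. (x, y, z)) \<union> linearity_relators scale (\<lambda>x. (y, x, z))
     \<union> linearity_relators scale (\<lambda>x. (y, z, x)))"

definition tensor2 ::
    "('k::field \<Rightarrow> 'v::ab_group_add \<Rightarrow> 'v) \<Rightarrow> ('v \<times> 'v \<Rightarrow>\<^sub>0 'k) set set" where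
  "tensor2 scale = UNIV // {(s, t). s - t \<in> tensor2_null scale}"


section \<open>Coalgebras and the coradical\<close>

text \<open>
  The value \<open>comult x\<close> is an element of \<open>V \<otimes> V\<close>, so \<open>t \<in> comult x\<close> says that \<open>t\<close> is an
  expression \<open>\<Delta>(x) = \<Sum> x\<^bsub>(1)\<^esub> \<otimes> x\<^bsub>(2)\<^esub>\<close> in Sweedler's notation. In \<open>coassoc\<close>, \<open>d\<close>
  chooses such an expression for every element.
\<close>

locale coalgebra = vector_space scale
  for scale :: "'k::field \<Rightarrow> 'h::ab_group_add \<Rightarrow> 'h" +
  fixes comult :: "'h \<Rightarrow> ('h \<times> 'h \<Rightarrow>\<^sub>0 'k) set"
    and counit :: "'h \<Rightarrow> 'k"
  assumes comult_in: "comult x \<in> tensor2 scale"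
    and comult_add: "\<lbrakk>s \<in> comult x; t \<in> comult y\<rbrakk> \<Longrightarrow> s + t \<in> comult (x + y)"
    and comult_scale: "t \<in> comult x \<Longrightarrow> formal_scale c t \<in> comult (scale c x)"
    and counit_linear: "Vector_Spaces.linear scale (*) counit"
    and counit_left: "t \<in> comult x \<Longrightarrow> lin_ext scale (\<lambda>(u, v). scale (counit u) v) t = x"
    and counit_right: "t \<in> comult x \<Longrightarrow> lin_ext scale (\<lambda>(u, v). scale (counit v) u) t = x"
    and coassoc: "(\<And>y. d y \<in> comult y) \<Longrightarrow>
      lin_ext formal_scale
          (\<lambda>(u, v). lin_ext formal_scale (\<lambda>(u1, u2). Poly_Mapping.single (u1, u2, v) 1) (d u)) (d x)
      - lin_ext formal_scale
          (\<lambda>(u, v). lin_ext formal_scale (\<lambda>(v1, v2). Poly_Mapping.single (u, v1, v2) 1) (d v)) (d x)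
      \<in> tensor3_null scale"
begin

text \<open>\<open>\<Delta>(D)\<close> lies in (the image of) \<open>D \<otimes> D\<close>.\<close>

definition subcoalgebra :: "'h set \<Rightarrow> bool" where
  "subcoalgebra D \<longleftrightarrow>
     subspace D \<and> (\<forall>x\<in>D. \<exists>t\<in>comult x. Poly_Mapping.keys t \<subseteq> D \<times> D)"

definition simple_subcoalgebra :: "'h set \<Rightarrow> bool" where
  "simple_subcoalgebra D \<longleftrightarrow>
     subcoalgebra D \<and> D \<noteq> {0} \<and> (\<forall>E. subcoalgebra E \<and> E \<subseteq> D \<longrightarrow> E = {0} \<or> E = D)"

definition coradical :: "'h set" where
  "coradical = span (\<Union>{D. simple_subcoalgebra D})"

end


section \<open>Hopf algebras\<close>

locale k_algebra = vector_space scale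
  for scale :: "'k::field \<Rightarrow> 'h::ring_1 \<Rightarrow> 'h" +
  assumes mult_scale_left: "scale c x * y = scale c (x * y)"
    and mult_scale_right: "x * scale c y = scale c (x * y)"

locale hopf_algebra = k_algebra scale + coalgebra scale comult counit
  for scale :: "'k::field \<Rightarrow> 'h::ring_1 \<Rightarrow> 'h"
    and comult :: "'h \<Rightarrow> ('h \<times> 'h \<Rightarrow>\<^sub>0 'k) set"
    and counit :: "'h \<Rightarrow> 'k" +
  fixes antipode :: "'h \<Rightarrow> 'h"
  assumes counit_one: "counit 1 = 1"
    and counit_mult: "counit (x * y) = counit x * counit y"
    and comult_one: "Poly_Mapping.single (1, 1) 1 \<in> comult 1"
    and comult_mult: "\<lbrakk>s \<in> comult x; t \<in> comult y\<rbrakk> \<Longrightarrow>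
      lin_ext formal_scale
        (\<lambda>(u, v). lin_ext formal_scale (\<lambda>(u', v'). Poly_Mapping.single (u * u', v * v') 1) t) s
      \<in> comult (x * y)"
    and antipode_linear: "Vector_Spaces.linear scale scale antipode"
    and antipode_left: "t \<in> comult x \<Longrightarrow>
      lin_ext scale (\<lambda>(u, v). antipode u * v) t = scale (counit x) 1"
    and antipode_right: "t \<in> comult x \<Longrightarrow>
      lin_ext scale (\<lambda>(u, v). u * antipode v) t = scale (counit x) 1"
begin

definition hopf_subalgebra :: "'h set \<Rightarrow> bool" where
  "hopf_subalgebra B \<longleftrightarrow>
     subcoalgebra B \<and> 1 \<in> B \<and> (\<forall>x\<in>B. \<forall>y\<in>B. x * y \<in> B) \<and> antipode ` B \<subseteq> B"

end

definition ring_center :: "'a::ring_1 set" where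
  "ring_center = {z. \<forall>x. z * x = x * z}"


section \<open>PBW bases\<close>

text \<open>In this section \<open>B\<close> is a central subring of the ring \<open>'a\<close>.\<close>

definition is_module_basis :: "'a::ring_1 set \<Rightarrow> 'a set \<Rightarrow> bool" where
  "is_module_basis B P \<longleftrightarrow>
     (\<forall>x. \<exists>F c. finite F \<and> F \<subseteq> P \<and> c ` F \<subseteq> B \<and> x = (\<Sum>p\<in>F. c p * p)) \<and>
     (\<forall>F c. finite F \<and> F \<subseteq> P \<and> c ` F \<subseteq> B \<and> (\<Sum>p\<in>F. c p * p) = 0 \<longrightarrow> (\<forall>p\<in>F. c p = 0))"

definition generates_over :: "'a::ring_1 set \<Rightarrow> 'a set \<Rightarrow> bool" where
  "generates_over B X \<longleftrightarrow>
     (\<lambda>S. 1 \<in> S \<and> (\<forall>x\<in>S. \<forall>y\<in>S. x - y \<in> S \<and> x * y \<in> S)) hull (B \<union> X) = UNIV"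

text \<open>The well-order \<open>r\<close> is reflexive; a list of pairs \<open>(\<lambda>\<^sub>i, k\<^sub>i)\<close> encodes a monomial.\<close>

definition pbw_set :: "'i set \<Rightarrow> 'i rel \<Rightarrow> ('i \<Rightarrow> 'a::ring_1) \<Rightarrow> 'a set" where
  "pbw_set \<Lambda> r a =
     {prod_list (map (\<lambda>(l, k). a l ^ k) ps) | ps :: ('i \<times> nat) list.
        set (map fst ps) \<subseteq> \<Lambda> \<and>
        sorted_wrt (\<lambda>l m. (l, m) \<in> r \<and> l \<noteq> m) (map fst ps)}"

text \<open>
  The generators \<open>a\<^sub>\<lambda>\<close> are pairwise distinct, so a well-ordered index set of any type is order
  isomorphic to a well-ordered subset of \<open>'a\<close>: nothing is lost by indexing with elements of \<open>'a\<close>.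
\<close>

definition has_pbw_basis_over :: "'a::ring_1 set \<Rightarrow> bool" where
  "has_pbw_basis_over B \<longleftrightarrow>
     (\<exists>(\<Lambda> :: 'a set) r (a :: 'a \<Rightarrow> 'a).
        well_order_on \<Lambda> r \<and> inj_on a \<Lambda> \<and> generates_over B (a ` \<Lambda>) \<and>
        is_module_basis B (pbw_set \<Lambda> r a))"

end

(*
  The coradical filtration H_0 <= H_1 <= ... is exhaustive, multiplicative and, because H_0 is
  central, satisfies [H_m, H_n] <= H_(m+n-1): the associated graded algebra is commutative.
  Each H_d/H_(d-1) is a Hopf module over H_0, so generators of degree d can be chosen as
  coinvariant lifts a of a basis of the indecomposables of degree d modulo the augmentation ideal
  of H_0. The dual functional delta of such a generator is an infinitesimal character of the
  graded algebra, so x |-> delta(x_1) x_2 is an H_0-linear derivation that acts on monomials like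
  d/da up to higher powers of the augmentation ideal. In characteristic zero these derivations
  separate the ordered monomials; commutativity makes the ordered monomials span.

  Tensors are detected by functionals: H is a bimodule over its convolution dual (actions lact and
  ract), its subcoalgebras are the sub-bimodules, and H_n is the annihilator of the (n+1)-st power
  of the ideal of functionals vanishing on H_0.
*)
theory Submission
  imports Defs "HOL-Library.Multiset"
begin

section \<open>Linear functionals, endomorphisms and bilinear maps\<close>

text \<open>The associated graded algebra is never built: a statement about its degree d is a
  congruence in H modulo H_(d-1). That coinvariant lifts generate over H_0 comes from the Hopf
  module structure: in degree d, x is congruent to the sum of x_1 S(x_2) x_3, which writes it
  through coinvariants and replaces Nakayama's lemma. Coinvariance also makes \<delta>(a_1) a_2
  exactly the scalar 0 or 1, not just some element of H_0. The derivation attached to a generator l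
  is not d/dl even in the graded algebra: on a generator of larger degree it may leave an element of
  positive degree. That term has one factor of positive degree more than the partial derivative,
  hence the second count by number of factors (size) beside the degree (weight). Differentiation
  multiplies by a multiplicity, which must be cancelled; in characteristic p it would lose the p-th
  powers. Functionals are the working tool because a coproduct is a class of formal sums: identities
  are checked after applying a functional to one factor.\<close>

text \<open>
  A copy of \<^locale>\<open>vector_space\<close>: additions to the latter would also be inherited by its
  global interpretations.
\<close>

locale linear_space = vector_space scale
  for scale :: "'a::field \<Rightarrow> 'b::ab_group_add \<Rightarrow> 'b" (infixr \<open>*s\<close> 75)
begin


definition functional :: "('b \<Rightarrow> 'a) \<Rightarrow> bool" where
  "functional f \<longleftrightarrow> (\<forall>x y. f (x + y) = f x + f y) \<and> (\<forall>c x. f (c *s x) = c * f x)"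

definition endo :: "('b \<Rightarrow> 'b) \<Rightarrow> bool" where
  "endo \<phi> \<longleftrightarrow> (\<forall>x y. \<phi> (x + y) = \<phi> x + \<phi> y) \<and> (\<forall>c x. \<phi> (c *s x) = c *s \<phi> x)"

text \<open>Values are vectors, not scalars: a functional f enters as u, v |-> f(u) v, so one notion
  of bilinear map serves for all Sweedler sums.\<close>

definition bilin :: "('b \<Rightarrow> 'b \<Rightarrow> 'b) \<Rightarrow> bool" where
  "bilin \<beta> \<longleftrightarrow> (\<forall>v. endo (\<lambda>u. \<beta> u v)) \<and> (\<forall>u. endo (\<beta> u))"

lemma functional_add: "functional f \<Longrightarrow> f (x + y) = f x + f y"
  and functional_scale: "functional f \<Longrightarrow> f (c *s x) = c * f x"
  by (auto simp: functional_def)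

lemma endo_add: "endo \<phi> \<Longrightarrow> \<phi> (x + y) = \<phi> x + \<phi> y"
  and endo_scale: "endo \<phi> \<Longrightarrow> \<phi> (c *s x) = c *s \<phi> x"
  by (auto simp: endo_def)

lemma functional_0: "functional f \<Longrightarrow> f 0 = 0"
  using functional_scale[of f 0 0] by simp

lemma endo_0: "endo \<phi> \<Longrightarrow> \<phi> 0 = 0"
  using endo_scale[of \<phi> 0 0] by simp

lemma functional_minus: "functional f \<Longrightarrow> f (- x) = - f x"
  using functional_scale[of f "-1" x] by simp

lemma endo_minus: "endo \<phi> \<Longrightarrow> \<phi> (- x) = - \<phi> x"
  using endo_scale[of \<phi> "-1" x] by simp

lemma functional_diff: "functional f \<Longrightarrow> f (x - y) = f x - f y"
  using functional_add[of f x "- y"] by (simp add: functional_minus)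

lemma endo_diff: "endo \<phi> \<Longrightarrow> \<phi> (x - y) = \<phi> x - \<phi> y"
  using endo_add[of \<phi> x "- y"] by (simp add: endo_minus)

lemma functional_sum: "functional f \<Longrightarrow> f (sum g A) = (\<Sum>x\<in>A. f (g x))"
  by (induction A rule: infinite_finite_induct) (auto simp: functional_0 functional_add)

lemma endo_sum: "endo \<phi> \<Longrightarrow> \<phi> (sum g A) = (\<Sum>x\<in>A. \<phi> (g x))"
  by (induction A rule: infinite_finite_induct) (auto simp: endo_0 endo_add)

lemma functional_comp: "functional f \<Longrightarrow> endo \<phi> \<Longrightarrow> functional (\<lambda>x. f (\<phi> x))"
  by (simp add: functional_def endo_def)

lemma functional_plus: "functional f \<Longrightarrow> functional g \<Longrightarrow> functional (\<lambda>x. f x + g x)"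
  by (simp add: functional_def algebra_simps)

lemma functional_minus_fun: "functional f \<Longrightarrow> functional g \<Longrightarrow> functional (\<lambda>x. f x - g x)"
  by (simp add: functional_def algebra_simps)

lemma functional_scale_fun: "functional f \<Longrightarrow> functional (\<lambda>x. c * f x)"
  by (simp add: functional_def algebra_simps)

lemma endo_comp: "endo \<phi> \<Longrightarrow> endo \<psi> \<Longrightarrow> endo (\<lambda>x. \<phi> (\<psi> x))"
  by (simp add: endo_def)

lemma endo_id: "endo (\<lambda>x. x)"
  by (simp add: endo_def)

lemma endo_plus: "endo \<phi> \<Longrightarrow> endo \<psi> \<Longrightarrow> endo (\<lambda>x. \<phi> x + \<psi> x)"
  by (simp add: endo_def algebra_simps)

lemma endo_minus_fun: "endo \<phi> \<Longrightarrow> endo \<psi> \<Longrightarrow> endo (\<lambda>x. \<phi> x - \<psi> x)"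
  by (simp add: endo_def algebra_simps)

lemma endo_scale_left: "functional f \<Longrightarrow> endo (\<lambda>x. f x *s y)"
  by (simp add: endo_def functional_def algebra_simps)

lemma endo_scale_right: "endo \<phi> \<Longrightarrow> endo (\<lambda>x. c *s \<phi> x)"
  by (simp add: endo_def scale_right_distrib scale_left_commute)

lemma bilinI: "(\<And>v. endo (\<lambda>u. \<beta> u v)) \<Longrightarrow> (\<And>u. endo (\<beta> u)) \<Longrightarrow> bilin \<beta>"
  by (simp add: bilin_def)

lemma bilin_left: "bilin \<beta> \<Longrightarrow> endo (\<lambda>u. \<beta> u v)"
  and bilin_right: "bilin \<beta> \<Longrightarrow> endo (\<beta> u)"
  by (auto simp: bilin_def)

lemma bilin_simps:
  assumes "bilin \<beta>"
  shows "\<beta> (x + y) z = \<beta> x z + \<beta> y z" "\<beta> z (x + y) = \<beta> z x + \<beta> z y"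
    "\<beta> (c *s x) z = c *s \<beta> x z" "\<beta> z (c *s x) = c *s \<beta> z x"
  using assms by (auto simp: bilin_def endo_def)

lemma endo_subspace_vimage: "endo \<phi> \<Longrightarrow> subspace T \<Longrightarrow> subspace {x. \<phi> x \<in> T}"
  by (auto simp: subspace_def endo_0 endo_add endo_scale)

lemma endo_subspace_image: "endo \<phi> \<Longrightarrow> subspace T \<Longrightarrow> subspace (\<phi> ` T)"
  unfolding subspace_def
  by (auto simp: image_iff) (metis endo_0, metis endo_add, metis endo_scale)

lemma endo_span: "endo \<phi> \<Longrightarrow> subspace T \<Longrightarrow> \<phi> ` X \<subseteq> T \<Longrightarrow> x \<in> span X \<Longrightarrow> \<phi> x \<in> T"
  using span_minimal[of X "{x. \<phi> x \<in> T}"] endo_subspace_vimage[of \<phi> T] by blast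

lemma functional_kernel: "functional f \<Longrightarrow> subspace {x. f x = 0}"
  by (auto simp: subspace_def functional_0 functional_add functional_scale)

lemma functional_span: "functional f \<Longrightarrow> (\<And>x. x \<in> X \<Longrightarrow> f x = 0) \<Longrightarrow> x \<in> span X \<Longrightarrow> f x = 0"
  using span_minimal[of X "{x. f x = 0}"] functional_kernel[of f] by blast

lemma functional_representation:
  assumes "independent X" "span X = UNIV"
  shows "functional (\<lambda>x. representation X x e)"
  unfolding functional_def
  using assms by (simp add: representation_add representation_scale)

section \<open>Dual coordinates, projections and dimension arguments\<close>

text \<open>\<open>C\<close> is a basis of T modulo S. A basis of S is extended to T and then to the
  whole space, so the coordinates at \<open>C\<close> are defined everywhere and vanish on S.
  Besides separating points, they become the dual functionals of the generators.\<close>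

lemma coordinates_relative:
  assumes "subspace S" "subspace T" "S \<subseteq> T"
  shows "\<exists>C \<delta>. C \<subseteq> T \<and> T \<subseteq> span (C \<union> S) \<and>
    (\<forall>c\<in>C. functional (\<delta> c) \<and> (\<forall>x\<in>S. \<delta> c x = 0) \<and> (\<forall>c'\<in>C. \<delta> c c' = (if c' = c then 1 else 0)))"
proof -
  obtain X where X: "X \<subseteq> S" "independent X" "S \<subseteq> span X"
    using maximal_independent_subset[of S] by blast
  obtain Y where Y: "X \<subseteq> Y" "Y \<subseteq> T" "independent Y" "T \<subseteq> span Y"
    using maximal_independent_subset_extend[of X T] X assms by blast
  obtain Z where Z: "Y \<subseteq> Z" "independent Z" "span Z = UNIV"
    using maximal_independent_subset_extend[of Y UNIV] Y(3) by (metis subset_UNIV top.extremum_uniqueI)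
  define C where "C = Y - X"
  define \<delta> where "\<delta> c x = representation Z x c" for c x
  have f: "functional (\<delta> c)" for c
    unfolding \<delta>_def by (rule functional_representation[OF Z(2,3)])
  have b: "\<delta> c x = (if x = c then 1 else 0)" if "x \<in> Z" for c x
    unfolding \<delta>_def using representation_basis[OF Z(2) that] by simp
  have "\<delta> c x = 0" if "c \<in> C" "x \<in> S" for c x
    by (rule functional_span[OF f, of X]) (use b that X Y Z C_def in auto)
  moreover have "T \<subseteq> span (C \<union> S)"
    using Y(4) span_mono[of Y "C \<union> S"] X unfolding C_def by blast
  moreover have "C \<subseteq> Z" "C \<subseteq> T" using Y Z unfolding C_def by auto
  ultimately have "C \<subseteq> T \<and> T \<subseteq> span (C \<union> S) \<and>
    (\<forall>c\<in>C. functional (\<delta> c) \<and> (\<forall>x\<in>S. \<delta> c x = 0) \<and> (\<forall>c'\<in>C. \<delta> c c' = (if c' = c then 1 else 0)))"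
    using f b by auto
  then show ?thesis by blast
qed

lemma separating_functional:
  assumes "subspace S" "x \<notin> S"
  shows "\<exists>f. functional f \<and> (\<forall>y\<in>S. f y = 0) \<and> f x \<noteq> 0"
proof -
  obtain C \<delta> where C: "UNIV \<subseteq> span (C \<union> S)"
    and \<delta>: "\<And>c. c \<in> C \<Longrightarrow> functional (\<delta> c)" "\<And>c y. c \<in> C \<Longrightarrow> y \<in> S \<Longrightarrow> \<delta> c y = 0"
      "\<And>c c'. c \<in> C \<Longrightarrow> c' \<in> C \<Longrightarrow> \<delta> c c' = (if c' = c then 1 else 0)"
    using coordinates_relative[OF assms(1) subspace_UNIV subset_UNIV] by blast
  obtain y z where y: "y \<in> span C" and z: "z \<in> S" and xyz: "x = y + z"
    using C assms(1) unfolding span_Un by (force simp: span_eq_iff[THEN iffD2])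
  then have "y \<noteq> 0" using assms(2) by auto
  obtain F u where F: "finite F" "F \<subseteq> C" and yu: "y = (\<Sum>c\<in>F. u c *s c)"
    using y unfolding span_explicit by blast
  have "\<exists>c\<in>F. u c \<noteq> 0"
  proof (rule ccontr)
    assume "\<not> (\<exists>c\<in>F. u c \<noteq> 0)"
    then have "y = 0" unfolding yu by simp
    with \<open>y \<noteq> 0\<close> show False ..
  qed
  then obtain c where c: "c \<in> F" "u c \<noteq> 0" by blast
  have "\<delta> c y = (\<Sum>c'\<in>F. u c' * \<delta> c c')"
    unfolding yu using \<delta>(1) c F by (auto simp: functional_sum functional_scale subset_iff)
  also have "\<dots> = (\<Sum>c'\<in>F. if c' = c then u c' else 0)"
  proof (rule sum.cong)
    fix c' assume "c' \<in> F"
    then show "u c' * \<delta> c c' = (if c' = c then u c' else 0)"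
      using \<delta>(3)[of c c'] c F(2) subsetD[OF F(2), of c] subsetD[OF F(2), of c'] by auto
  qed simp
  finally have "\<delta> c y = u c" using c F by simp
  moreover have "c \<in> C" using c F by blast
  ultimately have "\<delta> c x \<noteq> 0"
    using c(2) \<delta>(1,2)[OF \<open>c \<in> C\<close>] z xyz by (simp add: functional_add)
  then show ?thesis using \<delta> c F by blast
qed

lemma eq_by_functionals:
  assumes "\<And>f. functional f \<Longrightarrow> f x = f y"
  shows "x = y"
  using separating_functional[OF subspace_single_0, of "x - y"] assms
  by (fastforce simp: functional_diff)

lemma projection_exists:
  assumes "subspace S"
  shows "\<exists>\<phi>. endo \<phi> \<and> (\<forall>x. \<phi> x \<in> S) \<and> (\<forall>x\<in>S. \<phi> x = x)"
proof -
  obtain X where X: "X \<subseteq> S" "independent X" "S \<subseteq> span X"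
    using maximal_independent_subset[of S] by blast
  interpret vector_space_pair scale scale by unfold_locales
  obtain g where g: "Vector_Spaces.linear scale scale g" "\<And>x. x \<in> X \<Longrightarrow> g x = x"
    "range g = span ((\<lambda>x. x) ` X)"
    using linear_independent_extend_subspace[OF X(2), of "\<lambda>x. x"] by blast
  have e: "endo g" using g(1) by (auto simp: Vector_Spaces.linear_iff endo_def)
  have "g x = x" if "x \<in> S" for x
  proof -
    have "endo (\<lambda>x. g x - x)" using endo_minus_fun[OF e endo_id] .
    from endo_span[OF this subspace_single_0, of X x] show ?thesis
      using g X that by auto
  qed
  moreover have "g x \<in> S" for x
    using g(3) X assms by (metis image_ident range_eqI span_subspace)
  ultimately show ?thesis using e by blast
qed

lemma finite_coordinates:
  assumes "finite U"
  shows "\<exists>E h. finite E \<and> (\<forall>e. functional (h e)) \<and> (\<forall>u\<in>U. u = (\<Sum>e\<in>E. h e u *s e))"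
proof -
  obtain Z where Z: "independent Z" "span Z = UNIV"
    using maximal_independent_subset[of UNIV] by (metis top.extremum_uniqueI)
  define h where "h e u = representation Z u e" for e u
  define E where "E = (\<Union>u\<in>U. {e. h e u \<noteq> 0})"
  have fin: "finite {e. h e u \<noteq> 0}" for u
    unfolding h_def by (rule finite_representation)
  have "finite E" unfolding E_def using assms fin by blast
  moreover have "functional (h e)" for e
    unfolding h_def by (rule functional_representation[OF Z])
  moreover have "u = (\<Sum>e\<in>E. h e u *s e)" if "u \<in> U" for u
  proof -
    have "(\<Sum>e\<in>E. h e u *s e) = (\<Sum>e | h e u \<noteq> 0. h e u *s e)"
      using \<open>finite E\<close> that by (intro sum.mono_neutral_right) (auto simp: E_def)
    also have "\<dots> = u"
      unfolding h_def using sum_nonzero_representation_eq[OF Z(1)] Z(2) by simp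
    finally show ?thesis by simp
  qed
  ultimately show ?thesis by blast
qed

text \<open>Strict inclusion inside the finite-dimensional \<open>span U\<close> strictly raises
  \<open>dim\<close>, so a member of extreme dimension is extremal for inclusion. This supplies the
  simple subcoalgebras and the maximal coideals.\<close>

lemma finite_span_minimal_maximal_subspace:
  assumes "finite U" "\<And>S. S \<in> \<S> \<Longrightarrow> subspace S" "\<And>S. S \<in> \<S> \<Longrightarrow> S \<subseteq> span U" "S0 \<in> \<S>"
  shows "\<exists>S\<in>\<S>. \<forall>T\<in>\<S>. T \<subseteq> S \<longrightarrow> T = S" "\<exists>S\<in>\<S>. \<forall>T\<in>\<S>. S \<subseteq> T \<longrightarrow> T = S"
proof -
  have strict: "dim S < dim T" if "S \<in> \<S>" "T \<in> \<S>" "S \<subset> T" for S T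
  proof -
    have S: "subspace S" and T: "subspace T" "T \<subseteq> span U" using assms(2,3) that by auto
    obtain X where X: "X \<subseteq> S" "independent X" "S \<subseteq> span X"
      using maximal_independent_subset[of S] by blast
    obtain Y where Y: "X \<subseteq> Y" "Y \<subseteq> T" "independent Y" "T \<subseteq> span Y"
      using maximal_independent_subset_extend[of X T] X \<open>S \<subset> T\<close> by blast
    have "X \<noteq> Y" using X Y S \<open>S \<subset> T\<close> by (metis psubset_eq span_minimal subset_antisym order_trans)
    moreover have "finite Y"
      using independent_span_bound[OF assms(1) Y(3)] Y(2) T(2) by blast
    ultimately have "card X < card Y" using Y(1) psubset_card_mono[of Y X] by blast
    moreover have "dim S = card X" "dim T = card Y"
      using basis_card_eq_dim X Y by metis+
    ultimately show ?thesis by simp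
  qed
  have bd: "dim S < Suc (card U)" if "S \<in> \<S>" for S
    using dim_le_card[OF _ assms(1), of S] assms(3)[OF that] by simp
  note S0 = assms(4)
  show "\<exists>S\<in>\<S>. \<forall>T\<in>\<S>. T \<subseteq> S \<longrightarrow> T = S"
    using ex_has_least_nat[of "\<lambda>S. S \<in> \<S>" S0 dim] S0 strict
    by (metis leD psubsetI)
  show "\<exists>S\<in>\<S>. \<forall>T\<in>\<S>. S \<subseteq> T \<longrightarrow> T = S"
    using ex_has_greatest_nat[of "\<lambda>S. S \<in> \<S>" S0 dim "Suc (card U)"] S0 strict bd
    by (metis leD less_imp_le psubsetI)
qed

end


section \<open>Formal sums and the tensor square\<close>

lemma lin_ext_superset:
  assumes "vector_space sc" "finite F" "Poly_Mapping.keys t \<subseteq> F"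
  shows "lin_ext sc f t = (\<Sum>i\<in>F. sc (Poly_Mapping.lookup t i) (f i))"
proof -
  interpret vector_space sc by fact
  show ?thesis unfolding lin_ext_def
    by (rule sum.mono_neutral_left) (use assms in \<open>auto simp: in_keys_iff\<close>)
qed

lemma lin_ext_add:
  assumes "vector_space sc"
  shows "lin_ext sc f (s + t) = lin_ext sc f s + lin_ext sc f t"
proof -
  interpret vector_space sc by fact
  let ?F = "Poly_Mapping.keys s \<union> Poly_Mapping.keys t"
  have "Poly_Mapping.keys (s + t) \<subseteq> ?F" by (rule keys_add)
  then show ?thesis
    using lin_ext_superset[OF assms, of ?F]
    by (simp add: lookup_add scale_left_distrib sum.distrib)
qed

lemma lin_ext_formal_scale:
  assumes "vector_space sc"
  shows "lin_ext sc f (formal_scale c t) = sc c (lin_ext sc f t)"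
proof -
  interpret vector_space sc by fact
  have "Poly_Mapping.keys (formal_scale c t) \<subseteq> Poly_Mapping.keys t"
    by (auto simp: in_keys_iff)
  then show ?thesis
    using lin_ext_superset[OF assms, of "Poly_Mapping.keys t"]
    by (simp add: scale_sum_right)
qed

lemma lin_ext_single:
  assumes "vector_space sc"
  shows "lin_ext sc f (Poly_Mapping.single i c) = sc c (f i)"
proof -
  interpret vector_space sc by fact
  show ?thesis
    using lin_ext_superset[OF assms, of "{i}" "Poly_Mapping.single i c"] by auto
qed

lemma lin_ext_zero: "lin_ext sc f 0 = 0"
  by (simp add: lin_ext_def)

lemma lin_ext_minus:
  assumes "vector_space sc"
  shows "lin_ext sc f (s - t) = lin_ext sc f s - lin_ext sc f t"
  using lin_ext_add[OF assms, of f "s - t" t] by simp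

lemma lin_ext_sum:
  assumes "vector_space sc"
  shows "lin_ext sc f (sum g A) = (\<Sum>a\<in>A. lin_ext sc f (g a))"
  by (induction A rule: infinite_finite_induct) (auto simp: lin_ext_zero lin_ext_add[OF assms])

lemma lin_ext_lin_ext:
  assumes "vector_space sc"
  shows "lin_ext sc f (lin_ext formal_scale g t) = lin_ext sc (\<lambda>i. lin_ext sc f (g i)) t"
  by (simp add: lin_ext_def[of formal_scale] lin_ext_sum[OF assms] lin_ext_formal_scale[OF assms])
    (simp add: lin_ext_def)

lemma lin_ext_single_self: "lin_ext formal_scale (\<lambda>i. Poly_Mapping.single i 1) t = t"
proof (rule poly_mapping_eqI)
  fix k
  have "Poly_Mapping.lookup (lin_ext formal_scale (\<lambda>i. Poly_Mapping.single i 1) t) k =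
     (\<Sum>i\<in>Poly_Mapping.keys t. if i = k then Poly_Mapping.lookup t i else 0)"
    unfolding lin_ext_def lookup_sum by (rule sum.cong) (auto simp: lookup_single when_def)
  then show "Poly_Mapping.lookup (lin_ext formal_scale (\<lambda>i. Poly_Mapping.single i 1) t) k
      = Poly_Mapping.lookup t k"
    by (simp add: in_keys_iff)
qed

context linear_space
begin

lemma lin_ext_in_subspace:
  assumes "subspace T" "\<And>i. i \<in> Poly_Mapping.keys t \<Longrightarrow> f i \<in> T"
  shows "lin_ext scale f t \<in> T"
  unfolding lin_ext_def using assms by (intro subspace_sum subspace_scale) auto

lemma endo_lin_ext: "endo \<phi> \<Longrightarrow> \<phi> (lin_ext scale f t) = lin_ext scale (\<lambda>i. \<phi> (f i)) t"
  by (simp add: lin_ext_def endo_sum endo_scale)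

text \<open>Linearity of \<beta> in each slot sends every relator to 0; this is what makes a
  Sweedler sum independent of the chosen expression.\<close>

lemma lin_ext_null2:
  assumes "bilin \<beta>" "t \<in> tensor2_null scale"
  shows "lin_ext scale (\<lambda>(u, v). \<beta> u v) t = 0"
proof -
  let ?L = "lin_ext scale (\<lambda>(u, v). \<beta> u v)"
  note vs = vector_space_axioms
  note l = lin_ext_add[OF vs] lin_ext_minus[OF vs] lin_ext_single[OF vs] lin_ext_formal_scale[OF vs]
  have "formal.subspace {t. ?L t = 0}"
    by (auto simp: formal.subspace_def l lin_ext_zero)
  moreover have "(\<Union>z. linearity_relators scale (\<lambda>x. (x, z)) \<union> linearity_relators scale (\<lambda>x. (z, x)))
     \<subseteq> {t. ?L t = 0}"
    unfolding linearity_relators_def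
    by (auto simp: l bilin_simps[OF assms(1)])
  ultimately show ?thesis
    using assms(2) formal.span_minimal unfolding tensor2_null_def by blast
qed

lemma lin_ext_null3:
  assumes "\<And>v w. endo (\<lambda>u. \<gamma> u v w)" "\<And>u w. endo (\<lambda>v. \<gamma> u v w)" "\<And>u v. endo (\<gamma> u v)"
    and "t \<in> tensor3_null scale"
  shows "lin_ext scale (\<lambda>(u, v, w). \<gamma> u v w) t = 0"
proof -
  let ?L = "lin_ext scale (\<lambda>(u, v, w). \<gamma> u v w)"
  note vs = vector_space_axioms
  note l = lin_ext_add[OF vs] lin_ext_minus[OF vs] lin_ext_single[OF vs] lin_ext_formal_scale[OF vs]
  have "formal.subspace {t. ?L t = 0}"
    by (auto simp: formal.subspace_def l lin_ext_zero)
  moreover have "(\<Union>y z. linearity_relators scale (\<lambda>x. (x, y, z)) \<union> linearity_relators scale (\<lambda>x. (y, x, z))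
     \<union> linearity_relators scale (\<lambda>x. (y, z, x))) \<subseteq> {t. ?L t = 0}"
    using assms(1-3)[THEN endo_add] assms(1-3)[THEN endo_scale] unfolding linearity_relators_def
    by (auto simp: l)
  ultimately show ?thesis
    using assms(4) formal.span_minimal unfolding tensor3_null_def by blast
qed

section \<open>Congruence modulo the bilinearity relations\<close>

lemma subspace_tensor2_null: "formal.subspace (tensor2_null scale)"
  unfolding tensor2_null_def by (rule formal.subspace_span)

abbreviation tens :: "'b \<Rightarrow> 'b \<Rightarrow> ('b \<times> 'b \<Rightarrow>\<^sub>0 'a)" where
  "tens u v \<equiv> Poly_Mapping.single (u, v) 1"

lemma single_eq_scale: "Poly_Mapping.single i c = formal_scale c (Poly_Mapping.single i 1)"
  by (rule poly_mapping_eqI) (simp add: lookup_single when_def)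

lemma tens_linear_mod_null:
  "tens (x + y) z - tens x z - tens y z \<in> tensor2_null scale"
  "tens z (x + y) - tens z x - tens z y \<in> tensor2_null scale"
  "tens (c *s x) z - formal_scale c (tens x z) \<in> tensor2_null scale"
  "tens z (c *s x) - formal_scale c (tens z x) \<in> tensor2_null scale"
  unfolding tensor2_null_def single_eq_scale[of _ c, symmetric]
  by (rule formal.span_base, force simp: linearity_relators_def)+

lemma tens_0_null: "tens 0 z \<in> tensor2_null scale" "tens z 0 \<in> tensor2_null scale"
proof -
  have "formal_scale 0 t = 0" for t :: "'b \<times> 'b \<Rightarrow>\<^sub>0 'a"
    by (rule formal.scale_zero_left)
  then show "tens 0 z \<in> tensor2_null scale" "tens z 0 \<in> tensor2_null scale"
    using tens_linear_mod_null(3)[of 0 0 z] tens_linear_mod_null(4)[of z 0 0] by simp_all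
qed

lemma null_trans:
  "r - s \<in> tensor2_null scale \<Longrightarrow> s - t \<in> tensor2_null scale \<Longrightarrow> r - t \<in> tensor2_null scale"
  using formal.subspace_add[OF subspace_tensor2_null, of "r - s" "s - t"] by simp

lemma tens_sum_mod_null:
  assumes "finite E"
  shows "tens (\<Sum>e\<in>E. c e *s g e) v - (\<Sum>e\<in>E. formal_scale (c e) (tens (g e) v)) \<in> tensor2_null scale"
    and "tens v (\<Sum>e\<in>E. c e *s g e) - (\<Sum>e\<in>E. formal_scale (c e) (tens v (g e))) \<in> tensor2_null scale"
proof -
  show "tens (\<Sum>e\<in>E. c e *s g e) v - (\<Sum>e\<in>E. formal_scale (c e) (tens (g e) v)) \<in> tensor2_null scale"
    using assms
  proof induction
    case (insert e E)
    from formal.subspace_add[OF subspace_tensor2_null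
        formal.subspace_add[OF subspace_tensor2_null
          tens_linear_mod_null(1)[of "c e *s g e" "\<Sum>e\<in>E. c e *s g e" v]
          tens_linear_mod_null(3)[of "c e" "g e" v]] insert.IH]
    show ?case using insert.hyps by (simp add: algebra_simps)
  qed (simp add: tens_0_null)
  show "tens v (\<Sum>e\<in>E. c e *s g e) - (\<Sum>e\<in>E. formal_scale (c e) (tens v (g e))) \<in> tensor2_null scale"
    using assms
  proof induction
    case (insert e E)
    from formal.subspace_add[OF subspace_tensor2_null
        formal.subspace_add[OF subspace_tensor2_null
          tens_linear_mod_null(2)[of v "c e *s g e" "\<Sum>e\<in>E. c e *s g e"]
          tens_linear_mod_null(4)[of v "c e" "g e"]] insert.IH]
    show ?case using insert.hyps by (simp add: algebra_simps)
  qed (simp add: tens_0_null)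
qed

text \<open>Expand all first factors in a common finite family \<open>E\<close>. Modulo the
  relations t becomes the sum over e of e \<otimes> w_e, where w_e is the value of
  \<open>h e\<close> \<otimes> id on t and so is 0.\<close>

lemma tensor2_null_if_functionals:
  assumes "\<And>f. functional f \<Longrightarrow> lin_ext scale (\<lambda>(u, v). f u *s v) t = 0"
  shows "t \<in> tensor2_null scale"
proof -
  let ?K = "Poly_Mapping.keys t" and ?c = "Poly_Mapping.lookup t"
  obtain E h where E: "finite E" "\<And>e. functional (h e)"
    and rep: "\<And>u. u \<in> fst ` ?K \<Longrightarrow> u = (\<Sum>e\<in>E. h e u *s e)"
    using finite_coordinates[of "fst ` ?K"] by auto
  note N = subspace_tensor2_null
  have "t - (\<Sum>k\<in>?K. formal_scale (?c k) (\<Sum>e\<in>E. formal_scale (h e (fst k)) (tens e (snd k))))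
     = (\<Sum>k\<in>?K. formal_scale (?c k)
          (tens (fst k) (snd k) - (\<Sum>e\<in>E. formal_scale (h e (fst k)) (tens e (snd k)))))"
    by (subst (1) lin_ext_single_self[of t, symmetric])
      (simp add: lin_ext_def sum_subtractf[symmetric] formal.scale_right_diff_distrib)
  also have "\<dots> \<in> tensor2_null scale"
  proof (intro formal.subspace_sum[OF N] formal.subspace_scale[OF N])
    fix k assume "k \<in> ?K"
    then have "fst k = (\<Sum>e\<in>E. h e (fst k) *s e)" using rep by blast
    then show "tens (fst k) (snd k) - (\<Sum>e\<in>E. formal_scale (h e (fst k)) (tens e (snd k)))
        \<in> tensor2_null scale"
      using tens_sum_mod_null(1)[OF E(1), of "\<lambda>e. h e (fst k)" "\<lambda>e. e" "snd k"] by simp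
  qed
  finally have 1: "t - (\<Sum>k\<in>?K. formal_scale (?c k)
      (\<Sum>e\<in>E. formal_scale (h e (fst k)) (tens e (snd k)))) \<in> tensor2_null scale" .
  have "(\<Sum>k\<in>?K. formal_scale (?c k) (\<Sum>e\<in>E. formal_scale (h e (fst k)) (tens e (snd k))))
      = (\<Sum>e\<in>E. \<Sum>k\<in>?K. formal_scale (?c k * h e (fst k)) (tens e (snd k)))"
    by (simp add: formal.scale_sum_right) (rule sum.swap)
  also have "\<dots> \<in> tensor2_null scale"
  proof (rule formal.subspace_sum[OF N])
    fix e assume "e \<in> E"
    have "(\<Sum>k\<in>?K. (?c k * h e (fst k)) *s snd k) = 0"
      using assms[OF E(2)[of e]] by (simp add: lin_ext_def case_prod_unfold)
    then have "tens e 0 - (\<Sum>k\<in>?K. formal_scale (?c k * h e (fst k)) (tens e (snd k)))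
        \<in> tensor2_null scale"
      using tens_sum_mod_null(2)[of ?K e "\<lambda>k. ?c k * h e (fst k)" snd] by simp
    from formal.subspace_diff[OF N tens_0_null(2)[of e] this]
    show "(\<Sum>k\<in>?K. formal_scale (?c k * h e (fst k)) (tens e (snd k))) \<in> tensor2_null scale"
      by simp
  qed
  finally have 2: "(\<Sum>k\<in>?K. formal_scale (?c k)
      (\<Sum>e\<in>E. formal_scale (h e (fst k)) (tens e (snd k)))) \<in> tensor2_null scale" .
  show ?thesis
    using formal.subspace_add[OF N 1 2] by simp
qed

end

section \<open>Sweedler calculus\<close>

sublocale coalgebra \<subseteq> linear_space scale
  by unfold_locales

context coalgebra
begin

lemma ex_comult: "\<exists>t. t \<in> comult x"
proof -
  obtain t where "comult x = {(s, t). s - t \<in> tensor2_null scale} `` {t}"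
    using comult_in[of x] unfolding tensor2_def by (rule quotientE)
  then have "t \<in> comult x"
    using formal.subspace_0[OF subspace_tensor2_null] by simp
  then show ?thesis ..
qed

lemma comult_cong:
  assumes "s \<in> comult x"
  shows "t \<in> comult x \<longleftrightarrow> s - t \<in> tensor2_null scale"
proof -
  obtain r where r: "comult x = {(s, t). s - t \<in> tensor2_null scale} `` {r}"
    using comult_in[of x] unfolding tensor2_def by (rule quotientE)
  have "r - s \<in> tensor2_null scale" using assms r by simp
  moreover from this have "s - r \<in> tensor2_null scale"
    using formal.subspace_neg[OF subspace_tensor2_null] by fastforce
  ultimately show ?thesis
    unfolding r using null_trans[of r s t] null_trans[of s r t] by auto
qed

text \<open>The chosen expression need not depend linearly on x; linearity returns after a bilinear
  map is applied, by \<open>endo_sw\<close>.\<close>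

definition comult_rep :: "'h \<Rightarrow> ('h \<times> 'h \<Rightarrow>\<^sub>0 'k)" where
  "comult_rep x = (SOME t. t \<in> comult x)"

lemma comult_rep: "comult_rep x \<in> comult x"
  unfolding comult_rep_def using ex_comult by (rule someI_ex)

text \<open>\<open>sw \<beta> x\<close> is \<open>\<Sum> \<beta>(x\<^bsub>(1)\<^esub>, x\<^bsub>(2)\<^esub>)\<close>.\<close>

definition sw :: "('h \<Rightarrow> 'h \<Rightarrow> 'h) \<Rightarrow> 'h \<Rightarrow> 'h" where
  "sw \<beta> x = lin_ext scale (\<lambda>(u, v). \<beta> u v) (comult_rep x)"

lemma sw_eq:
  assumes "bilin \<beta>" "t \<in> comult x"
  shows "sw \<beta> x = lin_ext scale (\<lambda>(u, v). \<beta> u v) t"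
  using lin_ext_null2[OF assms(1)] comult_cong[OF comult_rep] assms(2)
    lin_ext_minus[OF vector_space_axioms]
  unfolding sw_def by (metis eq_iff_diff_eq_0)

lemma endo_sw:
  assumes "bilin \<beta>"
  shows "endo (sw \<beta>)"
  unfolding endo_def
proof (intro conjI allI)
  fix x y c
  show "sw \<beta> (x + y) = sw \<beta> x + sw \<beta> y"
    unfolding sw_eq[OF assms comult_add[OF comult_rep comult_rep]]
    by (simp add: sw_def lin_ext_add[OF vector_space_axioms])
  show "sw \<beta> (scale c x) = scale c (sw \<beta> x)"
    unfolding sw_eq[OF assms comult_scale[OF comult_rep]]
    by (simp add: sw_def lin_ext_formal_scale[OF vector_space_axioms])
qed

lemma sw_plus_fun: "sw (\<lambda>u v. \<beta> u v + \<gamma> u v) x = sw \<beta> x + sw \<gamma> x"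
  by (simp add: sw_def lin_ext_def case_prod_unfold scale_right_distrib sum.distrib)

lemma sw_minus_fun: "sw (\<lambda>u v. \<beta> u v - \<gamma> u v) x = sw \<beta> x - sw \<gamma> x"
  by (simp add: sw_def lin_ext_def case_prod_unfold scale_right_diff_distrib sum_subtractf)

lemma sw_sum_fun: "sw (\<lambda>u v. \<Sum>i\<in>A. \<beta> i u v) x = (\<Sum>i\<in>A. sw (\<beta> i) x)"
  unfolding sw_def lin_ext_def case_prod_unfold scale_sum_right by (rule sum.swap)

lemma endo_apply_sw: "endo \<phi> \<Longrightarrow> \<phi> (sw \<beta> x) = sw (\<lambda>u v. \<phi> (\<beta> u v)) x"
  unfolding sw_def by (simp add: endo_lin_ext case_prod_unfold)

lemma scale_sw: "scale c (sw \<beta> x) = sw (\<lambda>u v. scale c (\<beta> u v)) x"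
  by (rule endo_apply_sw[OF endo_scale_right[OF endo_id]])

lemma endo_sw_fun:
  assumes "\<And>u v. endo (\<lambda>x. \<beta> x u v)"
  shows "endo (\<lambda>x. sw (\<beta> x) y)"
proof -
  have "\<beta> (x + y) = (\<lambda>u v. \<beta> x u v + \<beta> y u v)" "\<beta> (scale c x) = (\<lambda>u v. scale c (\<beta> x u v))" for x y c
    using endo_add[OF assms] endo_scale[OF assms] by blast+
  then show ?thesis by (simp add: endo_def sw_plus_fun scale_sw)
qed

lemma sw_in_subspace:
  assumes "subspace T" "\<And>u v. \<beta> u v \<in> T"
  shows "sw \<beta> x \<in> T"
  unfolding sw_def by (rule lin_ext_in_subspace[OF assms(1)]) (auto simp: assms(2))

lemma sw_zero_fun: "sw (\<lambda>u v. 0) x = 0"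
  by (simp add: sw_def lin_ext_def case_prod_unfold)

text \<open>\<open>coassoc\<close> is applied to the chosen expressions \<open>comult_rep\<close>,
  and the trilinear map \<gamma> kills the resulting element of \<open>tensor3_null\<close>.\<close>

lemma sw_assoc:
  assumes "\<And>v w. endo (\<lambda>u. \<gamma> u v w)" "\<And>u w. endo (\<lambda>v. \<gamma> u v w)" "\<And>u v. endo (\<gamma> u v)"
  shows "sw (\<lambda>u w. sw (\<lambda>u1 u2. \<gamma> u1 u2 w) u) x = sw (\<lambda>u w. sw (\<gamma> u) w) x"
proof -
  note vs = vector_space_axioms
  from lin_ext_null3[OF assms coassoc[of comult_rep, OF comult_rep, of x]]
  have "lin_ext scale (\<lambda>(u, v, w). \<gamma> u v w) (lin_ext formal_scale
          (\<lambda>(u, v). lin_ext formal_scale (\<lambda>(u1, u2). Poly_Mapping.single (u1, u2, v) 1) (comult_rep u))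
           (comult_rep x))
      = lin_ext scale (\<lambda>(u, v, w). \<gamma> u v w) (lin_ext formal_scale
          (\<lambda>(u, v). lin_ext formal_scale (\<lambda>(v1, v2). Poly_Mapping.single (u, v1, v2) 1) (comult_rep v))
           (comult_rep x))"
    by (simp add: lin_ext_minus[OF vs])
  then show ?thesis
    unfolding sw_def lin_ext_lin_ext[OF vs] case_prod_unfold
    by (simp add: lin_ext_lin_ext[OF vs] lin_ext_single[OF vs])
qed

section \<open>The two actions of the convolution dual\<close>

lemma functional_counit: "functional counit"
  using counit_linear by (auto simp: Vector_Spaces.linear_iff functional_def)

lemma bilin_scale_left: "functional f \<Longrightarrow> endo \<phi> \<Longrightarrow> bilin (\<lambda>u v. scale (f u) (\<phi> v))"
  by (intro bilinI endo_scale_left endo_scale_right)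

lemma bilin_scale_right: "functional f \<Longrightarrow> endo \<phi> \<Longrightarrow> bilin (\<lambda>u v. scale (f v) (\<phi> u))"
  by (intro bilinI endo_scale_left endo_scale_right)

text \<open>The left module structure over the convolution dual. The product of f and g has no name
  of its own; it appears below as \<open>\<lambda>y. f (lact g y)\<close>. A subspace stable under
  \<open>lact\<close> is a right coideal.\<close>

definition lact :: "('h \<Rightarrow> 'k) \<Rightarrow> 'h \<Rightarrow> 'h" where
  "lact f = sw (\<lambda>u v. scale (f v) u)"

definition ract :: "('h \<Rightarrow> 'k) \<Rightarrow> 'h \<Rightarrow> 'h" where
  "ract f = sw (\<lambda>u v. scale (f u) v)"

lemma endo_lact: "functional f \<Longrightarrow> endo (lact f)"
  unfolding lact_def by (intro endo_sw bilin_scale_right endo_id)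

lemma endo_ract: "functional f \<Longrightarrow> endo (ract f)"
  unfolding ract_def by (intro endo_sw bilin_scale_left endo_id)

lemma lact_counit: "lact counit x = x"
  unfolding lact_def sw_def by (rule counit_right[OF comult_rep])

lemma ract_counit: "ract counit x = x"
  unfolding ract_def sw_def by (rule counit_left[OF comult_rep])

lemma lact_plus: "lact (\<lambda>x. f x + g x) x = lact f x + lact g x"
  unfolding lact_def by (simp add: scale_left_distrib sw_plus_fun)

lemma lact_minus: "lact (\<lambda>x. f x - g x) x = lact f x - lact g x"
  unfolding lact_def by (simp add: scale_left_diff_distrib sw_minus_fun)

lemma lact_scale_fun: "lact (\<lambda>x. c * f x) x = scale c (lact f x)"
  unfolding lact_def scale_sw by simp

lemma ract_minus: "ract (\<lambda>x. f x - g x) x = ract f x - ract g x"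
  unfolding ract_def sw_minus_fun[symmetric]
  by (rule arg_cong[of _ _ "\<lambda>\<beta>. sw \<beta> x"]) (simp add: fun_eq_iff scale_left_diff_distrib)

text \<open>Both sides are the convolution product of f and g at x, the sum of f(x_1) g(x_2). It
  trades one action for the other whenever an identity is tested with functionals.\<close>

lemma functional_lact_eq_ract:
  assumes "functional f" "functional g"
  shows "f (lact g x) = g (ract f x)"
  unfolding lact_def ract_def sw_def lin_ext_def
  using assms by (simp add: functional_sum functional_scale case_prod_unfold mult_ac)

text \<open>Coassociativity in the language of actions: both sides are the sum of f(x_1) g(x_3)
  x_2.\<close>

lemma lact_ract: 
  assumes f: "functional f" and g: "functional g"
  shows "lact g (ract f x) = ract f (lact g x)"
proof -
  have "lact g (ract f x) = sw (\<lambda>u v. scale (f u) (lact g v)) x"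
    unfolding ract_def using endo_apply_sw[OF endo_lact[OF g]] endo_lact[OF g]
    by (simp add: endo_scale)
  also have "\<dots> = sw (\<lambda>u w. sw (\<lambda>v1 v2. scale (f u * g v2) v1) w) x"
    unfolding lact_def scale_sw by simp
  also have "\<dots> = sw (\<lambda>u w. sw (\<lambda>u1 u2. scale (f u1 * g w) u2) u) x"
  proof (rule sw_assoc[symmetric])
    show "endo (\<lambda>u. scale (f u * g w) v)" for v w
      using f by (auto simp: endo_def functional_def algebra_simps)
    show "endo (\<lambda>v. scale (f u * g w) v)" for u w
      by (intro endo_scale_right endo_id)
    show "endo (\<lambda>w. scale (f u * g w) v)" for u v
      using g by (auto simp: endo_def functional_def algebra_simps)
  qed
  also have "\<dots> = sw (\<lambda>u w. scale (g w) (ract f u)) x"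
    unfolding ract_def scale_sw by (simp add: mult.commute)
  also have "\<dots> = ract f (lact g x)"
    unfolding lact_def using endo_apply_sw[OF endo_ract[OF f]] endo_ract[OF f]
    by (simp add: endo_scale)
  finally show ?thesis .
qed

text \<open>Tested with \<open>h\<close>, the outer action turns into \<open>ract h\<close>, which
  passes through \<open>lact g\<close>; the module axiom thus follows from the commuting actions
  without a further Sweedler computation.\<close>

lemma lact_lact:
  assumes f: "functional f" and g: "functional g"
  shows "lact f (lact g x) = lact (\<lambda>y. f (lact g y)) x"
proof (rule eq_by_functionals)
  fix h assume h: "functional h"
  have "h (lact f (lact g x)) = f (lact g (ract h x))"
    by (simp add: functional_lact_eq_ract[OF h f] lact_ract[OF h g])
  also have "\<dots> = h (lact (\<lambda>y. f (lact g y)) x)"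
    using functional_lact_eq_ract[OF h functional_comp[OF f endo_lact[OF g]]] by simp
  finally show "h (lact f (lact g x)) = h (lact (\<lambda>y. f (lact g y)) x)" .
qed

lemma ract_ract:
  assumes f: "functional f" and g: "functional g"
  shows "ract f (ract g x) = ract (\<lambda>y. f (ract g y)) x"
proof (rule eq_by_functionals)
  fix h assume h: "functional h"
  have "h (ract f (ract g x)) = f (ract g (lact h x))"
    using functional_lact_eq_ract[OF f h, of "ract g x"] lact_ract[OF g h, of x] by simp
  also have "\<dots> = h (ract (\<lambda>y. f (ract g y)) x)"
    using functional_lact_eq_ract[OF functional_comp[OF f endo_ract[OF g]] h] by simp
  finally show "h (ract f (ract g x)) = h (ract (\<lambda>y. f (ract g y)) x)" .
qed

text \<open>Recovers f from its action: \<open>lact f x = 0\<close> forces \<open>f x = 0\<close>,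
  which turns statements about annihilators into statements about membership.\<close>

lemma counit_lact: "functional f \<Longrightarrow> counit (lact f x) = f x"
  using functional_lact_eq_ract[OF functional_counit] ract_counit by simp

lemma counit_ract: "functional f \<Longrightarrow> counit (ract f x) = f x"
  using functional_lact_eq_ract[OF _ functional_counit] lact_counit by metis

text \<open>The last hypothesis says that every f \<otimes> id kills the image of \<Delta>(x) under
  \<phi> \<otimes> \<psi>; that image is therefore a null tensor, and \<beta> kills it.\<close>

lemma sw_eq_0_by_functionals:
  assumes "bilin \<beta>" "endo \<phi>" "endo \<psi>"
    and "\<And>f. functional f \<Longrightarrow> \<psi> (ract (\<lambda>x. f (\<phi> x)) x) = 0"
  shows "sw (\<lambda>u v. \<beta> (\<phi> u) (\<psi> v)) x = 0"
proof -
  note vs = vector_space_axioms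
  define t where "t = lin_ext formal_scale (\<lambda>(u, v). tens (\<phi> u) (\<psi> v)) (comult_rep x)"
  have L: "lin_ext scale (\<lambda>(u, v). \<gamma> u v) t = sw (\<lambda>u v. \<gamma> (\<phi> u) (\<psi> v)) x" for \<gamma>
    unfolding t_def sw_def lin_ext_lin_ext[OF vs] case_prod_unfold
    by (simp add: lin_ext_single[OF vs])
  have "lin_ext scale (\<lambda>(u, v). scale (f u) v) t = 0" if "functional f" for f
    using assms(4)[OF that] assms(3) unfolding L ract_def
    by (simp add: endo_apply_sw endo_scale)
  then have "t \<in> tensor2_null scale" by (rule tensor2_null_if_functionals)
  from lin_ext_null2[OF assms(1) this] show ?thesis unfolding L .
qed

section \<open>Stable subspaces and subcoalgebras\<close>

definition lstable :: "'h set \<Rightarrow> bool" where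
  "lstable D \<longleftrightarrow> (\<forall>f x. functional f \<and> x \<in> D \<longrightarrow> lact f x \<in> D)"

definition rstable :: "'h set \<Rightarrow> bool" where
  "rstable D \<longleftrightarrow> (\<forall>f x. functional f \<and> x \<in> D \<longrightarrow> ract f x \<in> D)"

lemma lstableD: "lstable D \<Longrightarrow> functional f \<Longrightarrow> x \<in> D \<Longrightarrow> lact f x \<in> D"
  and rstableD: "rstable D \<Longrightarrow> functional f \<Longrightarrow> x \<in> D \<Longrightarrow> ract f x \<in> D"
  by (auto simp: lstable_def rstable_def)

text \<open>Testing \<open>ract f x\<close> with g evaluates f at \<open>lact g x\<close>; hence the
  right action calls for stability under the left one.\<close>

lemma ract_eq_0:
  assumes "lstable D" "functional f" "\<And>y. y \<in> D \<Longrightarrow> f y = 0" "x \<in> D"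
  shows "ract f x = 0"
proof (rule eq_by_functionals)
  fix g assume g: "functional g"
  have "f (lact g x) = 0" using assms lstableD g by blast
  then show "g (ract f x) = g 0"
    by (simp add: functional_lact_eq_ract[OF assms(2) g] functional_0[OF g])
qed

lemma lact_eq_0:
  assumes "rstable D" "functional f" "\<And>y. y \<in> D \<Longrightarrow> f y = 0" "x \<in> D"
  shows "lact f x = 0"
proof (rule eq_by_functionals)
  fix g assume g: "functional g"
  have "f (ract g x) = 0" using assms rstableD g by blast
  then show "g (lact f x) = g 0"
    by (simp add: functional_lact_eq_ract[OF g assms(2)] functional_0[OF g])
qed

text \<open>To get an expression of \<Delta>(x) inside D, apply a projection p onto D to both
  factors of any expression. On the first factor, f and f o p agree on D and so act alike on x; on
  the second, \<open>ract f x\<close> already lies in D. Hence the class of the tensor is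
  unchanged.\<close>

lemma subcoalgebra_iff_stable: "subcoalgebra D \<longleftrightarrow> subspace D \<and> lstable D \<and> rstable D"
proof (intro iffI conjI)
  assume D: "subcoalgebra D"
  then show sub: "subspace D" by (simp add: subcoalgebra_def)
  show "lstable D" unfolding lstable_def
  proof (intro allI impI, elim conjE)
    fix f x assume f: "functional f" and x: "x \<in> D"
    obtain t where t: "t \<in> comult x" "Poly_Mapping.keys t \<subseteq> D \<times> D"
      using D x by (auto simp: subcoalgebra_def)
    show "lact f x \<in> D"
      unfolding lact_def sw_eq[OF bilin_scale_right[OF f endo_id] t(1)]
      by (rule lin_ext_in_subspace[OF sub]) (use t(2) sub in \<open>auto intro: subspace_scale\<close>)
  qed
  show "rstable D" unfolding rstable_def
  proof (intro allI impI, elim conjE)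
    fix f x assume f: "functional f" and x: "x \<in> D"
    obtain t where t: "t \<in> comult x" "Poly_Mapping.keys t \<subseteq> D \<times> D"
      using D x by (auto simp: subcoalgebra_def)
    show "ract f x \<in> D"
      unfolding ract_def sw_eq[OF bilin_scale_left[OF f endo_id] t(1)]
      by (rule lin_ext_in_subspace[OF sub]) (use t(2) sub in \<open>auto intro: subspace_scale\<close>)
  qed
next
  assume D: "subspace D \<and> lstable D \<and> rstable D"
  obtain p where p: "endo p" "\<And>x. p x \<in> D" "\<And>x. x \<in> D \<Longrightarrow> p x = x"
    using projection_exists[of D] D by blast
  show "subcoalgebra D" unfolding subcoalgebra_def
  proof (intro conjI ballI)
    fix x assume x: "x \<in> D"
    note vs = vector_space_axioms
    define t where "t = lin_ext formal_scale (\<lambda>(u, v). tens (p u) (p v)) (comult_rep x)"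
    have "comult_rep x - t \<in> tensor2_null scale"
    proof (rule tensor2_null_if_functionals)
      fix f assume f: "functional f"
      note fp = functional_comp[OF f p(1)]
      have "ract (\<lambda>y. f y - f (p y)) x = 0"
        by (rule ract_eq_0[OF _ functional_minus_fun[OF f fp] _ x]) (use D p in auto)
      then have eq: "ract (\<lambda>y. f (p y)) x = ract f x" by (simp add: ract_minus)
      have "lin_ext scale (\<lambda>(u, v). scale (f u) v) t = sw (\<lambda>u v. scale (f (p u)) (p v)) x"
        unfolding t_def sw_def lin_ext_lin_ext[OF vs] case_prod_unfold
        by (simp add: lin_ext_single[OF vs])
      also have "\<dots> = p (ract (\<lambda>y. f (p y)) x)"
        unfolding ract_def using p(1) by (simp add: endo_apply_sw endo_scale)
      also have "\<dots> = ract f x"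
        unfolding eq using p(3) D x rstableD f by blast
      finally show "lin_ext scale (\<lambda>(u, v). scale (f u) v) (comult_rep x - t) = 0"
        by (simp add: lin_ext_minus[OF vs] ract_def sw_def)
    qed
    then have "t \<in> comult x" using comult_cong[OF comult_rep] by blast
    moreover have "Poly_Mapping.keys t \<subseteq> D \<times> D"
    proof
      fix k assume "k \<in> Poly_Mapping.keys t"
      then have "Poly_Mapping.lookup t k \<noteq> 0" by (simp add: in_keys_iff)
      then obtain i where "Poly_Mapping.lookup (formal_scale (Poly_Mapping.lookup (comult_rep x) i)
          (tens (p (fst i)) (p (snd i)))) k \<noteq> 0"
        unfolding t_def lin_ext_def lookup_sum case_prod_unfold
        by (meson sum.not_neutral_contains_not_neutral)
      then have "k = (p (fst i), p (snd i))"
        by (auto simp: lookup_single when_def split: if_splits)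
      then show "k \<in> D \<times> D" using p(2) by simp
    qed
    ultimately show "\<exists>t\<in>comult x. Poly_Mapping.keys t \<subseteq> D \<times> D" by blast
  qed (use D in simp)
qed

lemma lstable_span:
  assumes "\<And>f x. functional f \<Longrightarrow> x \<in> X \<Longrightarrow> lact f x \<in> span X"
  shows "lstable (span X)"
  unfolding lstable_def using assms endo_span[OF endo_lact subspace_span] by blast

lemma rstable_span:
  assumes "\<And>f x. functional f \<Longrightarrow> x \<in> X \<Longrightarrow> ract f x \<in> span X"
  shows "rstable (span X)"
  unfolding rstable_def using assms endo_span[OF endo_ract subspace_span] by blast

lemma subcoalgebra_coradical: "subcoalgebra coradical"
  unfolding subcoalgebra_iff_stable coradical_def
proof (intro conjI lstable_span rstable_span subspace_span span_base)
  fix f x assume "functional f" "x \<in> \<Union> (Collect simple_subcoalgebra)"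
  then show "lact f x \<in> \<Union> (Collect simple_subcoalgebra)" "ract f x \<in> \<Union> (Collect simple_subcoalgebra)"
    unfolding simple_subcoalgebra_def subcoalgebra_iff_stable
    using lstableD rstableD by blast+
qed

text \<open>The fundamental theorem of coalgebras, for the sub-bimodule generated by x. It is
  finite-dimensional because \<open>ract g x\<close> lies in the span of the finitely many second
  factors v of \<open>comult_rep x\<close>, and \<open>lact f v\<close> in the span of the first
  factors of \<open>comult_rep v\<close>.\<close>

lemma finite_dimensional_subcoalgebra:
  "\<exists>C U. finite U \<and> C \<subseteq> span U \<and> x \<in> C \<and> subspace C \<and> lstable C \<and> rstable C"
proof -
  define K where "K = (\<lambda>y. Poly_Mapping.keys (comult_rep y))"
  define U where "U = (\<Union>v\<in>snd ` K x. fst ` K v)"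
  define X where "X = {lact f (ract g x) | f g. functional f \<and> functional g}"
  have l: "lact f v \<in> span (fst ` K v)" for f v
    unfolding lact_def sw_def
    by (rule lin_ext_in_subspace) (force simp: K_def intro: span_scale span_base)+
  have lU: "lact f v \<in> span U" if "v \<in> snd ` K x" for f v
    using l[of f v] span_mono[of "fst ` K v" U] that unfolding U_def by blast
  have rK: "ract g x \<in> span (snd ` K x)" for g
    unfolding ract_def sw_def
    by (rule lin_ext_in_subspace) (force simp: K_def intro: span_scale span_base)+
  have "lact f (ract g x) \<in> span U" if "functional f" for f g
    by (rule endo_span[OF endo_lact[OF that] subspace_span image_subsetI rK]) (rule lU)
  then have "X \<subseteq> span U" unfolding X_def by blast
  then have "span X \<subseteq> span U" by (rule span_minimal) (rule subspace_span)
  moreover have "finite U" unfolding U_def K_def by simp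
  moreover have "x \<in> X"
    unfolding X_def mem_Collect_eq
    by (rule exI[of _ counit], rule exI[of _ counit]) (simp add: functional_counit lact_counit ract_counit)
  moreover have "lstable (span X)"
  proof (rule lstable_span, rule span_base)
    fix f y assume f: "functional f" and "y \<in> X"
    then obtain g h where y: "y = lact g (ract h x)" "functional g" "functional h"
      unfolding X_def by blast
    then show "lact f y \<in> X"
      unfolding X_def using lact_lact[OF f y(2)] functional_comp[OF f endo_lact[OF y(2)]] by blast
  qed
  moreover have "rstable (span X)"
  proof (rule rstable_span, rule span_base)
    fix f y assume f: "functional f" and "y \<in> X"
    then obtain g h where y: "y = lact g (ract h x)" "functional g" "functional h"
      unfolding X_def by blast
    have "ract f y = lact g (ract (\<lambda>y. f (ract h y)) x)"
      unfolding y(1) by (simp add: lact_ract[OF f y(2), symmetric] ract_ract[OF f y(3)])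
    then show "ract f y \<in> X"
      unfolding X_def using functional_comp[OF f endo_ract[OF y(3)]] y(2) by blast
  qed
  ultimately show ?thesis using span_base subspace_span by blast
qed

end

section \<open>The coradical filtration\<close>

context coalgebra
begin

abbreviation corad_perp :: "('h \<Rightarrow> 'k) \<Rightarrow> bool" where
  "corad_perp f \<equiv> functional f \<and> (\<forall>y\<in>coradical. f y = 0)"

text \<open>With J the ideal of functionals vanishing on the coradical, level n holds the x whose
  images under n successive actions of J lie in D. The bottom D is a parameter because the proof of
  exhaustiveness lets it shrink to 0.\<close>

primrec corad_wedge :: "'h set \<Rightarrow> nat \<Rightarrow> 'h set" where
  "corad_wedge D 0 = D"
| "corad_wedge D (Suc n) = {x. \<forall>f. corad_perp f \<longrightarrow> lact f x \<in> corad_wedge D n}"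

text \<open>The index is shifted by one: \<open>corad_filt n\<close> is \<open>H\<^bsub>n-1\<^esub>\<close>, with \<open>H\<^bsub>-1\<^esub> = 0\<close>.\<close>

definition corad_filt :: "nat \<Rightarrow> 'h set" where
  "corad_filt = corad_wedge {0}"

lemma corad_filt_0 [simp]: "corad_filt 0 = {0}"
  by (simp add: corad_filt_def)

lemma corad_filt_SucI:
  "(\<And>f. corad_perp f \<Longrightarrow> lact f x \<in> corad_filt n) \<Longrightarrow> x \<in> corad_filt (Suc n)"
  by (simp add: corad_filt_def)

lemma corad_filt_SucD:
  "x \<in> corad_filt (Suc n) \<Longrightarrow> functional f \<Longrightarrow> (\<And>y. y \<in> coradical \<Longrightarrow> f y = 0) \<Longrightarrow> lact f x \<in> corad_filt n"
  by (simp add: corad_filt_def)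

lemma subspace_coradical: "subspace coradical"
  and lstable_coradical: "lstable coradical"
  and rstable_coradical: "rstable coradical"
  using subcoalgebra_coradical by (auto simp: subcoalgebra_iff_stable)

lemma corad_filt_1: "corad_filt (Suc 0) = coradical"
proof (intro equalityI subsetI)
  fix x assume x: "x \<in> corad_filt (Suc 0)"
  show "x \<in> coradical"
  proof (rule ccontr)
    assume "x \<notin> coradical"
    then obtain f where f: "functional f" "\<forall>y\<in>coradical. f y = 0" "f x \<noteq> 0"
      using separating_functional[OF subspace_coradical] by blast
    then have "lact f x = 0" using corad_filt_SucD[OF x, of f] by simp
    then show False using counit_lact[OF f(1), of x] f(3) functional_0[OF functional_counit] by simp
  qed
next
  fix x assume "x \<in> coradical"
  then show "x \<in> corad_filt (Suc 0)"
    using lact_eq_0[OF rstable_coradical] by (intro corad_filt_SucI) simp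
qed

lemma subspace_corad_filt: "subspace (corad_filt n)"
proof (induction n)
  case (Suc n)
  have "corad_filt (Suc n) = (\<Inter>f\<in>Collect corad_perp. {x. lact f x \<in> corad_filt n})"
    by (auto simp: corad_filt_def)
  also have "subspace \<dots>"
    by (rule subspace_Int) (auto intro: endo_subspace_vimage[OF endo_lact Suc])
  finally show ?case .
qed simp

text \<open>J is a right ideal of the convolution dual, since the coradical is stable under
  \<open>lact\<close>: an action of f followed by one of J is an action of J.\<close>

lemma lstable_corad_filt: "lstable (corad_filt n)"
proof (cases n)
  case 0
  then show ?thesis by (simp add: lstable_def endo_0[OF endo_lact])
next
  case (Suc m)
  show ?thesis unfolding lstable_def
  proof (intro allI impI, elim conjE)
    fix f x assume f: "functional f" and x: "x \<in> corad_filt n"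
    show "lact f x \<in> corad_filt n" unfolding Suc
    proof (rule corad_filt_SucI)
      fix g assume g: "corad_perp g"
      have "g (lact f y) = 0" if "y \<in> coradical" for y
        using g lstableD[OF lstable_coradical f that] by blast
      then show "lact g (lact f x) \<in> corad_filt m"
        using g corad_filt_SucD[OF x[unfolded Suc] functional_comp[OF _ endo_lact[OF f], of g]]
        by (simp add: lact_lact f)
    qed
  qed
qed

lemma corad_filt_Suc_mono: "corad_filt n \<subseteq> corad_filt (Suc n)"
  using lstableD[OF lstable_corad_filt] by (blast intro: corad_filt_SucI)

lemma corad_filt_mono: "m \<le> n \<Longrightarrow> corad_filt m \<subseteq> corad_filt n"
  using lift_Suc_mono_le[of corad_filt, OF corad_filt_Suc_mono] .

lemma corad_filt_monoD: "x \<in> corad_filt m \<Longrightarrow> m \<le> n \<Longrightarrow> x \<in> corad_filt n"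
  using corad_filt_mono by blast

text \<open>The two actions commute, so n - i successive actions of J can be moved onto x; they
  bring it into \<open>corad_filt i\<close>, where \<open>ract f\<close> is zero. For n \<le> i the
  truncated difference gives the correct value 0.\<close>

lemma ract_corad_filt:
  assumes "functional f" "\<And>y. y \<in> corad_filt i \<Longrightarrow> f y = 0" "x \<in> corad_filt n"
  shows "ract f x \<in> corad_filt (n - i)"
proof (cases "n \<le> i")
  case True
  then have "x \<in> corad_filt i" using assms(3) corad_filt_mono by blast
  then show ?thesis
    using True ract_eq_0[OF lstable_corad_filt assms(1,2)] by simp
next
  case False
  have "ract f x \<in> corad_filt m" if "x \<in> corad_filt (m + i)" for m x
    using that
  proof (induction m arbitrary: x)
    case 0
    then show ?case using ract_eq_0[OF lstable_corad_filt assms(1,2)] by simp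
  next
    case (Suc m)
    show ?case
    proof (rule corad_filt_SucI)
      fix g assume g: "corad_perp g"
      then have "lact g x \<in> corad_filt (m + i)"
        using corad_filt_SucD[of x "m + i" g] Suc.prems by simp
      from Suc.IH[OF this] show "lact g (ract f x) \<in> corad_filt m"
        using g assms(1) by (simp add: lact_ract)
    qed
  qed
  from this[of x "n - i"] show ?thesis using False assms(3) by simp
qed

text \<open>\<open>\<Delta>(H\<^sub>n) \<subseteq> \<Sum>\<^sub>i H\<^sub>i \<otimes> H\<^bsub>n-i\<^esub>\<close>\<close>

lemma sw_corad_filt:
  assumes "bilin \<beta>" "subspace T" "x \<in> corad_filt (Suc n)"
    and "\<And>i u v. i \<le> n \<Longrightarrow> u \<in> corad_filt (Suc i) \<Longrightarrow> v \<in> corad_filt (Suc (n - i)) \<Longrightarrow> \<beta> u v \<in> T"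
  shows "sw \<beta> x \<in> T"
proof -
  have "\<exists>p. \<forall>i. endo (p i) \<and> (\<forall>x. p i x \<in> corad_filt i) \<and> (\<forall>x\<in>corad_filt i. p i x = x)"
    using projection_exists[OF subspace_corad_filt] by (intro choice) blast
  then obtain p where p: "\<And>i. endo (p i)" "\<And>i x. p i x \<in> corad_filt i"
    "\<And>i x. x \<in> corad_filt i \<Longrightarrow> p i x = x" by metis
  \<comment> \<open>Telescoping pieces of the identity on first factors: \<open>r i\<close> has
    values in \<open>corad_filt (Suc i)\<close> and kills \<open>corad_filt i\<close>.\<close>
  define r where "r i u = p (Suc i) u - p i u" for i u
  have r: "endo (r i)" "r i u \<in> corad_filt (Suc i)" "u \<in> corad_filt i \<Longrightarrow> r i u = 0" for i u
    unfolding r_def using p corad_filt_Suc_mono[of i]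
    by (auto intro!: endo_minus_fun subspace_diff subspace_corad_filt)
  have split: "u = (\<Sum>i\<le>n. r i u) + (u - p (Suc n) u)" for u
  proof -
    have "(\<Sum>i\<le>n. r i u) = p (Suc n) u - p 0 u"
      unfolding r_def by (induction n) auto
    moreover have "p 0 u = 0" using p(2)[of 0 u] by simp
    ultimately show ?thesis by simp
  qed
  \<comment> \<open>When \<phi> kills \<open>corad_filt i\<close>, \<open>ract_corad_filt\<close>
    puts the second factor, seen through any functional on the first, into
    \<open>corad_filt (Suc n - i)\<close>; projecting v there changes nothing.\<close>
  have zero: "sw (\<lambda>u v. \<beta> (\<phi> u) (v - p (Suc n - i) v)) x = 0"
    if \<phi>: "endo \<phi>" "\<And>u. u \<in> corad_filt i \<Longrightarrow> \<phi> u = 0" for \<phi> i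
  proof (rule sw_eq_0_by_functionals[OF assms(1) \<phi>(1) endo_minus_fun[OF endo_id p(1)]])
    fix f assume f: "functional f"
    have "ract (\<lambda>x. f (\<phi> x)) x \<in> corad_filt (Suc n - i)"
      by (rule ract_corad_filt[OF functional_comp[OF f \<phi>(1)] _ assms(3)])
        (simp add: \<phi>(2) functional_0[OF f])
    then show "ract (\<lambda>x. f (\<phi> x)) x - p (Suc n - i) (ract (\<lambda>x. f (\<phi> x)) x) = 0"
      by (simp add: p(3))
  qed
  have part: "sw (\<lambda>u v. \<beta> (r i u) v) x \<in> T" if "i \<le> n" for i
  proof -
    have "sw (\<lambda>u v. \<beta> (r i u) v) x
      = sw (\<lambda>u v. \<beta> (r i u) (p (Suc n - i) v)) x + sw (\<lambda>u v. \<beta> (r i u) (v - p (Suc n - i) v)) x"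
      unfolding sw_plus_fun[symmetric] bilin_simps(2)[OF assms(1), symmetric] by simp
    also have "\<dots> = sw (\<lambda>u v. \<beta> (r i u) (p (Suc n - i) v)) x"
      using zero[OF r(1,3)] by simp
    also have "\<dots> \<in> T"
      by (rule sw_in_subspace[OF assms(2)], rule assms(4)[OF that])
        (use r(2) p(2)[of "Suc n - i"] that in \<open>auto simp: Suc_diff_le\<close>)
    finally show ?thesis .
  qed
  \<comment> \<open>The last piece has index \<open>Suc n\<close>, where the projection onto
    \<open>corad_filt 0\<close> is zero.\<close>
  have rest: "sw (\<lambda>u v. \<beta> (u - p (Suc n) u) v) x = 0"
    using zero[of "\<lambda>u. u - p (Suc n) u" "Suc n"] p(2)[of 0] p(1,3) endo_minus_fun[OF endo_id p(1)]
    by simp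
  have "\<beta> = (\<lambda>u v. (\<Sum>i\<le>n. \<beta> (r i u) v) + \<beta> (u - p (Suc n) u) v)"
  proof (intro ext)
    fix u v
    have "\<beta> u v = \<beta> ((\<Sum>i\<le>n. r i u) + (u - p (Suc n) u)) v"
      by (simp only: split[symmetric])
    then show "\<beta> u v = (\<Sum>i\<le>n. \<beta> (r i u) v) + \<beta> (u - p (Suc n) u) v"
      using endo_sum[OF bilin_left[OF assms(1), of v]] by (simp add: bilin_simps(1)[OF assms(1)])
  qed
  then have "sw \<beta> x = (\<Sum>i\<le>n. sw (\<lambda>u v. \<beta> (r i u) v) x) + sw (\<lambda>u v. \<beta> (u - p (Suc n) u) v) x"
    unfolding sw_sum_fun[symmetric] sw_plus_fun[symmetric] by simp
  then show ?thesis
    using rest subspace_sum[OF assms(2), of "{..n}"] part by simp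
qed

subsection \<open>Exhaustiveness\<close>

text \<open>In the convolution algebra with unit \<open>counit\<close> the functional is 1 - (1 -
  j)(1 - i), so it fixes l exactly when j fixes (1 - i) l. This is how the set of elements fixed by
  one functional is enlarged.\<close>

lemma lact_eq_self_iff:
  assumes id: "functional i" and jd: "functional j"
  shows "lact (\<lambda>x. i x + j x - j (lact i x)) l = l \<longleftrightarrow> lact j (l - lact i l) = l - lact i l"
proof -
  have "lact (\<lambda>x. i x + j x - j (lact i x)) l = lact i l + lact j l - lact j (lact i l)"
    by (simp add: lact_minus lact_plus lact_lact[OF jd id])
  then show ?thesis
    by (auto simp: endo_diff[OF endo_lact[OF jd]] algebra_simps)
qed

text \<open>
  A subcoalgebra inside the one generated by \<open>L\<close> meets \<open>L\<close>: otherwise functionals vanishing on it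
  map each nonzero \<open>l \<in> L\<close> onto all of \<open>L\<close>, so one of them fixes any finitely many elements of \<open>L\<close>,
  hence also a given element of that subcoalgebra, which it annihilates.
\<close>

lemma minimal_lstable_subset:
  assumes L: "subspace L" "lstable L"
    and min: "\<And>M. subspace M \<Longrightarrow> lstable M \<Longrightarrow> M \<subseteq> L \<Longrightarrow> M \<noteq> {0} \<Longrightarrow> M = L"
    and E: "subspace E" "lstable E" "rstable E" "E \<noteq> {0}"
      "E \<subseteq> span {ract f l | f l. functional f \<and> l \<in> L}"
  shows "L \<subseteq> E"
proof (cases "L \<inter> E = {0}")
  case False
  have "L \<inter> E = L"
    by (rule min) (use L E False in \<open>auto simp: subspace_inter lstable_def\<close>)
  then show ?thesis by blast
next
  case LE: True
  define I where "I = {f. functional f \<and> (\<forall>y\<in>E. f y = 0)}"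
  have I_lact: "(\<lambda>y. g (lact f y)) \<in> I" if "functional g" "f \<in> I" for f g
  proof -
    have "g (lact f y) = 0" if "y \<in> E" for y
      using lact_eq_0[OF E(3) _ _ that, of f] \<open>f \<in> I\<close> functional_0[OF \<open>functional g\<close>]
      unfolding I_def by simp
    then show ?thesis using that functional_comp[OF that(1) endo_lact] by (simp add: I_def)
  qed
  have I_orbit: "\<exists>f\<in>I. lact f l = m" if l: "l \<in> L" "l \<noteq> 0" and m: "m \<in> L" for l m
  proof -
    let ?M = "(\<lambda>f. lact f l) ` I"
    have "?M = L"
    proof (rule min)
      show "subspace ?M" unfolding subspace_def
      proof (intro conjI ballI allI)
        have "(\<lambda>x. 0) \<in> I" by (simp add: I_def functional_def)
        moreover have "lact (\<lambda>x. 0) l = 0" by (simp add: lact_def sw_zero_fun)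
        ultimately show "0 \<in> ?M" by (metis imageI)
        show "x + y \<in> ?M" if xy: "x \<in> ?M" "y \<in> ?M" for x y
        proof -
          obtain f g where fg: "f \<in> I" "g \<in> I" "x = lact f l" "y = lact g l" using xy by blast
          then have "(\<lambda>x. f x + g x) \<in> I" by (simp add: I_def functional_plus)
          then show ?thesis unfolding fg lact_plus[symmetric] by (rule imageI)
        qed
        show "scale c x \<in> ?M" if x: "x \<in> ?M" for c x
        proof -
          obtain f where f: "f \<in> I" "x = lact f l" using x by blast
          then have "(\<lambda>x. c * f x) \<in> I" by (simp add: I_def functional_scale_fun)
          then show ?thesis unfolding f lact_scale_fun[symmetric] by (rule imageI)
        qed
      qed
      show "lstable ?M" unfolding lstable_def
      proof (intro allI impI, elim conjE imageE)
        fix g x f assume g: "functional g" and "x = lact f l" and f: "f \<in> I"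
        then have "lact g x = lact (\<lambda>y. g (lact f y)) l" by (simp add: lact_lact I_def)
        then show "lact g x \<in> ?M" using I_lact[OF g f] by blast
      qed
      show "?M \<subseteq> L" using lstableD[OF L(2)] l by (auto simp: I_def)
      \<comment> \<open>If I killed l, every functional vanishing on E would vanish at l by
        \<open>counit_lact\<close>, so l would lie in E, against
        \<open>L \<inter> E = {0}\<close>.\<close>
      show "?M \<noteq> {0}"
      proof
        assume 0: "?M = {0}"
        have "l \<in> E"
        proof (rule ccontr)
          assume "l \<notin> E"
          then obtain f where f: "functional f" "\<forall>y\<in>E. f y = 0" "f l \<noteq> 0"
            using separating_functional[OF E(1)] by blast
          then have "lact f l = 0" using 0 by (auto simp: I_def)
          then show False
            using counit_lact[OF f(1), of l] f(3) functional_0[OF functional_counit] by simp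
        qed
        then show False using LE l by blast
      qed
    qed
    then show ?thesis using m by blast
  qed
  have fix_finite: "\<exists>f\<in>I. \<forall>l\<in>F. lact f l = l" if "finite F" "F \<subseteq> L" for F
    using that
  proof induction
    case empty
    have "(\<lambda>x. 0) \<in> I" by (simp add: I_def functional_def)
    then show ?case by blast
  next
    case (insert l F)
    then obtain i where i: "i \<in> I" "\<forall>l\<in>F. lact i l = l" by auto
    have fi: "functional i" using i by (simp add: I_def)
    have lL: "l - lact i l \<in> L"
      using insert.prems L lstableD[OF L(2) fi] by (intro subspace_diff) auto
    have "\<exists>j\<in>I. lact j (l - lact i l) = l - lact i l"
    proof (cases "l - lact i l = 0")
      case True
      then show ?thesis using i(1) endo_0[OF endo_lact[OF fi]] by auto
    next
      case False
      then show ?thesis using I_orbit[OF lL] lL by blast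
    qed
    then obtain j where j: "j \<in> I" "lact j (l - lact i l) = l - lact i l" by blast
    have fj: "functional j" using j by (simp add: I_def)
    define f where "f = (\<lambda>x. i x + j x - j (lact i x))"
    have "f \<in> I"
      using i(1) j(1) I_lact[OF fj i(1)] unfolding f_def I_def
      by (simp add: functional_plus functional_minus_fun)
    moreover have "lact f x = x" if "x \<in> insert l F" for x
      unfolding f_def lact_eq_self_iff[OF fi fj]
      using that i(2) j(2) endo_0[OF endo_lact[OF fj]] by auto
    ultimately show ?case by blast
  qed
  obtain e where e: "e \<in> E" "e \<noteq> 0" using E(1,4) subspace_0 by blast
  then obtain F u where F: "finite F" "F \<subseteq> {ract f l | f l. functional f \<and> l \<in> L}"
    and eu: "e = (\<Sum>a\<in>F. scale (u a) a)"
    using E(5) unfolding span_explicit by blast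
  have "\<forall>a\<in>F. \<exists>f l. functional f \<and> l \<in> L \<and> a = ract f l" using F by blast
  then obtain g m where gm: "\<And>a. a \<in> F \<Longrightarrow> functional (g a) \<and> m a \<in> L \<and> a = ract (g a) (m a)"
    by metis
  obtain f where f: "f \<in> I" "\<forall>l\<in>m ` F. lact f l = l"
    using fix_finite[of "m ` F"] F gm by blast
  have ff: "functional f" using f by (simp add: I_def)
  have "lact f a = a" if "a \<in> F" for a
    using gm[OF that] f(2) that lact_ract[OF _ ff, of "g a" "m a"] by auto
  then have "lact f e = e"
    unfolding eu using endo_lact[OF ff] by (simp add: endo_sum endo_scale)
  moreover have "lact f e = 0"
    using lact_eq_0[OF E(3) ff _ e(1)] f by (simp add: I_def)
  ultimately show ?thesis using e by simp
qed

text \<open>A simple right coideal lies in a simple subcoalgebra: finite dimension gives a minimal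
  nonzero sub-bimodule E of the one generated by L, and \<open>minimal_lstable_subset\<close> puts L
  inside E.\<close>

lemma minimal_lstable_subset_coradical:
  assumes L: "subspace L" "lstable L" "L \<noteq> {0}"
    and min: "\<And>M. subspace M \<Longrightarrow> lstable M \<Longrightarrow> M \<subseteq> L \<Longrightarrow> M \<noteq> {0} \<Longrightarrow> M = L"
    and C: "L \<subseteq> C" "subspace C" "rstable C" "C \<subseteq> span U" "finite U"
  shows "L \<subseteq> coradical"
proof -
  define X where "X = {ract f l | f l. functional f \<and> l \<in> L}"
  have X_C: "span X \<subseteq> C"
    using C rstableD[OF C(3)] unfolding X_def by (intro span_minimal) auto
  have l: "lstable (span X)"
  proof (rule lstable_span, rule span_base)
    fix f x assume f: "functional f" and "x \<in> X"
    then obtain g l where "functional g" "l \<in> L" "x = ract g l" unfolding X_def by blast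
    then show "lact f x \<in> X"
      using lact_ract[OF _ f] lstableD[OF L(2) f] unfolding X_def by blast
  qed
  have r: "rstable (span X)"
  proof (rule rstable_span, rule span_base)
    fix f x assume f: "functional f" and "x \<in> X"
    then obtain g l where "functional g" "l \<in> L" "x = ract g l" unfolding X_def by blast
    then show "ract f x \<in> X"
      using ract_ract[OF f] functional_comp[OF f endo_ract] unfolding X_def by blast
  qed
  have "L \<subseteq> X"
  proof
    fix l assume "l \<in> L"
    then show "l \<in> X" unfolding X_def mem_Collect_eq
      by (intro exI[of _ counit] exI[of _ l]) (simp add: functional_counit ract_counit)
  qed
  then have "span X \<noteq> {0}"
    using L(1,3) span_superset[of X] subspace_0 by blast
  moreover define \<S> where "\<S> = {D. subspace D \<and> lstable D \<and> rstable D \<and> D \<noteq> {0} \<and> D \<subseteq> span X}"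
  ultimately have S0: "span X \<in> \<S>" using l r by auto
  have "\<exists>E\<in>\<S>. \<forall>D\<in>\<S>. D \<subseteq> E \<longrightarrow> D = E"
    by (rule finite_span_minimal_maximal_subspace(1)[OF C(5) _ _ S0])
      (use X_C C(4) in \<open>auto simp: \<S>_def\<close>)
  then obtain E where "E \<in> \<S>" and min_E: "\<forall>D\<in>\<S>. D \<subseteq> E \<longrightarrow> D = E" by (elim bexE)
  then have E: "subspace E" "lstable E" "rstable E" "E \<noteq> {0}" "E \<subseteq> span X"
    unfolding \<S>_def by simp_all
  have minE: "D = E" if "subspace D" "lstable D" "rstable D" "D \<noteq> {0}" "D \<subseteq> E" for D
    using min_E[rule_format, of D] that order_trans[OF \<open>D \<subseteq> E\<close> E(5)] unfolding \<S>_def by simp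
  have "simple_subcoalgebra E"
    unfolding simple_subcoalgebra_def subcoalgebra_iff_stable
  proof (intro conjI allI impI)
    fix D assume "(subspace D \<and> lstable D \<and> rstable D) \<and> D \<subseteq> E"
    then show "D = {0} \<or> D = E" using minE[of D] by (cases "D = {0}") simp_all
  qed (use E in simp_all)
  then have "E \<subseteq> \<Union> (Collect simple_subcoalgebra)" by (intro Union_upper CollectI)
  then have "E \<subseteq> coradical" unfolding coradical_def by (rule order_trans[OF _ span_superset])
  moreover have "L \<subseteq> E"
    by (rule minimal_lstable_subset[OF L(1,2) min E(1-4)]) (use E(5) in \<open>simp_all add: X_def\<close>)
  ultimately show ?thesis by blast
qed

lemma corad_wedge_mono: "D \<subseteq> D' \<Longrightarrow> corad_wedge D n \<subseteq> corad_wedge D' n"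
  by (induction n) auto

text \<open>The recursion adds its layer on the outside, while exhaustiveness inserts one at the
  bottom, next to D.\<close>

lemma corad_wedge_Suc: "corad_wedge {x. \<forall>f. corad_perp f \<longrightarrow> lact f x \<in> D} n = corad_wedge D (Suc n)"
  by (induction n) simp_all

text \<open>A Nakayama statement, J D \<noteq> D. Take a maximal proper right coideal N of D and a
  functional \<phi> that vanishes on N but not on D. The image of D under \<open>ract \<phi>\<close>
  is a copy of the simple quotient D/N, so it lies in the coradical and J kills it. Were J D = D,
  then \<open>ract \<phi>\<close> would kill D.\<close>

lemma corad_perp_span_psubset:
  assumes D: "subspace D" "lstable D" "rstable D" "D \<noteq> {0}" "D \<subseteq> span U" "finite U"
  shows "span {lact f y | f y. corad_perp f \<and> y \<in> D} \<noteq> D"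
proof
  assume JD: "span {lact f y | f y. corad_perp f \<and> y \<in> D} = D"
  obtain N where N: "subspace N" "lstable N" "N \<subseteq> D" "N \<noteq> D"
    and max: "\<And>M. subspace M \<Longrightarrow> lstable M \<Longrightarrow> M \<subseteq> D \<Longrightarrow> M \<noteq> D \<Longrightarrow> N \<subseteq> M \<Longrightarrow> M = N"
  proof -
    let ?S = "{M. subspace M \<and> lstable M \<and> M \<subseteq> D \<and> M \<noteq> D}"
    have "{0} \<in> ?S"
      using D subspace_0 by (auto simp: lstable_def endo_0[OF endo_lact])
    then have "\<exists>N\<in>?S. \<forall>M\<in>?S. N \<subseteq> M \<longrightarrow> M = N"
      by (rule finite_span_minimal_maximal_subspace(2)[OF D(6), rotated 2]) (use D(5) in auto)
    then obtain N where N: "N \<in> ?S" and max: "\<forall>M\<in>?S. N \<subseteq> M \<longrightarrow> M = N" by (elim bexE)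
    show ?thesis
      by (rule that[of N]) (use N max in simp_all)
  qed
  obtain d where d: "d \<in> D" "d \<notin> N" using N by blast
  obtain \<phi> where \<phi>: "functional \<phi>" "\<And>y. y \<in> N \<Longrightarrow> \<phi> y = 0" "\<phi> d \<noteq> 0"
    using separating_functional[OF N(1) d(2)] by blast
  let ?L = "ract \<phi> ` D"
  have L: "subspace ?L" by (rule endo_subspace_image[OF endo_ract[OF \<phi>(1)] D(1)])
  have lL: "lstable ?L" unfolding lstable_def
    using lact_ract[OF \<phi>(1)] lstableD[OF D(2)] by auto
  have "counit (ract \<phi> d) \<noteq> 0" using counit_ract[OF \<phi>(1)] \<phi>(3) by simp
  then have "ract \<phi> d \<noteq> 0" using functional_0[OF functional_counit] by metis
  then have L0: "?L \<noteq> {0}" using d(1) by blast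
  have min: "M = ?L" if M: "subspace M" "lstable M" "M \<subseteq> ?L" "M \<noteq> {0}" for M
  proof -
    define N' where "N' = D \<inter> {y. ract \<phi> y \<in> M}"
    have "subspace N'" unfolding N'_def
      by (intro subspace_inter D(1) endo_subspace_vimage[OF endo_ract[OF \<phi>(1)] M(1)])
    moreover have "lstable N'"
      using D(2) M(2) unfolding N'_def lstable_def by (auto simp: lact_ract[OF \<phi>(1), symmetric])
    moreover have "N \<subseteq> N'"
      unfolding N'_def using N ract_eq_0[OF N(2) \<phi>(1,2)] subspace_0[OF M(1)] by auto
    moreover have "N' \<noteq> N"
    proof
      assume "N' = N"
      then have "ract \<phi> y = 0" if "y \<in> D" "ract \<phi> y \<in> M" for y
        using that ract_eq_0[OF N(2) \<phi>(1,2)] unfolding N'_def by blast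
      then have "M \<subseteq> {0}" using M(3) by blast
      then show False using M(4) subspace_0[OF M(1)] by blast
    qed
    ultimately have "N' = D" using max unfolding N'_def by blast
    then show ?thesis using M(3) unfolding N'_def by blast
  qed
  have "?L \<subseteq> coradical"
    by (rule minimal_lstable_subset_coradical[OF L lL L0 min _ D(1,3,5,6)])
      (use rstableD[OF D(3) \<phi>(1)] in auto)
  then have "ract \<phi> (lact f y) = 0" if "corad_perp f" "y \<in> D" for f y
    using that lact_eq_0[OF rstable_coradical, of f "ract \<phi> y"] lact_ract[OF \<phi>(1), of f y] by auto
  then have "ract \<phi> d \<in> {0}"
    by (intro endo_span[OF endo_ract[OF \<phi>(1)] subspace_single_0, of "{lact f y | f y. corad_perp f \<and> y \<in> D}"])
      (use d(1) JD in auto)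
  then show False using \<open>ract \<phi> d \<noteq> 0\<close> by simp
qed

text \<open>In a finite-dimensional subcoalgebra C containing x, consider the sub-bimodules D into
  which some power of J carries C. A minimal one is 0, since otherwise J D would be a smaller
  one.\<close>

theorem corad_filt_exhaustive: "\<exists>n. x \<in> corad_filt n"
proof -
  obtain C U where C: "finite U" "C \<subseteq> span U" "x \<in> C" "subspace C" "lstable C" "rstable C"
    using finite_dimensional_subcoalgebra[of x] by (elim exE conjE)
  let ?S = "{D. subspace D \<and> lstable D \<and> rstable D \<and> D \<subseteq> C \<and> (\<exists>n. C \<subseteq> corad_wedge D n)}"
  have "C \<in> ?S" using C by (auto intro: exI[of _ 0])
  then have "\<exists>D\<in>?S. \<forall>D'\<in>?S. D' \<subseteq> D \<longrightarrow> D' = D"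
    by (rule finite_span_minimal_maximal_subspace(1)[OF C(1), rotated 2]) (use C(2) in auto)
  then obtain D where DS: "D \<in> ?S" and min: "\<forall>D'\<in>?S. D' \<subseteq> D \<longrightarrow> D' = D" by (elim bexE)
  from DS obtain n where D: "subspace D" "lstable D" "rstable D" "D \<subseteq> C" "C \<subseteq> corad_wedge D n"
    by (elim CollectE conjE exE)
  define X where "X = {lact f y | f y. corad_perp f \<and> y \<in> D}"
  have XD: "span X \<subseteq> D"
    using lstableD[OF D(2)] D(1) unfolding X_def by (intro span_minimal) auto
  have "D = {0}"
  proof (rule ccontr)
    assume "D \<noteq> {0}"
    have l: "lstable (span X)"
    proof (rule lstable_span, rule span_base)
      fix f x assume f: "functional f" and "x \<in> X"
      then obtain g y where gy: "corad_perp g" "y \<in> D" "x = lact g y" unfolding X_def by blast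
      have "f (lact g z) = 0" if "z \<in> coradical" for z
        using lact_eq_0[OF rstable_coradical _ _ that, of g] gy(1) functional_0[OF f] by simp
      then have "corad_perp (\<lambda>z. f (lact g z))"
        using functional_comp[OF f endo_lact] gy(1) by simp
      moreover have "lact f x = lact (\<lambda>z. f (lact g z)) y"
        using gy f by (simp add: lact_lact)
      ultimately show "lact f x \<in> X" unfolding X_def using gy(2) by blast
    qed
    have r: "rstable (span X)"
    proof (rule rstable_span, rule span_base)
      fix f x assume f: "functional f" and "x \<in> X"
      then obtain g y where gy: "corad_perp g" "y \<in> D" "x = lact g y" unfolding X_def by blast
      then have "ract f x = lact g (ract f y)" using lact_ract[OF f] by simp
      then show "ract f x \<in> X" unfolding X_def using gy rstableD[OF D(3) f] by blast
    qed
    have "D \<subseteq> {x. \<forall>f. corad_perp f \<longrightarrow> lact f x \<in> span X}"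
      unfolding X_def by (blast intro: span_base)
    from corad_wedge_mono[OF this, of n] have "C \<subseteq> corad_wedge (span X) (Suc n)"
      using D(5) unfolding corad_wedge_Suc by blast
    then have "span X \<in> ?S" using l r XD D(4) by blast
    then have "span X = D" using min XD by simp
    then show False
      using corad_perp_span_psubset[OF D(1-3) \<open>D \<noteq> {0}\<close> _ C(1)] D(4) C(2)
      unfolding X_def by blast
  qed
  then have "x \<in> corad_filt n" unfolding corad_filt_def using D(5) C(3) by blast
  then show ?thesis ..
qed

end

section \<open>Multiplication and the coradical filtration\<close>

context coalgebra
begin

lemma sw_swap:
  "sw (\<lambda>u u'. sw (\<lambda>v v'. \<gamma> u u' v v') y) x = sw (\<lambda>v v'. sw (\<lambda>u u'. \<gamma> u u' v v') x) y"
  unfolding sw_def lin_ext_def case_prod_unfold scale_sum_right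
  by (subst sum.swap) (simp add: mult.commute)

lemma sw_minus_corad_filt:
  assumes "bilin \<beta>" "bilin \<gamma>" "subspace T" "x \<in> corad_filt (Suc n)"
    and "\<And>i u v. i \<le> n \<Longrightarrow> u \<in> corad_filt (Suc i) \<Longrightarrow> v \<in> corad_filt (Suc (n - i)) \<Longrightarrow> \<beta> u v - \<gamma> u v \<in> T"
  shows "sw \<beta> x - sw \<gamma> x \<in> T"
  unfolding sw_minus_fun[symmetric]
  by (rule sw_corad_filt[OF bilinI assms(3,4)])
    (use assms(5) bilin_left[OF assms(1)] bilin_left[OF assms(2)]
       bilin_right[OF assms(1)] bilin_right[OF assms(2)] in \<open>auto intro: endo_minus_fun\<close>)

lemma sw_cong_corad_filt:
  assumes "bilin \<beta>" "bilin \<gamma>" "x \<in> corad_filt (Suc n)"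
    and "\<And>i u v. i \<le> n \<Longrightarrow> u \<in> corad_filt (Suc i) \<Longrightarrow> v \<in> corad_filt (Suc (n - i)) \<Longrightarrow> \<beta> u v = \<gamma> u v"
  shows "sw \<beta> x = sw \<gamma> x"
  using sw_minus_corad_filt[OF assms(1,2) subspace_single_0 assms(3)] assms(4) by simp

lemma sw_cong_coradical:
  assumes "bilin \<beta>" "bilin \<gamma>" "x \<in> coradical"
    and "\<And>u v. u \<in> coradical \<Longrightarrow> v \<in> coradical \<Longrightarrow> \<beta> u v = \<gamma> u v"
  shows "sw \<beta> x = sw \<gamma> x"
  by (rule sw_cong_corad_filt[OF assms(1,2), of x 0]) (use assms(3,4) corad_filt_1 in auto)

lemma sw_sw_corad_filt:
  assumes "\<And>v v'. bilin (\<lambda>u u'. \<gamma> u u' v v')" "\<And>u u'. bilin (\<gamma> u u')" "subspace T"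
    and "x \<in> corad_filt (Suc m)" "y \<in> corad_filt (Suc n)"
    and "\<And>i j u u' v v'. i \<le> m \<Longrightarrow> j \<le> n \<Longrightarrow> u \<in> corad_filt (Suc i) \<Longrightarrow> u' \<in> corad_filt (Suc (m - i))
       \<Longrightarrow> v \<in> corad_filt (Suc j) \<Longrightarrow> v' \<in> corad_filt (Suc (n - j)) \<Longrightarrow> \<gamma> u u' v v' \<in> T"
  shows "sw (\<lambda>u u'. sw (\<lambda>v v'. \<gamma> u u' v v') y) x \<in> T"
proof (rule sw_corad_filt[OF bilinI assms(3,4)])
  show "endo (\<lambda>u. sw (\<lambda>v v'. \<gamma> u u' v v') y)" for u'
    by (rule endo_sw_fun) (rule bilin_left[OF assms(1)])
  show "endo (\<lambda>u'. sw (\<lambda>v v'. \<gamma> u u' v v') y)" for u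
    by (rule endo_sw_fun) (rule bilin_right[OF assms(1)])
qed (rule sw_corad_filt[OF assms(2,3,5)], rule assms(6))

end

context k_algebra
begin

lemma scale_mult: "scale c x * y = scale c (x * y)" "x * scale c y = scale c (x * y)"
  by (fact mult_scale_left mult_scale_right)+

end

section \<open>Products and the antipode in Sweedler form\<close>

context hopf_algebra
begin

lemma endo_mult_right: "endo \<phi> \<Longrightarrow> endo (\<lambda>x. \<phi> x * y)"
  and endo_mult_left: "endo \<phi> \<Longrightarrow> endo (\<lambda>x. y * \<phi> x)"
  by (simp_all add: endo_def scale_mult algebra_simps)

lemma endo_antipode: "endo antipode"
  using antipode_linear by (auto simp: Vector_Spaces.linear_iff endo_def)

lemma endo_sw_arg: "bilin \<beta> \<Longrightarrow> endo \<phi> \<Longrightarrow> endo (\<lambda>x. sw \<beta> (\<phi> x))"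
  by (rule endo_comp[OF endo_sw])

lemma functional_scale_right: "functional f \<Longrightarrow> functional (\<lambda>x. f x * c)"
  by (simp add: functional_def algebra_simps)

text \<open>Follows the syntax of a nested Sweedler expression, so that the linearity side
  conditions of \<open>sw_mult\<close>, \<open>sw_assoc\<close> and the filtration lemmas need no
  individual proofs.\<close>

lemmas lin_intros = bilinI endo_id endo_mult_right endo_mult_left endo_comp[OF endo_antipode]
  endo_sw_arg endo_sw_fun endo_minus_fun endo_plus endo_scale_right endo_scale_left
  functional_comp[OF functional_counit] functional_scale_fun functional_scale_right

lemma sw_mult:
  assumes "bilin \<beta>"
  shows "sw \<beta> (x * y) = sw (\<lambda>u u'. sw (\<lambda>v v'. \<beta> (u * v) (u' * v')) y) x"
  unfolding sw_eq[OF assms comult_mult[OF comult_rep comult_rep]]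
  unfolding lin_ext_lin_ext[OF vector_space_axioms] case_prod_unfold sw_def
  by (simp add: lin_ext_lin_ext[OF vector_space_axioms] lin_ext_single[OF vector_space_axioms])

lemma sw_antipode_left: "sw (\<lambda>u v. antipode u * v) x = scale (counit x) 1"
  unfolding sw_def by (rule antipode_left[OF comult_rep])

lemma sw_antipode_right: "sw (\<lambda>u v. u * antipode v) x = scale (counit x) 1"
  unfolding sw_def by (rule antipode_right[OF comult_rep])

lemma sw_counit_left: "sw (\<lambda>u v. scale (counit u) v) x = x"
  using ract_counit by (simp add: ract_def)

lemma sw_counit_right: "sw (\<lambda>u v. scale (counit v) u) x = x"
  using lact_counit by (simp add: lact_def)

lemma mult_sw: "y * sw \<beta> x = sw (\<lambda>u v. y * \<beta> u v) x"
  by (rule endo_apply_sw[OF endo_mult_left[OF endo_id]])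

lemma sw_mult_right: "sw \<beta> x * y = sw (\<lambda>u v. \<beta> u v * y) x"
  by (rule endo_apply_sw[OF endo_mult_right[OF endo_id]])

text \<open>The hypothesis says that G convolved with the identity is z times the counit; convolving
  with \<open>antipode\<close> on the right cancels the identity.\<close>

lemma convolution_inverse_antipode:
  assumes G: "endo G" and inv: "\<And>c. sw (\<lambda>u v. G u * v) c = scale (counit c) z"
  shows "G c = z * antipode c"
proof -
  have "G c = sw (\<lambda>u w. G u * scale (counit w) 1) c"
    using endo_apply_sw[OF G, of "\<lambda>u v. scale (counit v) u" c]
    by (simp add: sw_counit_right endo_scale[OF G] scale_mult)
  also have "\<dots> = sw (\<lambda>u w. sw (\<lambda>v1 v2. G u * v1 * antipode v2) w) c"
    unfolding sw_antipode_right[symmetric] mult_sw by (simp add: mult.assoc)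
  also have "\<dots> = sw (\<lambda>u w. sw (\<lambda>u1 u2. G u1 * u2 * antipode w) u) c"
    by (rule sw_assoc[symmetric]; intro lin_intros endo_comp[OF G])
  also have "\<dots> = sw (\<lambda>u w. scale (counit u) z * antipode w) c"
    unfolding sw_mult_right[symmetric] inv ..
  also have "\<dots> = z * antipode (sw (\<lambda>u w. scale (counit u) w) c)"
    by (simp add: endo_apply_sw[OF endo_antipode] mult_sw scale_mult endo_scale[OF endo_antipode])
  finally show ?thesis by (simp add: sw_counit_left)
qed

text \<open>Uniqueness of convolution inverses, used twice with one argument frozen: in c, for the
  sum of S(b_1 c) b_2, which is thereby \<epsilon>(b) S(c); then in b, for S(b c). Freezing avoids a
  convolution algebra on the tensor square.\<close>

lemma antipode_mult: "antipode (b * c) = antipode c * antipode b"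
proof -
  have 1: "sw (\<lambda>b1 b2. antipode (b1 * c) * b2) b = scale (counit b) 1 * antipode c" for b c
  proof (rule convolution_inverse_antipode)
    show "endo (\<lambda>c. sw (\<lambda>b1 b2. antipode (b1 * c) * b2) b)"
      by (intro lin_intros)
    fix c
    have "sw (\<lambda>u v. sw (\<lambda>b1 b2. antipode (b1 * u) * b2) b * v) c
        = sw (\<lambda>b1 b2. sw (\<lambda>u v. antipode (b1 * u) * (b2 * v)) c) b"
      unfolding sw_mult_right by (subst sw_swap) (simp add: mult.assoc)
    also have "\<dots> = sw (\<lambda>u v. antipode u * v) (b * c)"
      by (rule sw_mult[symmetric]) (intro lin_intros)
    finally show "sw (\<lambda>u v. sw (\<lambda>b1 b2. antipode (b1 * u) * b2) b * v) c
        = scale (counit c) (scale (counit b) 1)"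
      by (simp add: sw_antipode_left counit_mult mult.commute)
  qed
  show ?thesis
  proof (rule convolution_inverse_antipode)
    show "endo (\<lambda>b. antipode (b * c))" by (intro lin_intros)
  qed (simp add: 1 scale_mult)
qed

end

section \<open>Products and commutators when the coradical is central\<close>

locale hopf_central_coradical = hopf_algebra scale comult counit antipode
  for scale :: "'k::field_char_0 \<Rightarrow> 'h::ring_1 \<Rightarrow> 'h"
    and comult :: "'h \<Rightarrow> ('h \<times> 'h \<Rightarrow>\<^sub>0 'k) set"
    and counit :: "'h \<Rightarrow> 'k"
    and antipode :: "'h \<Rightarrow> 'h" +
  assumes hopf_subalgebra_coradical: "hopf_subalgebra coradical"
    and coradical_central: "coradical \<subseteq> ring_center"
begin

lemma one_in_coradical: "1 \<in> coradical"
  and coradical_mult: "x \<in> coradical \<Longrightarrow> y \<in> coradical \<Longrightarrow> x * y \<in> coradical"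
  and coradical_antipode: "x \<in> coradical \<Longrightarrow> antipode x \<in> coradical"
  using hopf_subalgebra_coradical by (auto simp: hopf_subalgebra_def)

lemma coradical_commute: "b \<in> coradical \<Longrightarrow> b * x = x * b"
  using coradical_central by (auto simp: ring_center_def)

text \<open>When f in J acts on x y, the term whose left factors keep full degree has both right
  factors in the coradical. Their product stays there because the coradical is a subalgebra, so f
  kills it; all other terms have smaller degree and fall to the induction.\<close>

lemma corad_filt_mult:
  "x \<in> corad_filt (Suc i) \<Longrightarrow> y \<in> corad_filt (Suc j) \<Longrightarrow> x * y \<in> corad_filt (Suc (i + j))"
proof (induction "i + j" arbitrary: i j x y rule: less_induct)
  case less
  show ?case
  proof (rule corad_filt_SucI)
    fix f assume f: "corad_perp f"
    then have ff: "functional f" by blast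
    note lin = lin_intros functional_comp[OF ff]
    have "lact f (x * y) = sw (\<lambda>u u'. sw (\<lambda>v v'. scale (f (u' * v')) (u * v)) y) x"
      unfolding lact_def by (rule sw_mult) (intro lin)
    also have "\<dots> \<in> corad_filt (i + j)"
    proof (rule sw_sw_corad_filt[OF _ _ subspace_corad_filt less.prems])
      fix a b u u' v v'
      assume *: "a \<le> i" "b \<le> j" "u \<in> corad_filt (Suc a)" "u' \<in> corad_filt (Suc (i - a))"
        "v \<in> corad_filt (Suc b)" "v' \<in> corad_filt (Suc (j - b))"
      show "scale (f (u' * v')) (u * v) \<in> corad_filt (i + j)"
      proof (cases "a = i \<and> b = j")
        case True
        then have "u' * v' \<in> coradical" using * by (simp add: corad_filt_1 coradical_mult)
        then show ?thesis using f by (simp add: subspace_0[OF subspace_corad_filt])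
      next
        case False
        then have "a + b < i + j" using * by linarith
        then have "u * v \<in> corad_filt (i + j)"
          using less.hyps[of a b u v] * corad_filt_monoD[of _ "Suc (a + b)" "i + j"] by simp
        then show ?thesis by (rule subspace_scale[OF subspace_corad_filt])
      qed
    qed (intro lin)+
    finally show "lact f (x * y) \<in> corad_filt (i + j)" .
  qed
qed

lemma corad_filt_coradical_mult:
  assumes "b \<in> coradical" "x \<in> corad_filt n"
  shows "b * x \<in> corad_filt n" "x * b \<in> corad_filt n"
proof -
  show "b * x \<in> corad_filt n"
    using assms corad_filt_mult[of b 0 x] by (cases n) (auto simp: corad_filt_1)
  then show "x * b \<in> corad_filt n" using coradical_commute[OF assms(1)] by simp
qed

text \<open>Write f(u'v') uv - f(v'u') vu as f(u'v') [u, v] + f([u', v']) vu. The first part is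
  settled by induction, or by f vanishing on the coradical. In the second, centrality gives [u', v']
  = 0 unless i < m and j < n, and then vu has already lost two degrees.\<close>

lemma corad_filt_commutator:
  "x \<in> corad_filt (Suc m) \<Longrightarrow> y \<in> corad_filt (Suc n) \<Longrightarrow> x * y - y * x \<in> corad_filt (m + n)"
proof (induction "m + n" arbitrary: m n x y rule: less_induct)
  case less
  show ?case
  proof (cases "m = 0 \<or> n = 0")
    case True
    then have "x * y = y * x"
      using less.prems coradical_commute[of x y] coradical_commute[of y x] by (auto simp: corad_filt_1)
    then show ?thesis by (simp add: subspace_0[OF subspace_corad_filt])
  next
    case False
    then obtain k where k: "m + n = Suc k" by (cases "m + n") auto
    show ?thesis unfolding k
    proof (rule corad_filt_SucI)
      fix f assume f: "corad_perp f"
      then have ff: "functional f" by blast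
      note lin = lin_intros functional_comp[OF ff]
      have 1: "lact f (x * y) = sw (\<lambda>u u'. sw (\<lambda>v v'. scale (f (u' * v')) (u * v)) y) x"
        unfolding lact_def by (rule sw_mult) (intro lin)
      have 2: "lact f (y * x) = sw (\<lambda>u u'. sw (\<lambda>v v'. scale (f (v' * u')) (v * u)) y) x"
        unfolding lact_def by (subst sw_swap) (rule sw_mult, intro lin)
      have "lact f (x * y - y * x)
          = sw (\<lambda>u u'. sw (\<lambda>v v'. scale (f (u' * v')) (u * v) - scale (f (v' * u')) (v * u)) y) x"
        unfolding endo_diff[OF endo_lact[OF ff]] 1 2 sw_minus_fun ..
      also have "\<dots> \<in> corad_filt k"
      proof (rule sw_sw_corad_filt[OF _ _ subspace_corad_filt less.prems])
        fix i j u u' v v'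
        assume *: "i \<le> m" "j \<le> n" "u \<in> corad_filt (Suc i)" "u' \<in> corad_filt (Suc (m - i))"
          "v \<in> corad_filt (Suc j)" "v' \<in> corad_filt (Suc (n - j))"
        have "scale (f (u' * v')) (u * v - v * u) \<in> corad_filt k"
        proof (cases "i + j = m + n")
          case True
          then have "u' * v' \<in> coradical" using * by (simp add: corad_filt_1 coradical_mult)
          then show ?thesis using f by (simp add: subspace_0[OF subspace_corad_filt])
        next
          case False
          then have "i + j < m + n" using * by linarith
          then show ?thesis
            using less.hyps[of i j u v] * corad_filt_monoD[of _ "i + j" k] k
            by (intro subspace_scale[OF subspace_corad_filt]) simp
        qed
        moreover have "scale (f (u' * v' - v' * u')) (v * u) \<in> corad_filt k"
        proof (cases "Suc (i + j) < m + n")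
          case True
          have "v * u \<in> corad_filt (Suc (j + i))" using corad_filt_mult * by blast
          then show ?thesis
            using True k corad_filt_monoD[of _ "Suc (j + i)" k]
            by (intro subspace_scale[OF subspace_corad_filt]) simp
        next
          case False
          then have "i = m \<or> j = n" using * by linarith
          then have "u' * v' = v' * u'"
            using * coradical_commute[of u' v'] coradical_commute[of v' u'] by (auto simp: corad_filt_1)
          then show ?thesis by (simp add: functional_0[OF ff] subspace_0[OF subspace_corad_filt])
        qed
        ultimately have "scale (f (u' * v')) (u * v - v * u) + scale (f (u' * v' - v' * u')) (v * u)
            \<in> corad_filt k"
          by (rule subspace_add[OF subspace_corad_filt])
        then show "scale (f (u' * v')) (u * v) - scale (f (v' * u')) (v * u) \<in> corad_filt k"
          by (simp add: functional_diff[OF ff] algebra_simps)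
      qed (intro lin)+
      finally show "lact f (x * y - y * x) \<in> corad_filt k" .
    qed
  qed
qed

end

section \<open>Generators of the associated graded algebra\<close>

context hopf_central_coradical
begin

text \<open>\<Delta> gives a coaction of H_0 on H_d/H_(d-1) only modulo lower terms; composing the
  second factor with a linear projection onto H_0 lifts it to H. Another projection changes
  \<open>coinv_proj\<close> on H_d only by elements of H_(d-1).\<close>

definition corad_proj :: "'h \<Rightarrow> 'h" where
  "corad_proj = (SOME q. endo q \<and> (\<forall>x. q x \<in> coradical) \<and> (\<forall>x\<in>coradical. q x = x))"

lemma endo_corad_proj: "endo corad_proj"
  and corad_proj_in: "corad_proj x \<in> coradical"
  and corad_proj_id: "x \<in> coradical \<Longrightarrow> corad_proj x = x"
  using someI_ex[OF projection_exists[OF subspace_coradical]]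
  unfolding corad_proj_def[symmetric] by auto

text \<open>
  \<open>H\<^sub>d/H\<^bsub>d-1\<^esub>\<close> is a Hopf module over \<open>H\<^sub>0\<close>; on it, \<open>coinv_proj\<close> is the projection
  \<open>x \<mapsto> \<Sum> x\<^bsub>(0)\<^esub> S(x\<^bsub>(1)\<^esub>)\<close> onto the coinvariants.
\<close>

definition coinv_proj :: "'h \<Rightarrow> 'h" where
  "coinv_proj = sw (\<lambda>u v. u * antipode (corad_proj v))"

definition decomposables :: "nat \<Rightarrow> 'h set" where
  "decomposables d = {x * y | x y i j. i + j = d \<and> 0 < i \<and> 0 < j \<and>
     x \<in> corad_filt (Suc i) \<and> y \<in> corad_filt (Suc j)}"

text \<open>The functionals of degree \<open>d\<close> on the indecomposables \<open>Q\<close> of the associated graded algebra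
  that factor through \<open>Q/Q(H\<^sub>0 \<inter> ker \<epsilon>)\<close>.\<close>

definition indec_functional :: "nat \<Rightarrow> ('h \<Rightarrow> 'k) \<Rightarrow> bool" where
  "indec_functional d \<delta> \<longleftrightarrow> functional \<delta> \<and> (\<forall>x\<in>corad_filt d. \<delta> x = 0) \<and>
     (\<forall>b\<in>coradical. \<forall>x\<in>corad_filt (Suc d). \<delta> (b * x) = counit b * \<delta> x) \<and>
     (\<forall>x\<in>decomposables d. \<delta> x = 0)"

lemma indec_functionalD:
  assumes "indec_functional d \<delta>"
  shows "functional \<delta>" "\<And>x. x \<in> corad_filt d \<Longrightarrow> \<delta> x = 0"
    "\<And>b x. b \<in> coradical \<Longrightarrow> x \<in> corad_filt (Suc d) \<Longrightarrow> \<delta> (b * x) = counit b * \<delta> x"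
    "\<And>x y i j. x \<in> corad_filt (Suc i) \<Longrightarrow> y \<in> corad_filt (Suc j) \<Longrightarrow> i + j = d \<Longrightarrow> 0 < i \<Longrightarrow> 0 < j \<Longrightarrow> \<delta> (x * y) = 0"
  using assms unfolding indec_functional_def decomposables_def by blast+

section \<open>Derivations from functionals on the indecomposables\<close>

lemma ract_indec_corad_filt:
  "indec_functional d \<delta> \<Longrightarrow> x \<in> corad_filt n \<Longrightarrow> ract \<delta> x \<in> corad_filt (n - d)"
  using ract_corad_filt[of \<delta> d x n] by (simp add: indec_functional_def)

lemma ract_indec_coradical:
  assumes "indec_functional d \<delta>" "0 < d" "b \<in> coradical"
  shows "ract \<delta> b = 0"
  using ract_indec_corad_filt[OF assms(1), of b "Suc 0"] assms(2,3)
  by (simp add: corad_filt_1)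

text \<open>The infinitesimal character rule up to degree d: below degree d everything is killed,
  products of two positive degrees are decomposable, and a factor of degree 0 comes out through the
  counit, on either side by centrality. As d > 0, \<delta> also kills the coradical.\<close>

lemma indec_functional_coproduct_term:
  assumes \<delta>: "indec_functional d \<delta>" and d: "0 < d"
    and u: "u \<in> corad_filt (Suc i)" and v: "v \<in> corad_filt (Suc j)" and ij: "i + j \<le> d"
  shows "\<delta> (u * v) = \<delta> u * counit v + counit u * \<delta> v"
proof -
  note D = indec_functionalD[OF \<delta>]
  consider "i + j < d" | "i + j = d" "0 < i" "0 < j" | "i = 0" "j = d" | "j = 0" "i = d"
    using ij by linarith
  then show ?thesis
  proof cases
    case 1
    then have "u \<in> corad_filt d" "v \<in> corad_filt d" "u * v \<in> corad_filt d"
      using u v corad_filt_mult[OF u v] corad_filt_monoD[of _ _ d] by simp_all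
    then show ?thesis by (simp add: D(2))
  next
    case 2
    then have "u \<in> corad_filt d" "v \<in> corad_filt d"
      using u v corad_filt_monoD[of _ _ d] by simp_all
    then show ?thesis using 2 D(4)[OF u v] by (simp add: D(2))
  next
    case 3
    then have "u \<in> coradical" "u \<in> corad_filt d"
      using u d corad_filt_monoD[of u "Suc 0" d] by (simp_all add: corad_filt_1)
    then show ?thesis using 3 v by (simp add: D(2,3))
  next
    case 4
    then have "v \<in> coradical" "v \<in> corad_filt d"
      using v d corad_filt_monoD[of v "Suc 0" d] by (simp_all add: corad_filt_1)
    moreover have "\<delta> (u * v) = counit v * \<delta> u"
      using D(3)[of v u] 4 u \<open>v \<in> coradical\<close> coradical_commute[of v u] by simp
    ultimately show ?thesis by (simp add: D(2))
  qed
qed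

text \<open>Terms with i + j \<le> d cancel by the infinitesimal character rule. In the others the
  first factors absorb more than d degrees, so u' v' has degree below m + n - d.\<close>

lemma ract_indec_mult:
  assumes \<delta>: "indec_functional d \<delta>" and d: "0 < d"
    and x: "x \<in> corad_filt (Suc m)" and y: "y \<in> corad_filt (Suc n)"
  shows "ract \<delta> (x * y) - (ract \<delta> x * y + x * ract \<delta> y) \<in> corad_filt (m + n - d)"
proof -
  note D = indec_functionalD[OF \<delta>]
  note lin = lin_intros functional_comp[OF D(1)]
  have 1: "ract \<delta> (x * y) = sw (\<lambda>u u'. sw (\<lambda>v v'. scale (\<delta> (u * v)) (u' * v')) y) x"
    unfolding ract_def by (rule sw_mult) (intro lin)
  have "ract \<delta> x * y = sw (\<lambda>u u'. sw (\<lambda>v v'. scale (\<delta> u * counit v) (u' * v')) y) x"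
  proof -
    have "scale (\<delta> u) u' * y = sw (\<lambda>v v'. scale (\<delta> u * counit v) (u' * v')) y" for u u'
      using mult_sw[of "scale (\<delta> u) u'" "\<lambda>v v'. scale (counit v) v'" y]
      by (simp add: sw_counit_left scale_mult mult.commute)
    then show ?thesis unfolding ract_def sw_mult_right by simp
  qed
  moreover have "x * ract \<delta> y = sw (\<lambda>u u'. sw (\<lambda>v v'. scale (counit u * \<delta> v) (u' * v')) y) x"
  proof -
    have "x * scale (\<delta> v) v' = sw (\<lambda>u u'. scale (counit u * \<delta> v) (u' * v')) x" for v v'
      using sw_mult_right[of "\<lambda>u u'. scale (counit u) u'" x "scale (\<delta> v) v'"]
      by (simp add: sw_counit_left scale_mult mult.commute)
    then show ?thesis unfolding ract_def mult_sw by (subst sw_swap) simp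
  qed
  ultimately have "ract \<delta> (x * y) - (ract \<delta> x * y + x * ract \<delta> y)
      = sw (\<lambda>u u'. sw (\<lambda>v v'. scale (\<delta> (u * v)) (u' * v') -
          (scale (\<delta> u * counit v) (u' * v') + scale (counit u * \<delta> v) (u' * v'))) y) x"
    unfolding 1 by (simp add: sw_minus_fun sw_plus_fun)
  also have "\<dots> \<in> corad_filt (m + n - d)"
  proof (rule sw_sw_corad_filt[OF _ _ subspace_corad_filt x y])
    fix i j u u' v v'
    assume *: "i \<le> m" "j \<le> n" "u \<in> corad_filt (Suc i)" "u' \<in> corad_filt (Suc (m - i))"
      "v \<in> corad_filt (Suc j)" "v' \<in> corad_filt (Suc (n - j))"
    show "scale (\<delta> (u * v)) (u' * v') -
        (scale (\<delta> u * counit v) (u' * v') + scale (counit u * \<delta> v) (u' * v')) \<in> corad_filt (m + n - d)"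
    proof (cases "i + j \<le> d")
      case True
      then show ?thesis
        using indec_functional_coproduct_term[OF \<delta> d *(3,5)]
        by (simp add: scale_left_distrib subspace_0[OF subspace_corad_filt])
    next
      case False
      have "u' * v' \<in> corad_filt (Suc ((m - i) + (n - j)))" by (rule corad_filt_mult[OF *(4,6)])
      then have "u' * v' \<in> corad_filt (m + n - d)"
        by (rule corad_filt_monoD) (use False * in linarith)
      then show ?thesis
        by (intro subspace_diff subspace_add subspace_scale subspace_corad_filt)
    qed
  qed (intro lin functional_comp[OF D(1)])+
  finally show ?thesis .
qed

lemma ract_indec_coradical_mult:
  assumes \<delta>: "indec_functional d \<delta>" and d: "0 < d" and b: "b \<in> coradical"
    and x: "x \<in> corad_filt (Suc n)"
  shows "ract \<delta> (b * x) - b * ract \<delta> x \<in> corad_filt (n - d)"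
  using ract_indec_mult[OF \<delta> d _ x, of b 0] b ract_indec_coradical[OF \<delta> d b]
  by (simp add: corad_filt_1)

section \<open>Coinvariants of the graded Hopf modules\<close>

lemma endo_coinv_proj: "endo coinv_proj"
  unfolding coinv_proj_def by (intro endo_sw lin_intros endo_comp[OF endo_corad_proj])

lemma antipode_corad_proj_in: "antipode (corad_proj x) \<in> coradical"
  by (intro coradical_antipode corad_proj_in)

lemma coinv_proj_corad_filt:
  assumes "x \<in> corad_filt (Suc n)"
  shows "coinv_proj x \<in> corad_filt (Suc n)"
  unfolding coinv_proj_def
proof (rule sw_corad_filt[OF _ subspace_corad_filt assms])
  fix i u v assume "i \<le> n" "u \<in> corad_filt (Suc i)"
  then show "u * antipode (corad_proj v) \<in> corad_filt (Suc n)"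
    using corad_filt_monoD[of u "Suc i" "Suc n"]
    by (intro corad_filt_coradical_mult antipode_corad_proj_in) simp
qed (intro lin_intros endo_comp[OF endo_corad_proj])

lemma coinv_proj_corad_filt_shifted:
  assumes "x \<in> corad_filt d"
  shows "coinv_proj x \<in> corad_filt d"
  using assms coinv_proj_corad_filt endo_0[OF endo_coinv_proj] by (cases d) auto

lemma coinv_proj_coradical:
  assumes "b \<in> coradical"
  shows "coinv_proj b = scale (counit b) 1"
  unfolding coinv_proj_def sw_antipode_right[symmetric]
  by (rule sw_cong_coradical[OF _ _ assms])
    (intro lin_intros endo_comp[OF endo_corad_proj], intro lin_intros, simp add: corad_proj_id)

text \<open>On H_d, \<open>ract \<delta>\<close> commutes with \<open>coinv_proj\<close> and lands
  in the coradical, where \<open>coinv_proj\<close> is the counit. For a lift that is not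
  coinvariant the value could be any element of H_0.\<close>

lemma ract_indec_coinv_proj:
  assumes \<delta>: "indec_functional d \<delta>" and d: "0 < d" and x: "x \<in> corad_filt (Suc d)"
  shows "ract \<delta> (coinv_proj x) = scale (\<delta> x) 1"
proof -
  note D = indec_functionalD[OF \<delta>]
  note lin = lin_intros functional_comp[OF D(1)] endo_comp[OF endo_ract[OF D(1)]]
    endo_comp[OF endo_corad_proj]
  have "ract \<delta> (coinv_proj x) = sw (\<lambda>u v. ract \<delta> (u * antipode (corad_proj v))) x"
    unfolding coinv_proj_def by (rule endo_apply_sw[OF endo_ract[OF D(1)]])
  \<comment> \<open>The Leibniz error for u in H_d and a factor of degree 0 lies in
    \<open>corad_filt 0\<close>, so the equation is exact.\<close>
  also have "\<dots> = sw (\<lambda>u v. ract \<delta> u * antipode (corad_proj v)) x"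
  proof (rule sw_cong_corad_filt[OF _ _ x])
    fix i u v assume "i \<le> d" "u \<in> corad_filt (Suc i)"
    then have u: "u \<in> corad_filt (Suc d)" using corad_filt_monoD[of u "Suc i" "Suc d"] by simp
    have "antipode (corad_proj v) \<in> corad_filt (Suc 0)"
      using antipode_corad_proj_in by (simp add: corad_filt_1)
    from ract_indec_mult[OF \<delta> d u this]
    show "ract \<delta> (u * antipode (corad_proj v)) = ract \<delta> u * antipode (corad_proj v)"
      using ract_indec_coradical[OF \<delta> d antipode_corad_proj_in] by simp
  qed (intro lin)+
  also have "\<dots> = sw (\<lambda>u w. sw (\<lambda>u1 u2. scale (\<delta> u1) (u2 * antipode (corad_proj w))) u) x"
    unfolding ract_def sw_mult_right scale_mult ..
  also have "\<dots> = sw (\<lambda>u w. sw (\<lambda>w1 w2. scale (\<delta> u) (w1 * antipode (corad_proj w2))) w) x"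
    by (rule sw_assoc) (intro lin D(1))+
  also have "\<dots> = coinv_proj (ract \<delta> x)"
    unfolding ract_def endo_apply_sw[OF endo_coinv_proj]
    by (simp add: scale_sw[symmetric] endo_scale[OF endo_coinv_proj]) (simp add: coinv_proj_def)
  also have "\<dots> = scale (counit (ract \<delta> x)) 1"
    using ract_indec_corad_filt[OF \<delta> x] by (intro coinv_proj_coradical) (simp add: corad_filt_1)
  finally show ?thesis by (simp add: counit_ract[OF D(1)])
qed

text \<open>The generating half of the structure theorem for Hopf modules: in the sum of x_1 S(x_2)
  x_3 the last two factors collapse to the counit wherever x_1 has full degree.\<close>

lemma coinv_proj_generates:
  assumes d: "0 < d" and x: "x \<in> corad_filt (Suc d)"
  shows "x - sw (\<lambda>u v. coinv_proj u * corad_proj v) x \<in> corad_filt d"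
proof -
  note lin = lin_intros endo_comp[OF endo_corad_proj]
  have "sw (\<lambda>u v. coinv_proj u * corad_proj v) x
      = sw (\<lambda>u w. sw (\<lambda>u1 u2. u1 * antipode (corad_proj u2) * corad_proj w) u) x"
    unfolding coinv_proj_def sw_mult_right ..
  also have "\<dots> = sw (\<lambda>u w. sw (\<lambda>w1 w2. u * antipode (corad_proj w1) * corad_proj w2) w) x"
    by (rule sw_assoc) (intro lin)+
  also have "\<dots> = sw (\<lambda>u w. u * sw (\<lambda>w1 w2. antipode (corad_proj w1) * corad_proj w2) w) x"
    unfolding mult_sw by (simp add: mult.assoc)
  finally have eq: "sw (\<lambda>u v. coinv_proj u * corad_proj v) x
    = sw (\<lambda>u w. u * sw (\<lambda>w1 w2. antipode (corad_proj w1) * corad_proj w2) w) x" .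
  have "sw (\<lambda>u v. scale (counit v) u) x - sw (\<lambda>u v. coinv_proj u * corad_proj v) x \<in> corad_filt d"
    unfolding eq
  proof (rule sw_minus_corad_filt[OF _ _ subspace_corad_filt x])
    fix i u w assume *: "i \<le> d" "u \<in> corad_filt (Suc i)" "w \<in> corad_filt (Suc (d - i))"
    let ?s = "sw (\<lambda>w1 w2. antipode (corad_proj w1) * corad_proj w2) w"
    show "scale (counit w) u - u * ?s \<in> corad_filt d"
    proof (cases "i = d")
      case True
      then have w: "w \<in> coradical" using * by (simp add: corad_filt_1)
      have "?s = sw (\<lambda>w1 w2. antipode w1 * w2) w"
        by (rule sw_cong_coradical[OF _ _ w])
          (intro lin, intro lin, simp add: corad_proj_id)
      then show ?thesis
        by (simp add: sw_antipode_left scale_mult subspace_0[OF subspace_corad_filt])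
    next
      case False
      then have u: "u \<in> corad_filt d" using * corad_filt_monoD[of u "Suc i" d] by simp
      have "?s \<in> coradical"
        by (rule sw_in_subspace[OF subspace_coradical])
          (intro coradical_mult antipode_corad_proj_in corad_proj_in)
      then show ?thesis
        by (intro subspace_diff subspace_scale subspace_corad_filt u corad_filt_coradical_mult)
    qed
  qed (intro lin functional_counit)+
  then show ?thesis by (simp add: sw_counit_right)
qed

text \<open>Since \<open>antipode\<close> reverses products and H_0 is central, b_1 x_1 S(x_2)
  S(b_2) regroups as b_1 S(b_2) x_1 S(x_2) in top degree. So the augmentation ideal of H_0 times H_d
  is sent to H_(d-1).\<close>

lemma coinv_proj_coradical_mult:
  assumes d: "0 < d" and b: "b \<in> coradical" and x: "x \<in> corad_filt (Suc d)"
  shows "coinv_proj (b * x) - scale (counit b) (coinv_proj x) \<in> corad_filt d"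
proof -
  note lin = lin_intros endo_comp[OF endo_corad_proj]
  have 1: "coinv_proj (b * x) = sw (\<lambda>u u'. sw (\<lambda>v v'. (u * v) * antipode (corad_proj (u' * v'))) x) b"
    unfolding coinv_proj_def by (rule sw_mult) (intro lin)
  have "scale (counit b) (coinv_proj x) = sw (\<lambda>u u'. u * antipode u') b * coinv_proj x"
    by (simp add: sw_antipode_right scale_mult)
  also have "\<dots> = sw (\<lambda>u u'. sw (\<lambda>v v'. (u * antipode u') * (v * antipode (corad_proj v'))) x) b"
    unfolding sw_mult_right by (simp add: coinv_proj_def mult_sw)
  finally have "coinv_proj (b * x) - scale (counit b) (coinv_proj x)
     = sw (\<lambda>u u'. sw (\<lambda>v v'. (u * v) * antipode (corad_proj (u' * v')) -
         (u * antipode u') * (v * antipode (corad_proj v'))) x) b"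
    unfolding 1 by (simp add: sw_minus_fun)
  also have "\<dots> \<in> corad_filt d"
  proof (rule sw_sw_corad_filt[OF _ _ subspace_corad_filt _ x, of _ _ 0])
    show "b \<in> corad_filt (Suc 0)" using b by (simp add: corad_filt_1)
    fix i j u u' v v'
    assume *: "i \<le> 0" "j \<le> d" "u \<in> corad_filt (Suc i)" "u' \<in> corad_filt (Suc (0 - i))"
      "v \<in> corad_filt (Suc j)" "v' \<in> corad_filt (Suc (d - j))"
    then have u: "u \<in> coradical" "u' \<in> coradical" by (simp_all add: corad_filt_1)
    show "(u * v) * antipode (corad_proj (u' * v')) - (u * antipode u') * (v * antipode (corad_proj v'))
        \<in> corad_filt d"
    proof (cases "j = d")
      case True
      then have v': "v' \<in> coradical" using * by (simp add: corad_filt_1)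
      have "(u * v) * (antipode v' * antipode u') = (u * antipode u') * (v * antipode v')"
        using coradical_commute[OF coradical_antipode[OF u(2)], of "v * antipode v'"]
        by (simp add: mult.assoc)
      then show ?thesis
        using u v' by (simp add: corad_proj_id coradical_mult antipode_mult subspace_0[OF subspace_corad_filt])
    next
      case False
      then have "v \<in> corad_filt d" using * corad_filt_monoD[of v "Suc j" d] by simp
      then show ?thesis
        by (intro subspace_diff subspace_corad_filt corad_filt_coradical_mult antipode_corad_proj_in
            coradical_mult coradical_antipode u)
    qed
  qed (intro lin)+
  finally show ?thesis .
qed

text \<open>The antipode factor lies in H_0 and is absorbed into v, so the top term stays
  decomposable; every other term is in H_(d-1).\<close>

lemma coinv_proj_decomposables:
  assumes "z \<in> decomposables d"
  shows "coinv_proj z \<in> span (decomposables d \<union> corad_filt d)"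
proof -
  note lin = lin_intros endo_comp[OF endo_corad_proj]
  obtain x y m n where z: "z = x * y" "m + n = d" "0 < m" "0 < n"
    and x: "x \<in> corad_filt (Suc m)" and y: "y \<in> corad_filt (Suc n)"
    using assms unfolding decomposables_def by blast
  have "coinv_proj z = sw (\<lambda>u u'. sw (\<lambda>v v'. (u * v) * antipode (corad_proj (u' * v'))) y) x"
    unfolding coinv_proj_def z by (rule sw_mult) (intro lin)
  also have "\<dots> \<in> span (decomposables d \<union> corad_filt d)"
  proof (rule sw_sw_corad_filt[OF _ _ subspace_span x y], rule_tac [3] span_base)
    fix i j u u' v v'
    assume *: "i \<le> m" "j \<le> n" "u \<in> corad_filt (Suc i)" "u' \<in> corad_filt (Suc (m - i))"
      "v \<in> corad_filt (Suc j)" "v' \<in> corad_filt (Suc (n - j))"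
    let ?b = "antipode (corad_proj (u' * v'))"
    show "(u * v) * ?b \<in> decomposables d \<union> corad_filt d"
    proof (cases "i = m \<and> j = n")
      case True
      then have "v * ?b \<in> corad_filt (Suc n)"
        using * by (intro corad_filt_coradical_mult antipode_corad_proj_in) simp
      then have "u * (v * ?b) \<in> decomposables d"
        unfolding decomposables_def using True * z by blast
      then show ?thesis by (simp add: mult.assoc)
    next
      case False
      then have "i + j < d" using * z by linarith
      then have "u * v \<in> corad_filt d"
        using corad_filt_mult[OF *(3,5)] corad_filt_monoD[of "u * v" "Suc (i + j)" d] by simp
      then show ?thesis by (intro UnI2 corad_filt_coradical_mult(2)[OF antipode_corad_proj_in])
    qed
  qed (intro lin)+
  finally show ?thesis .
qed

text \<open>\<open>C\<close> is a basis of H_d modulo \<open>span X\<close>, and the generators are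
  its image under \<open>coinv_proj\<close>. Vanishing on X makes the dual functionals
  indecomposable. For generation, \<open>coinv_proj\<close> maps both X and \<open>C\<close> into
  \<open>span Y\<close>, and \<open>coinv_proj_generates\<close> expresses every x through values of
  \<open>coinv_proj\<close> with coefficients in H_0.\<close>

lemma generators_exist:
  assumes d: "0 < d"
  shows "\<exists>A \<delta>. A \<subseteq> corad_filt (Suc d) \<and> (\<forall>a\<in>A. indec_functional d (\<delta> a)) \<and>
    (\<forall>a\<in>A. \<forall>a'\<in>A. ract (\<delta> a) a' = (if a' = a then 1 else 0)) \<and>
    corad_filt (Suc d) \<subseteq> span ({b * a | b a. b \<in> coradical \<and> a \<in> A} \<union> decomposables d \<union> corad_filt d)"
proof -
  define X where "X = decomposables d \<union> {b * x | b x. b \<in> coradical \<and> counit b = 0 \<and> x \<in> corad_filt (Suc d)}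
    \<union> corad_filt d"
  have "X \<subseteq> corad_filt (Suc d)"
    unfolding X_def decomposables_def
    using corad_filt_mult corad_filt_coradical_mult corad_filt_Suc_mono[of d] by auto
  then have sub: "span X \<subseteq> corad_filt (Suc d)"
    by (rule span_minimal) (rule subspace_corad_filt)
  obtain C \<delta> where C: "C \<subseteq> corad_filt (Suc d)" "corad_filt (Suc d) \<subseteq> span (C \<union> span X)"
    and \<delta>_all: "\<forall>c\<in>C. functional (\<delta> c) \<and> (\<forall>x\<in>span X. \<delta> c x = 0) \<and>
      (\<forall>c'\<in>C. \<delta> c c' = (if c' = c then 1 else 0))"
    using coordinates_relative[OF subspace_span subspace_corad_filt sub] by (elim exE conjE)
  then have \<delta>: "\<And>c. c \<in> C \<Longrightarrow> functional (\<delta> c)" "\<And>c x. c \<in> C \<Longrightarrow> x \<in> span X \<Longrightarrow> \<delta> c x = 0"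
      "\<And>c c'. c \<in> C \<Longrightarrow> c' \<in> C \<Longrightarrow> \<delta> c c' = (if c' = c then 1 else 0)"
    by simp_all
  have indec: "indec_functional d (\<delta> c)" if c: "c \<in> C" for c
    unfolding indec_functional_def
  proof (intro conjI ballI)
    fix b x assume b: "b \<in> coradical" and x: "x \<in> corad_filt (Suc d)"
    let ?b = "b - scale (counit b) 1"
    have "?b \<in> coradical" 
      by (intro subspace_diff subspace_scale subspace_coradical b one_in_coradical)
    moreover have "counit ?b = 0"
      by (simp add: functional_diff[OF functional_counit] functional_scale[OF functional_counit] counit_one)
    ultimately have "?b * x \<in> span X" using x unfolding X_def by (intro span_base) blast
    then have "\<delta> c (?b * x) = 0" using \<delta>(2)[OF c] by blast
    then show "\<delta> c (b * x) = counit b * \<delta> c x"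
      by (simp add: left_diff_distrib scale_mult functional_diff[OF \<delta>(1)[OF c]]
          functional_scale[OF \<delta>(1)[OF c]])
  qed (use \<delta>(1,2)[OF c] span_base[of _ X] in \<open>auto simp: X_def\<close>)
  have dual: "ract (\<delta> c) (coinv_proj c') = (if c' = c then 1 else 0)" if "c \<in> C" "c' \<in> C" for c c'
    using ract_indec_coinv_proj[OF indec[OF that(1)] d] C(1) that(2) \<delta>(3)[OF that] by auto
  \<comment> \<open>Distinct elements of \<open>C\<close> with the same image would pair both to 0
    and to 1.\<close>
  have inj: "inj_on coinv_proj C"
    by (intro inj_onI) (metis dual one_neq_zero)
  define A where "A = coinv_proj ` C"
  define \<delta>' where "\<delta>' = (\<lambda>a. \<delta> (the_inv_into C coinv_proj a))"
  have inv: "the_inv_into C coinv_proj (coinv_proj c) = c" if "c \<in> C" for c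
    using the_inv_into_f_f[OF inj that] .
  define Y where "Y = {b * a | b a. b \<in> coradical \<and> a \<in> A} \<union> decomposables d \<union> corad_filt d"
  have span_Y: "span (decomposables d \<union> corad_filt d) \<subseteq> span Y"
    unfolding Y_def by (intro span_mono) blast
  have Y_mult: "x * b \<in> span Y" if b: "b \<in> coradical" and x: "x \<in> span Y" for b x
  proof (rule endo_span[OF endo_mult_right[OF endo_id] subspace_span _ x], rule image_subsetI)
    fix y assume "y \<in> Y"
    then consider b' a where "y = b' * a" "b' \<in> coradical" "a \<in> A" | "y \<in> decomposables d" | "y \<in> corad_filt d"
      unfolding Y_def by blast
    then show "y * b \<in> span Y"
    proof cases
      case 1
      then have "y * b = (b * b') * a" using coradical_commute[OF b, of y] by (simp add: mult.assoc)
      then show ?thesis unfolding Y_def using 1 coradical_mult[OF b] by (intro span_base) blast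
    next
      case 2
      then obtain u v i j where "y = u * v" "i + j = d" "0 < i" "0 < j"
        "u \<in> corad_filt (Suc i)" "v \<in> corad_filt (Suc j)" unfolding decomposables_def by blast
      moreover from this have "v * b \<in> corad_filt (Suc j)"
        using corad_filt_coradical_mult b by blast
      ultimately have "u * (v * b) \<in> decomposables d" "y * b = u * (v * b)"
        unfolding decomposables_def by (blast, simp add: mult.assoc)
      then show ?thesis unfolding Y_def by (intro span_base) simp
    next
      case 3
      then show ?thesis unfolding Y_def
        using corad_filt_coradical_mult b by (intro span_base) blast
    qed
  qed
  have P_X: "coinv_proj x \<in> span Y" if xX: "x \<in> X" for x
  proof -
    consider "x \<in> decomposables d" | "x \<in> corad_filt d"
      | b y where "x = b * y" "b \<in> coradical" "counit b = 0" "y \<in> corad_filt (Suc d)"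
      using xX unfolding X_def by blast
    then show ?thesis
    proof cases
      case 1
      then show ?thesis using coinv_proj_decomposables span_Y by blast
    next
      case 2
      then show ?thesis
        unfolding Y_def using coinv_proj_corad_filt_shifted by (intro span_base) blast
    next
      case 3
      then have "coinv_proj x \<in> corad_filt d"
        using coinv_proj_coradical_mult[OF d 3(2,4)] by simp
      then show ?thesis unfolding Y_def by (intro span_base) blast
    qed
  qed
  have P_C: "coinv_proj c \<in> span Y" if "c \<in> C" for c
  proof -
    have "1 * coinv_proj c \<in> Y" unfolding Y_def A_def using one_in_coradical that by blast
    then show ?thesis by (intro span_base) simp
  qed
  have P: "coinv_proj x \<in> span Y" if "x \<in> corad_filt (Suc d)" for x
  proof (rule endo_span[OF endo_coinv_proj subspace_span])
    show "x \<in> span (C \<union> span X)" using C(2) that by blast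
    have "coinv_proj ` span X \<subseteq> span Y"
      using endo_span[OF endo_coinv_proj subspace_span, of X] P_X by blast
    then show "coinv_proj ` (C \<union> span X) \<subseteq> span Y" using P_C by blast
  qed
  have "corad_filt (Suc d) \<subseteq> span Y"
  proof
    fix x assume x: "x \<in> corad_filt (Suc d)"
    have "sw (\<lambda>u v. coinv_proj u * corad_proj v) x \<in> span Y"
    proof (rule sw_corad_filt[OF _ subspace_span x])
      show "bilin (\<lambda>u v. coinv_proj u * corad_proj v)"
        by (intro lin_intros endo_coinv_proj endo_comp[OF endo_corad_proj])
      fix i u v assume "i \<le> d" "u \<in> corad_filt (Suc i)"
      then have "u \<in> corad_filt (Suc d)" using corad_filt_monoD[of u "Suc i" "Suc d"] by simp
      then show "coinv_proj u * corad_proj v \<in> span Y" using Y_mult[OF corad_proj_in] P by blast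
    qed
    moreover have "x - sw (\<lambda>u v. coinv_proj u * corad_proj v) x \<in> span Y"
      using coinv_proj_generates[OF d x] unfolding Y_def by (intro span_base) blast
    ultimately show "x \<in> span Y" using span_add by fastforce
  qed
  moreover have "A \<subseteq> corad_filt (Suc d)" unfolding A_def using C(1) coinv_proj_corad_filt by blast
  moreover have "\<forall>a\<in>A. indec_functional d (\<delta>' a)" unfolding A_def \<delta>'_def using inv indec by auto
  moreover have "\<forall>a\<in>A. \<forall>a'\<in>A. ract (\<delta>' a) a' = (if a' = a then 1 else 0)"
    unfolding A_def \<delta>'_def using inv dual inj by (auto simp: inj_on_eq_iff)
  ultimately show ?thesis unfolding Y_def by blast
qed

end

section \<open>Ordered monomials\<close>

lemma sorted_wrt_mset_unique:
  assumes "sorted_wrt (\<lambda>x y. (x, y) \<in> r) xs" "sorted_wrt (\<lambda>x y. (x, y) \<in> r) ys"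
    and "mset xs = mset ys" "antisym r"
  shows "xs = ys"
  using assms(1-3)
proof (induction xs arbitrary: ys)
  case (Cons x xs)
  then obtain y ys' where ys: "ys = y # ys'" by (cases ys) auto
  have "x = y"
  proof (rule ccontr)
    assume "x \<noteq> y"
    have "set (x # xs) = set (y # ys')"
      using Cons.prems(3) unfolding ys by (metis set_mset_mset)
    then have "x \<in> set ys'" "y \<in> set xs" using \<open>x \<noteq> y\<close> by auto
    then have "(y, x) \<in> r" "(x, y) \<in> r" using Cons.prems(1,2) unfolding ys by auto
    then show False using \<open>antisym r\<close> \<open>x \<noteq> y\<close> by (auto dest: antisymD)
  qed
  then show ?case using Cons.IH[of ys'] Cons.prems unfolding ys by simp
qed simp

lemma well_order_on_strict_sorted_list:
  assumes "well_order_on \<Lambda> r" "finite S" "S \<subseteq> \<Lambda>"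
  shows "\<exists>xs. set xs = S \<and> sorted_wrt (\<lambda>l m. (l, m) \<in> r \<and> l \<noteq> m) xs"
  using assms(2,3)
proof (induction S rule: finite_psubset_induct)
  case (psubset S)
  show ?case
  proof (cases "S = {}")
    case False
    have "wf (r - Id)" and tot: "total_on \<Lambda> r"
      using assms(1) by (auto simp: well_order_on_def linear_order_on_def)
    then obtain x where x: "x \<in> S" "\<And>y. (y, x) \<in> r - Id \<Longrightarrow> y \<notin> S"
      using False wfE_min by (metis ex_in_conv)
    have le: "(x, y) \<in> r \<and> x \<noteq> y" if "y \<in> S - {x}" for y
    proof -
      have "x \<in> \<Lambda>" "y \<in> \<Lambda>" "x \<noteq> y" using that x(1) psubset.prems by auto
      then have "(x, y) \<in> r \<or> (y, x) \<in> r" using tot by (simp add: total_on_def)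
      then show ?thesis using x(2)[of y] that by blast
    qed
    obtain xs where "set xs = S - {x}" "sorted_wrt (\<lambda>l m. (l, m) \<in> r \<and> l \<noteq> m) xs"
      using psubset.IH[of "S - {x}"] x(1) psubset.prems by blast
    then have "set (x # xs) = S \<and> sorted_wrt (\<lambda>l m. (l, m) \<in> r \<and> l \<noteq> m) (x # xs)"
      using x(1) le by auto
    then show ?thesis by blast
  qed simp
qed

lemma prod_list_concat_replicate:
  "prod_list (concat (map (\<lambda>(l, k). replicate k (a l)) ps)) = prod_list (map (\<lambda>(l, k). a l ^ k) ps)"
  for a :: "'i \<Rightarrow> 'a::monoid_mult"
  by (induction ps) (auto simp: prod_list_replicate)

lemma sorted_wrt_concat_replicate:
  assumes "refl_on \<Lambda> r" "set (map fst ps) \<subseteq> \<Lambda>"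
    "sorted_wrt (\<lambda>l m. (l, m) \<in> r \<and> l \<noteq> m) (map fst ps)"
  shows "sorted_wrt (\<lambda>x y. (x, y) \<in> r) (concat (map (\<lambda>(l, k). replicate k l) ps))"
  using assms(2,3)
proof (induction ps)
  case (Cons p ps)
  have "(fst p, fst p) \<in> r" using Cons.prems assms(1) by (auto simp: refl_on_def)
  then have "sorted_wrt (\<lambda>x y. (x, y) \<in> r) (replicate k (fst p))" for k
    by (induction k) auto
  then show ?case
    using Cons by (auto simp: sorted_wrt_append case_prod_unfold)
qed simp

lemma count_concat_replicate:
  "distinct L \<Longrightarrow> count (mset (concat (map (\<lambda>l. replicate (f l) l) L))) x = (if x \<in> set L then f x else 0)"
  by (induction L) auto

text \<open>\<open>pbw_set\<close> allows exponent 0, so several lists encode one monomial. Written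
  out as a sorted word, a list is determined by its multiset of letters, because r is
  antisymmetric.\<close>

lemma pbw_set_eq_monomials:
  fixes r :: "'a::ring_1 rel"
  assumes "well_order_on \<Lambda> r"
  shows "\<exists>ord. (\<forall>M. set_mset M \<subseteq> \<Lambda> \<longrightarrow> mset (ord M) = M) \<and>
    pbw_set \<Lambda> r (\<lambda>x. x) = (\<lambda>M. prod_list (ord M)) ` {M. set_mset M \<subseteq> \<Lambda>}"
proof -
  have r: "refl_on \<Lambda> r" "antisym r"
    using assms by (auto simp: well_order_on_def linear_order_on_def partial_order_on_def preorder_on_def)
  define L where "L M = (SOME xs. set xs = set_mset M \<and> sorted_wrt (\<lambda>l m. (l, m) \<in> r \<and> l \<noteq> m) xs)"
    for M :: "'a multiset"
  define ord where "ord M = concat (map (\<lambda>(l, k). replicate k l) (map (\<lambda>l. (l, count M l)) (L M)))"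
    for M :: "'a multiset"
  have L: "set (L M) = set_mset M" "sorted_wrt (\<lambda>l m. (l, m) \<in> r \<and> l \<noteq> m) (L M)"
    if "set_mset M \<subseteq> \<Lambda>" for M
    using someI_ex[OF well_order_on_strict_sorted_list[OF assms finite_set_mset that]]
    unfolding L_def by auto
  have mset_ord: "mset (ord M) = M" if M: "set_mset M \<subseteq> \<Lambda>" for M
  proof (rule multiset_eqI)
    fix x
    have "distinct (L M)"
      using L(2)[OF M] unfolding distinct_conv_nth sorted_wrt_iff_nth_less by (metis nat_neq_iff)
    then show "count (mset (ord M)) x = count M x"
      unfolding ord_def using count_concat_replicate[of "L M" "count M" x] L(1)[OF M]
      by (simp add: comp_def count_eq_zero_iff)
  qed
  have "pbw_set \<Lambda> r (\<lambda>x. x) = (\<lambda>M. prod_list (ord M)) ` {M. set_mset M \<subseteq> \<Lambda>}"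
  proof (intro equalityI subsetI)
    fix p assume "p \<in> pbw_set \<Lambda> r (\<lambda>x. x)"
    then obtain ps where p: "p = prod_list (map (\<lambda>(l, k). l ^ k) ps)" and ps: "set (map fst ps) \<subseteq> \<Lambda>"
      "sorted_wrt (\<lambda>l m. (l, m) \<in> r \<and> l \<noteq> m) (map fst ps)"
      unfolding pbw_set_def by blast
    define xs where "xs = concat (map (\<lambda>(l, k). replicate k l) ps)"
    have xs: "set_mset (mset xs) \<subseteq> \<Lambda>" using ps(1) unfolding xs_def by (auto split: if_splits)
    have "sorted_wrt (\<lambda>x y. (x, y) \<in> r) xs"
      unfolding xs_def by (rule sorted_wrt_concat_replicate[OF r(1) ps])
    moreover have "sorted_wrt (\<lambda>x y. (x, y) \<in> r) (ord (mset xs))"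
      unfolding ord_def
      by (rule sorted_wrt_concat_replicate[OF r(1)]) (use L[OF xs] xs in \<open>simp_all add: comp_def\<close>)
    ultimately have "xs = ord (mset xs)"
      by (rule sorted_wrt_mset_unique) (simp_all add: mset_ord[OF xs] r)
    moreover have "p = prod_list xs"
      unfolding p xs_def using prod_list_concat_replicate[of "\<lambda>x. x" ps] by simp
    ultimately have "p = prod_list (ord (mset xs))" by simp
    then show "p \<in> (\<lambda>M. prod_list (ord M)) ` {M. set_mset M \<subseteq> \<Lambda>}" using xs by blast
  next
    fix p assume "p \<in> (\<lambda>M. prod_list (ord M)) ` {M. set_mset M \<subseteq> \<Lambda>}"
    then obtain M where M: "set_mset M \<subseteq> \<Lambda>" and p: "p = prod_list (ord M)" by blast
    have "p = prod_list (map (\<lambda>(l, k). l ^ k) (map (\<lambda>l. (l, count M l)) (L M)))"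
      unfolding p ord_def using prod_list_concat_replicate[of "\<lambda>x. x"] by blast
    then show "p \<in> pbw_set \<Lambda> r (\<lambda>x. x)"
      unfolding pbw_set_def using L[OF M] M
      by (intro CollectI exI[of _ "map (\<lambda>l. (l, count M l)) (L M)"]) (simp add: comp_def)
  qed
  then show ?thesis using mset_ord by blast
qed

section \<open>The PBW basis\<close>

context hopf_central_coradical
begin

lemma corad_filt_mult':
  "x \<in> corad_filt (Suc i) \<Longrightarrow> y \<in> corad_filt n \<Longrightarrow> x * y \<in> corad_filt (i + n)"
  "x \<in> corad_filt n \<Longrightarrow> y \<in> corad_filt (Suc j) \<Longrightarrow> x * y \<in> corad_filt (n + j)"
  using corad_filt_mult[of x i y "n - 1"] corad_filt_mult[of x "n - 1" y j]
  by (cases n; simp add: subspace_0[OF subspace_corad_filt])+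

lemma subspace_diff_cancel:
  assumes "subspace T" "x - y \<in> T" "y \<in> T"
  shows "x \<in> T"
  using subspace_add[OF assms] by simp

lemma subspace_of_nat_mult:
  assumes "subspace T" "x \<in> T"
  shows "of_nat n * x \<in> T"
  using assms by (induction n) (auto simp: subspace_0 subspace_add distrib_right)

text \<open>Multiplication by n is scaling by \<open>of_nat n\<close>, which is invertible in k:
  here characteristic zero enters.\<close>

lemma of_nat_mult_eq_0:
  assumes "of_nat n * x = 0" "n \<noteq> 0"
  shows "x = (0 :: 'h)"
proof -
  have "of_nat n * x = scale (of_nat n) x" for n
    by (induction n) (simp_all add: scale_left_distrib distrib_right)
  then show ?thesis using assms by simp
qed

text \<open>
  \<open>gr_power m N\<close> is the preimage in \<open>H\<^sub>N\<close> of the degree \<open>N\<close> part of the \<open>m\<close>-th power of the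
  augmentation ideal of the associated graded algebra.
\<close>

primrec gr_power :: "nat \<Rightarrow> nat \<Rightarrow> 'h set" where
  "gr_power 0 N = corad_filt (Suc N)"
| "gr_power (Suc m) N = span (corad_filt N \<union>
     {y * z | y z n. 0 < n \<and> n \<le> N \<and> y \<in> corad_filt (Suc n) \<and> z \<in> gr_power m (N - n)})"

lemma subspace_gr_power: "subspace (gr_power m N)"
  by (cases m) (simp_all add: subspace_corad_filt)

lemma corad_filt_subset_gr_power: "corad_filt N \<subseteq> gr_power m N"
  using corad_filt_Suc_mono by (cases m) (auto intro: span_base)

declare gr_power.simps(2) [simp del]

lemma gr_power_SucI:
  "0 < n \<Longrightarrow> n \<le> N \<Longrightarrow> y \<in> corad_filt (Suc n) \<Longrightarrow> z \<in> gr_power m (N - n) \<Longrightarrow> y * z \<in> gr_power (Suc m) N"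
  unfolding gr_power.simps by (intro span_base) blast

lemma gr_power_subset_corad_filt: "gr_power m N \<subseteq> corad_filt (Suc N)"
proof (induction m arbitrary: N)
  case (Suc m)
  show ?case unfolding gr_power.simps
  proof (rule span_minimal[OF _ subspace_corad_filt], rule subsetI)
    fix x assume "x \<in> corad_filt N \<union>
      {y * z | y z n. 0 < n \<and> n \<le> N \<and> y \<in> corad_filt (Suc n) \<and> z \<in> gr_power m (N - n)}"
    then consider "x \<in> corad_filt N"
      | y z n where "x = y * z" "n \<le> N" "y \<in> corad_filt (Suc n)" "z \<in> gr_power m (N - n)"
      by blast
    then show "x \<in> corad_filt (Suc N)"
    proof cases
      case 1
      then show ?thesis using corad_filt_Suc_mono by blast
    next
      case 2
      then have "z \<in> corad_filt (Suc (N - n))" using Suc by blast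
      from corad_filt_mult[OF 2(3) this] show ?thesis using 2 by simp
    qed
  qed
qed simp

lemma gr_power_Suc_subset: "gr_power (Suc m) N \<subseteq> gr_power m N"
proof (induction m arbitrary: N)
  case 0
  show ?case using gr_power_subset_corad_filt[of "Suc 0" N] by simp
next
  case (Suc m)
  then show ?case
    unfolding gr_power.simps(2)[of "Suc m"] gr_power.simps(2)[of m N]
    by (intro span_mono) blast
qed

lemma gr_power_antimono: "m \<le> n \<Longrightarrow> gr_power n N \<subseteq> gr_power m N"
  using lift_Suc_antimono_le[of "\<lambda>m. gr_power m N"] gr_power_Suc_subset by blast

text \<open>w is merged into the leading factor of each product, so the number of factors of
  positive degree does not drop; w itself may have degree 0.\<close>

lemma gr_power_mult_left:
  assumes w: "w \<in> corad_filt (Suc k)" and z: "z \<in> gr_power m N"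
  shows "w * z \<in> gr_power m (k + N)"
proof (cases m)
  case 0
  then show ?thesis using assms corad_filt_mult by simp
next
  case (Suc m')
  show ?thesis
  proof (rule endo_span[OF endo_mult_left[OF endo_id] subspace_gr_power])
    show "z \<in> span (corad_filt N \<union>
      {y * z | y z n. 0 < n \<and> n \<le> N \<and> y \<in> corad_filt (Suc n) \<and> z \<in> gr_power m' (N - n)})"
      using z unfolding Suc gr_power.simps(2) .
    show "(*) w ` (corad_filt N \<union>
      {y * z | y z n. 0 < n \<and> n \<le> N \<and> y \<in> corad_filt (Suc n) \<and> z \<in> gr_power m' (N - n)})
      \<subseteq> gr_power m (k + N)"
    proof (rule image_subsetI, elim UnE)
      fix x assume "x \<in> corad_filt N"
      then show "w * x \<in> gr_power m (k + N)"
        using corad_filt_mult'(1)[OF w] corad_filt_subset_gr_power by blast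
    next
      fix x assume "x \<in> {y * z | y z n. 0 < n \<and> n \<le> N \<and> y \<in> corad_filt (Suc n) \<and> z \<in> gr_power m' (N - n)}"
      then obtain y z n where x: "x = y * z" "0 < n" "n \<le> N" "y \<in> corad_filt (Suc n)" "z \<in> gr_power m' (N - n)"
        by blast
      have "(w * y) * z \<in> gr_power m (k + N)"
        unfolding Suc
        by (rule gr_power_SucI[of "k + n"]) (use x corad_filt_mult[OF w x(4)] in auto)
      then show "w * x \<in> gr_power m (k + N)" by (simp add: x mult.assoc)
    qed
  qed
qed

lemma gr_power_mult_coradical:
  "b \<in> coradical \<Longrightarrow> z \<in> gr_power m N \<Longrightarrow> b * z \<in> gr_power m N"
  using gr_power_mult_left[of b 0 z m N] by (simp add: corad_filt_1)

text \<open>By Leibniz, differentiating y may leave degree 0 and cost that factor, but z keeps all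
  of its own; differentiating z costs one factor there, and y makes up for it.\<close>

lemma ract_indec_gr_power:
  assumes \<delta>: "indec_functional d \<delta>" and d: "0 < d"
  shows "x \<in> gr_power (Suc m) N \<Longrightarrow> d \<le> N \<Longrightarrow> ract \<delta> x \<in> gr_power m (N - d)"
proof (induction m arbitrary: x N)
  case 0
  then have "x \<in> corad_filt (Suc N)" using gr_power_subset_corad_filt by blast
  from ract_indec_corad_filt[OF \<delta> this] 0 show ?case by (simp add: Suc_diff_le)
next
  case (Suc m)
  note \<delta>f = indec_functionalD(1)[OF \<delta>]
  show ?case
  proof (rule endo_span[OF endo_ract[OF \<delta>f] subspace_gr_power _
        Suc.prems(1)[unfolded gr_power.simps(2)[of "Suc m"]]], rule image_subsetI, elim UnE)
    fix x assume "x \<in> corad_filt N"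
    then show "ract \<delta> x \<in> gr_power (Suc m) (N - d)"
      using ract_indec_corad_filt[OF \<delta>] corad_filt_subset_gr_power by blast
  next
    fix x assume "x \<in> {y * z | y z n. 0 < n \<and> n \<le> N \<and> y \<in> corad_filt (Suc n) \<and> z \<in> gr_power (Suc m) (N - n)}"
    then obtain y z n where x: "x = y * z" and n: "0 < n" "n \<le> N"
      and y: "y \<in> corad_filt (Suc n)" and z: "z \<in> gr_power (Suc m) (N - n)" by blast
    have zf: "z \<in> corad_filt (Suc (N - n))" using z gr_power_subset_corad_filt by blast
    have "ract \<delta> (y * z) - (ract \<delta> y * z + y * ract \<delta> z) \<in> corad_filt (N - d)"
      using ract_indec_mult[OF \<delta> d y zf] n by simp
    then have "ract \<delta> (y * z) - (ract \<delta> y * z + y * ract \<delta> z) \<in> gr_power (Suc m) (N - d)"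
      using corad_filt_subset_gr_power by blast
    moreover have "ract \<delta> y * z \<in> gr_power (Suc m) (N - d)"
    proof (cases "d \<le> n")
      case True
      then have "ract \<delta> y \<in> corad_filt (Suc (n - d))"
        using ract_indec_corad_filt[OF \<delta> y] by (simp add: Suc_diff_le)
      from gr_power_mult_left[OF this z] show ?thesis using True n by simp
    next
      case False
      then have "ract \<delta> y = 0" using ract_indec_corad_filt[OF \<delta> y] by simp
      then show ?thesis by (simp add: subspace_0[OF subspace_gr_power])
    qed
    moreover have "y * ract \<delta> z \<in> gr_power (Suc m) (N - d)"
    proof (cases "d \<le> N - n")
      case True
      then have "ract \<delta> z \<in> gr_power m (N - n - d)" using Suc.IH[OF z] by simp
      then show ?thesis
        using True n y by (intro gr_power_SucI[of n]) (simp_all add: add.commute)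
    next
      case False
      then have "ract \<delta> z = 0" using ract_indec_corad_filt[OF \<delta> zf] by simp
      then show ?thesis by (simp add: subspace_0[OF subspace_gr_power])
    qed
    ultimately show "ract \<delta> x \<in> gr_power (Suc m) (N - d)"
      unfolding x by (rule subspace_diff_cancel[OF subspace_gr_power _ subspace_add[OF subspace_gr_power]])
  qed
qed

end

text \<open>Fixes the choices made in all degrees. Of the word \<open>ord M\<close> only the
  multiset of letters is recorded: reordering changes a product by lower filtration terms, so the
  well-order matters only for describing \<open>pbw_set\<close>.\<close>

locale graded_generators = hopf_central_coradical scale comult counit antipode
  for scale :: "'k::field_char_0 \<Rightarrow> 'h::ring_1 \<Rightarrow> 'h"
    and comult :: "'h \<Rightarrow> ('h \<times> 'h \<Rightarrow>\<^sub>0 'k) set"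
    and counit :: "'h \<Rightarrow> 'k"
    and antipode :: "'h \<Rightarrow> 'h" +
  fixes gens :: "nat \<Rightarrow> 'h set" and dual :: "nat \<Rightarrow> 'h \<Rightarrow> 'h \<Rightarrow> 'k"
    and \<Lambda> :: "'h set" and ord :: "'h multiset \<Rightarrow> 'h list"
  assumes gens_corad_filt: "0 < d \<Longrightarrow> gens d \<subseteq> corad_filt (Suc d)"
    and indec_dual: "0 < d \<Longrightarrow> a \<in> gens d \<Longrightarrow> indec_functional d (dual d a)"
    and ract_dual: "0 < d \<Longrightarrow> a \<in> gens d \<Longrightarrow> a' \<in> gens d \<Longrightarrow> ract (dual d a) a' = (if a' = a then 1 else 0)"
    and gens_span: "0 < d \<Longrightarrow> corad_filt (Suc d)
      \<subseteq> span ({b * a | b a. b \<in> coradical \<and> a \<in> gens d} \<union> decomposables d \<union> corad_filt d)"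
    and \<Lambda>_eq: "\<Lambda> = (\<Union>d\<in>{0<..}. gens d)"
    and mset_ord: "set_mset M \<subseteq> \<Lambda> \<Longrightarrow> mset (ord M) = M"
begin

section \<open>Degrees, words and monomials\<close>

definition deg :: "'h \<Rightarrow> nat" where
  "deg a = (THE d. 0 < d \<and> a \<in> gens d)"

definition weight :: "'h multiset \<Rightarrow> nat" where
  "weight M = sum_mset (image_mset deg M)"

lemma weight_simps [simp]: "weight {#} = 0" "weight (add_mset a M) = deg a + weight M"
  "weight (M + M') = weight M + weight M'"
  by (simp_all add: weight_def)

definition monomial :: "'h multiset \<Rightarrow> 'h" where
  "monomial M = prod_list (ord M)"

text \<open>If d < e, the derivation dual to a in degree e kills a because a has degree d, yet must
  send it to 1.\<close>

lemma gens_disjoint: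
  assumes "0 < d" "0 < e" "a \<in> gens d" "a \<in> gens e"
  shows "d = e"
proof -
  have "False" if "d < e" "0 < d" "a \<in> gens d" "a \<in> gens e" for d e
  proof -
    have "ract (dual e a) a \<in> corad_filt (Suc d - e)"
      by (rule ract_indec_corad_filt[OF indec_dual]) (use that gens_corad_filt[of d] in auto)
    then show False using ract_dual[of e a a] that by simp
  qed
  then show ?thesis using assms by (metis linorder_neqE_nat)
qed

lemma deg_eq: "0 < d \<Longrightarrow> a \<in> gens d \<Longrightarrow> deg a = d"
  unfolding deg_def using gens_disjoint by (intro the_equality) auto

lemma \<Lambda>D:
  assumes "a \<in> \<Lambda>"
  shows "0 < deg a" "a \<in> gens (deg a)" "a \<in> corad_filt (Suc (deg a))"
proof -
  obtain d where d: "0 < d" "a \<in> gens d" using assms by (auto simp: \<Lambda>_eq)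
  then show "0 < deg a" "a \<in> gens (deg a)" by (simp_all add: deg_eq)
  then show "a \<in> corad_filt (Suc (deg a))" using gens_corad_filt by blast
qed

lemma prod_list_gr_power: "set xs \<subseteq> \<Lambda> \<Longrightarrow> prod_list xs \<in> gr_power (length xs) (weight (mset xs))"
proof (induction xs)
  case Nil
  then show ?case using one_in_coradical by (simp add: corad_filt_1)
next
  case (Cons a xs)
  then have "a * prod_list xs \<in> gr_power (Suc (length xs)) (deg a + weight (mset xs))"
    using \<Lambda>D[of a] by (intro gr_power_SucI[of "deg a"]) auto
  then show ?case by simp
qed

lemma prod_list_corad_filt: "set xs \<subseteq> \<Lambda> \<Longrightarrow> prod_list xs \<in> corad_filt (Suc (weight (mset xs)))"
  using prod_list_gr_power gr_power_subset_corad_filt by blast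

text \<open>Moving the first letter of xs to its place in ys costs one commutator, which lies one
  filtration step lower.\<close>

lemma prod_list_perm:
  "mset xs = mset ys \<Longrightarrow> set xs \<subseteq> \<Lambda> \<Longrightarrow> prod_list xs - prod_list ys \<in> corad_filt (weight (mset xs))"
proof (induction xs arbitrary: ys)
  case Nil
  then show ?case by (simp add: subspace_0[OF subspace_corad_filt])
next
  case (Cons a xs)
  have "a \<in> set ys" using Cons.prems(1) by (metis list.set_intros(1) mset_eq_setD)
  then obtain l r where ys: "ys = l @ a # r" by (meson split_list)
  then have lr: "mset xs = mset (l @ r)" using Cons.prems(1) by simp
  have setlr: "set l \<subseteq> \<Lambda>" "set r \<subseteq> \<Lambda>"
    using Cons.prems(2) mset_eq_setD[OF lr] by auto
  have a: "a \<in> corad_filt (Suc (deg a))" using Cons.prems \<Lambda>D(3) by simp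
  have "prod_list xs - prod_list (l @ r) \<in> corad_filt (weight (mset xs))"
    using Cons.IH[OF lr] Cons.prems(2) by simp
  then have 1: "a * (prod_list xs - prod_list (l @ r)) \<in> corad_filt (deg a + weight (mset xs))"
    by (rule corad_filt_mult'(1)[OF a])
  have "a * prod_list l - prod_list l * a \<in> corad_filt (deg a + weight (mset l))"
    by (rule corad_filt_commutator[OF a prod_list_corad_filt[OF setlr(1)]])
  then have "(a * prod_list l - prod_list l * a) * prod_list r
      \<in> corad_filt (deg a + weight (mset l) + weight (mset r))"
    by (rule corad_filt_mult'(2)[OF _ prod_list_corad_filt[OF setlr(2)]])
  then have 2: "(a * prod_list l - prod_list l * a) * prod_list r \<in> corad_filt (deg a + weight (mset xs))"
    unfolding lr by (simp add: add.assoc)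
  show ?case
    using subspace_add[OF subspace_corad_filt 1 2] unfolding ys by (simp add: algebra_simps)
qed

lemma ord_in: "set_mset M \<subseteq> \<Lambda> \<Longrightarrow> set (ord M) \<subseteq> \<Lambda>"
  by (metis mset_ord set_mset_mset)

lemma prod_list_monomial:
  "set xs \<subseteq> \<Lambda> \<Longrightarrow> prod_list xs - monomial (mset xs) \<in> corad_filt (weight (mset xs))"
  unfolding monomial_def by (rule prod_list_perm) (simp_all add: mset_ord)

lemma monomial_gr_power: "set_mset M \<subseteq> \<Lambda> \<Longrightarrow> monomial M \<in> gr_power (size M) (weight M)"
  unfolding monomial_def
  using prod_list_gr_power[OF ord_in] mset_ord by (metis size_mset)

lemma monomial_corad_filt: "set_mset M \<subseteq> \<Lambda> \<Longrightarrow> monomial M \<in> corad_filt (Suc (weight M))"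
  using monomial_gr_power gr_power_subset_corad_filt by blast

lemma ract_dual_eq_0:
  assumes "l \<in> gens d" "0 < d" "x \<in> corad_filt (Suc N)" "N < d"
  shows "ract (dual d l) x = 0"
  using ract_indec_corad_filt[OF indec_dual[OF assms(2,1)] assms(3)] assms(4) by simp

lemma deg_le_weight: "l \<in># M \<Longrightarrow> deg l \<le> weight M"
  by (metis insert_DiffM weight_simps(2) le_add1)

text \<open>Modulo higher powers of the augmentation ideal, the derivation dual to \<open>l\<close> acts on
  monomials as \<open>\<partial>/\<partial>l\<close>.\<close>

lemma ract_dual_prod_list:
  assumes l: "l \<in> gens d" and d: "0 < d"
  shows "set xs \<subseteq> \<Lambda> \<Longrightarrow>
    ract (dual d l) (prod_list xs) - of_nat (count (mset xs) l) * prod_list (remove1 l xs)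
      \<in> gr_power (length xs) (weight (mset xs) - d)"
proof (induction xs)
  case Nil
  have "ract (dual d l) 1 = 0"
    by (rule ract_indec_coradical[OF indec_dual[OF d l] d one_in_coradical])
  then show ?case by (simp add: subspace_0[OF subspace_corad_filt])
next
  case (Cons a xs)
  define \<delta> where "\<delta> = dual d l"
  define p where "p = prod_list xs"
  define r where "r = prod_list (remove1 l xs)"
  define c where "c = count (mset xs) l"
  let ?I = "gr_power (length (a # xs)) (weight (mset (a # xs)) - d)"
  note sub = subspace_gr_power[of "length (a # xs)" "weight (mset (a # xs)) - d"]
  have \<delta>: "indec_functional d \<delta>" unfolding \<delta>_def by (rule indec_dual[OF d l])
  have a: "a \<in> \<Lambda>" "a \<in> corad_filt (Suc (deg a))" "0 < deg a" "a \<in> gens (deg a)"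
    and xs: "set xs \<subseteq> \<Lambda>" using Cons.prems \<Lambda>D[of a] by auto
  have p: "p \<in> corad_filt (Suc (weight (mset xs)))" "p \<in> gr_power (length xs) (weight (mset xs))"
    unfolding p_def using prod_list_corad_filt[OF xs] prod_list_gr_power[OF xs] by auto
  have "ract \<delta> (a * p) - (ract \<delta> a * p + a * ract \<delta> p) \<in> corad_filt (deg a + weight (mset xs) - d)"
    by (rule ract_indec_mult[OF \<delta> d a(2) p(1)])
  then have 1: "ract \<delta> (a * p) - (ract \<delta> a * p + a * ract \<delta> p) \<in> ?I"
    using corad_filt_subset_gr_power by auto
  \<comment> \<open>The factor a raises the power by one, as the longer word requires of the error
    from the induction hypothesis.\<close>
  have 2: "a * (ract \<delta> p - of_nat c * r) \<in> ?I"
  proof (cases "d \<le> weight (mset xs)")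
    case True
    have "ract \<delta> p - of_nat c * r \<in> gr_power (length xs) (weight (mset xs) - d)"
      using Cons.IH[OF xs] unfolding \<delta>_def p_def c_def r_def .
    then show ?thesis
      unfolding list.size add_0_right add_Suc_right
      using a True by (intro gr_power_SucI[of "deg a"]) auto
  next
    case False
    then have "ract \<delta> p = 0" unfolding \<delta>_def using ract_dual_eq_0[OF l d p(1)] by simp
    moreover have "c = 0"
      unfolding c_def using False deg_le_weight[of l "mset xs"] deg_eq[OF d l] by (auto simp: not_in_iff)
    ultimately have "a * (ract \<delta> p - of_nat c * r) = 0" by simp
    then show ?thesis using subspace_0[OF sub] by (simp only:)
  qed
  have 3: "ract \<delta> a * p + a * (of_nat c * r)
      - of_nat (count (mset (a # xs)) l) * prod_list (remove1 l (a # xs)) \<in> ?I"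
  \<comment> \<open>If a = l, the derivation returns 1 and p itself joins the main term, raising the
    multiplicity from c to c + 1; the other c summands l * r equal p up to reordering.\<close>
  proof (cases "a = l")
    case True
    have "ract \<delta> a = 1" unfolding \<delta>_def True using ract_dual[OF d l l] by simp
    moreover have "of_nat c * (l * r - p) \<in> ?I"
    proof (cases "l \<in> set xs")
      case True': True
      have "prod_list (l # remove1 l xs) - prod_list xs \<in> corad_filt (weight (mset (l # remove1 l xs)))"
        by (rule prod_list_perm) (use True' True a(1) xs set_remove1_subset[of l xs] in auto)
      moreover have "weight (mset (l # remove1 l xs)) = weight (mset (a # xs)) - d"
        using True' True deg_eq[OF d l] by simp
      ultimately have "l * r - p \<in> ?I"
        unfolding r_def p_def using corad_filt_subset_gr_power by auto
      then show ?thesis by (rule subspace_of_nat_mult[OF sub])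
    next
      case False
      then have "c = 0" unfolding c_def by (simp add: count_eq_zero_iff)
      then have "of_nat c * (l * r - p) = 0" by simp
      then show ?thesis using subspace_0[OF sub] by (simp only:)
    qed
    moreover have "a * (of_nat c * r) = of_nat c * (a * r)"
      by (simp add: mult_of_nat_commute[of c a] flip: mult.assoc)
    ultimately show ?thesis
      using True by (simp add: p_def[symmetric] c_def[symmetric] algebra_simps)
  next
    case False
    have "ract \<delta> a * p \<in> ?I"
    proof (cases "deg a \<le> d")
      case True
      then have "ract \<delta> a = 0"
        using ract_dual[OF d l] ract_dual_eq_0[OF l d a(2)] a(4) False
        unfolding \<delta>_def by (cases "deg a = d") auto
      then have "ract \<delta> a * p = 0" by simp
      then show ?thesis using subspace_0[OF sub] by (simp only:)
    next
      \<comment> \<open>Here the derivative of a lies in degree \<open>deg a - d\<close> > 0, so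
        together with p it still makes \<open>Suc (length xs)\<close> factors. Such a term need not
        drop in the filtration; it is absorbed by the power.\<close>
      case gt: False
      then have "ract \<delta> a \<in> corad_filt (Suc (deg a - d))"
        using ract_indec_corad_filt[OF \<delta> a(2)] by (simp add: Suc_diff_le)
      then show ?thesis
        unfolding list.size add_0_right add_Suc_right
        using gt p(2) by (intro gr_power_SucI[of "deg a - d"]) auto
    qed
    moreover have "a * (of_nat c * r) = of_nat c * (a * r)"
      by (simp add: mult_of_nat_commute[of c a] flip: mult.assoc)
    ultimately show ?thesis using False by (simp add: c_def r_def)
  qed
  have "ract (dual d l) (prod_list (a # xs))
      - of_nat (count (mset (a # xs)) l) * prod_list (remove1 l (a # xs))
    = (ract \<delta> (a * p) - (ract \<delta> a * p + a * ract \<delta> p)) + a * (ract \<delta> p - of_nat c * r)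
      + (ract \<delta> a * p + a * (of_nat c * r) - of_nat (count (mset (a # xs)) l) * prod_list (remove1 l (a # xs)))"
    unfolding \<delta>_def p_def by (simp add: right_diff_distrib)
  also have "\<dots> \<in> ?I" by (intro subspace_add[OF sub] 1 2 3)
  finally show ?case .
qed

text \<open>Deleting l from \<open>ord M\<close> need not give \<open>ord (M - {#l#})\<close>; the
  two words differ by a permutation, hence by lower filtration terms.\<close>

lemma ract_dual_monomial:
  assumes l: "l \<in> gens d" and d: "0 < d" and M: "set_mset M \<subseteq> \<Lambda>"
  shows "ract (dual d l) (monomial M) - of_nat (count M l) * monomial (M - {#l#})
      \<in> gr_power (size M) (weight M - d)"
proof (cases "l \<in># M")
  case True
  have xs: "mset (ord M) = M" "set (ord M) \<subseteq> \<Lambda>" by (simp_all add: mset_ord M ord_in)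
  have len: "length (ord M) = size M" by (metis xs(1) size_mset)
  have "prod_list (remove1 l (ord M)) - monomial (M - {#l#}) \<in> corad_filt (weight (M - {#l#}))"
    using prod_list_monomial[of "remove1 l (ord M)"] xs set_remove1_subset[of l "ord M"] by auto
  moreover have "weight (M - {#l#}) = weight M - d"
    using True deg_eq[OF d l] weight_simps(2)[of l "M - {#l#}"] by simp
  ultimately have "prod_list (remove1 l (ord M)) - monomial (M - {#l#}) \<in> gr_power (size M) (weight M - d)"
    using corad_filt_subset_gr_power by auto
  then have 1: "of_nat (count M l) * (prod_list (remove1 l (ord M)) - monomial (M - {#l#}))
      \<in> gr_power (size M) (weight M - d)"
    by (rule subspace_of_nat_mult[OF subspace_gr_power])
  from subspace_add[OF subspace_gr_power ract_dual_prod_list[OF l d xs(2), unfolded xs(1) len] 1]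
  show ?thesis by (simp add: monomial_def algebra_simps)
next
  case False
  then show ?thesis
    using ract_dual_prod_list[OF l d ord_in[OF M]] mset_ord[OF M]
    by (simp add: monomial_def not_in_iff) (metis size_mset)
qed

text \<open>Differentiate along a letter l of \<open>M0\<close>. Monomials without l vanish modulo
  the higher power, M |-> M - {#l#} is injective on the others, and the induction hypothesis leaves
  \<open>count M0 l\<close> times \<open>b M0\<close> equal to 0.\<close>

lemma monomials_independent_graded:
  assumes "finite \<M>" "\<And>M. M \<in> \<M> \<Longrightarrow> set_mset M \<subseteq> \<Lambda> \<and> size M = m \<and> weight M = N"
    and "\<And>M. M \<in> \<M> \<Longrightarrow> b M \<in> coradical" "(\<Sum>M\<in>\<M>. b M * monomial M) \<in> gr_power (Suc m) N"
    and "M0 \<in> \<M>"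
  shows "b M0 = 0"
  using assms
proof (induction m arbitrary: N \<M> b M0)
  case 0
  then have M: "\<M> = {{#}}" "M0 = {#}" by force+
  then have "N = 0" using 0(2)[of "{#}"] by simp
  have "mset (ord {#}) = {#}" by (rule mset_ord) simp
  then have "monomial {#} = 1" by (simp add: monomial_def)
  \<comment> \<open>In degree 0 there is no room for a factor of positive degree, which leaves the
    span of \<open>corad_filt 0\<close>.\<close>
  moreover have "gr_power (Suc 0) 0 = {0}" by (simp add: gr_power.simps(2))
  ultimately show ?case using 0(4) unfolding M \<open>N = 0\<close> by simp
next
  case (Suc m)
  have props: "set_mset M \<subseteq> \<Lambda>" "size M = Suc m" "weight M = N" if "M \<in> \<M>" for M
    using Suc.prems(2)[OF that] by auto
  obtain l where l: "l \<in># M0" using props(2)[OF Suc.prems(5)] by fastforce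
  define d where "d = deg l"
  have "l \<in> \<Lambda>" using l props(1)[OF Suc.prems(5)] by blast
  then have ld: "l \<in> gens d" "0 < d" using \<Lambda>D unfolding d_def by auto
  have dN: "d \<le> N" using deg_le_weight[OF l] props(3)[OF Suc.prems(5)] unfolding d_def by simp
  have \<delta>: "indec_functional d (dual d l)" by (rule indec_dual[OF ld(2,1)])
  note endo = endo_ract[OF indec_functionalD(1)[OF \<delta>]]
  note sub = subspace_gr_power[of "Suc m" "N - d"]
  have 1: "(\<Sum>M\<in>\<M>. ract (dual d l) (b M * monomial M)) \<in> gr_power (Suc m) (N - d)"
    unfolding endo_sum[OF endo, symmetric]
    by (rule ract_indec_gr_power[OF \<delta> ld(2) Suc.prems(4) dN])
  have 2: "ract (dual d l) (b M * monomial M) - b M * (of_nat (count M l) * monomial (M - {#l#}))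
      \<in> gr_power (Suc m) (N - d)" if M: "M \<in> \<M>" for M
  proof -
    have b: "b M \<in> coradical" using Suc.prems(3)[OF M] .
    have "ract (dual d l) (b M * monomial M) - b M * ract (dual d l) (monomial M) \<in> corad_filt (N - d)"
      using ract_indec_coradical_mult[OF \<delta> ld(2) b] monomial_corad_filt[OF props(1)[OF M]] props(3)[OF M]
      by simp
    then have "ract (dual d l) (b M * monomial M) - b M * ract (dual d l) (monomial M)
        \<in> gr_power (Suc m) (N - d)"
      using corad_filt_subset_gr_power by blast
    moreover have "b M * (ract (dual d l) (monomial M) - of_nat (count M l) * monomial (M - {#l#}))
        \<in> gr_power (Suc m) (N - d)"
      using ract_dual_monomial[OF ld props(1)[OF M]] props[OF M]
      by (intro gr_power_mult_coradical[OF b]) simp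
    ultimately show ?thesis
      using subspace_add[OF sub] by (fastforce simp: right_diff_distrib)
  qed
  have "(\<Sum>M\<in>\<M>. ract (dual d l) (b M * monomial M)) -
      (\<Sum>M\<in>\<M>. ract (dual d l) (b M * monomial M) - b M * (of_nat (count M l) * monomial (M - {#l#})))
      \<in> gr_power (Suc m) (N - d)"
    by (intro subspace_diff[OF sub] 1 subspace_sum[OF sub] 2)
  then have 3: "(\<Sum>M\<in>\<M>. b M * (of_nat (count M l) * monomial (M - {#l#}))) \<in> gr_power (Suc m) (N - d)"
    by (simp add: sum_subtractf)
  define \<M>' where "\<M>' = {M \<in> \<M>. l \<in># M}"
  \<comment> \<open>The coefficient of the derivative at M: it comes from the term
    \<open>add_mset l M\<close>.\<close>
  define b' where "b' M = of_nat (count (add_mset l M) l) * b (add_mset l M)" for M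
  have inj: "inj_on (\<lambda>M. M - {#l#}) \<M>'"
    by (rule inj_onI) (metis (mono_tags, lifting) \<M>'_def insert_DiffM mem_Collect_eq)
  have "(\<Sum>M\<in>\<M>. b M * (of_nat (count M l) * monomial (M - {#l#})))
      = (\<Sum>M\<in>\<M>'. b M * (of_nat (count M l) * monomial (M - {#l#})))"
    unfolding \<M>'_def using Suc.prems(1)
    by (intro sum.mono_neutral_right) (auto simp: not_in_iff)
  also have "\<dots> = (\<Sum>M\<in>\<M>'. b' (M - {#l#}) * monomial (M - {#l#}))"
    by (rule sum.cong)
      (auto simp: b'_def \<M>'_def mult_of_nat_commute[of _ "b _"] mult.assoc[symmetric]
        simp del: of_nat_Suc of_nat_add count_add_mset)
  also have "\<dots> = (\<Sum>M\<in>(\<lambda>M. M - {#l#}) ` \<M>'. b' M * monomial M)"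
    by (simp add: sum.reindex[OF inj])
  finally have 4: "(\<Sum>M\<in>(\<lambda>M. M - {#l#}) ` \<M>'. b' M * monomial M) \<in> gr_power (Suc m) (N - d)"
    using 3 by simp
  have "b' (M0 - {#l#}) = 0"
  proof (rule Suc.IH[OF _ _ _ 4])
    show "finite ((\<lambda>M. M - {#l#}) ` \<M>')" using Suc.prems(1) unfolding \<M>'_def by simp
    show "M0 - {#l#} \<in> (\<lambda>M. M - {#l#}) ` \<M>'" using Suc.prems(5) l unfolding \<M>'_def by blast
    fix M assume "M \<in> (\<lambda>M. M - {#l#}) ` \<M>'"
    then obtain M1 where M1: "M1 \<in> \<M>" "l \<in># M1" "M = M1 - {#l#}" unfolding \<M>'_def by blast
    then have eq: "M1 = add_mset l M" by simp
    show "set_mset M \<subseteq> \<Lambda> \<and> size M = m \<and> weight M = N - d"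
      using props[OF M1(1)] unfolding eq d_def by auto
    show "b' M \<in> coradical"
      unfolding b'_def eq[symmetric]
      by (rule subspace_of_nat_mult[OF subspace_coradical Suc.prems(3)[OF M1(1)]])
  qed
  then have "of_nat (count M0 l) * b M0 = 0" unfolding b'_def using l by simp
  then show ?case by (rule of_nat_mult_eq_0) (use l in \<open>simp add: count_eq_zero_iff\<close>)
qed

section \<open>Spanning and independence over the coradical\<close>

lemma monomial_singleton: "a \<in> \<Lambda> \<Longrightarrow> monomial {#a#} = a"
  using mset_ord[of "{#a#}"] by (simp add: monomial_def)

lemma monomial_empty: "monomial {#} = 1"
  using mset_ord[of "{#}"] by (simp add: monomial_def)

text \<open>A decomposable is a product of two elements of smaller degree, already spanned by
  monomials, and the product of two monomials is congruent to the monomial of the multiset sum. The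
  remaining part of H_N is covered by the generators of degree N.\<close>

lemma corad_filt_span_monomials:
  "corad_filt (Suc N) \<subseteq> span {b * monomial M | b M. b \<in> coradical \<and> set_mset M \<subseteq> \<Lambda> \<and> weight M \<le> N}"
proof (induction N rule: less_induct)
  case (less N)
  define Q where "Q N = span {b * monomial M | b M. b \<in> coradical \<and> set_mset M \<subseteq> \<Lambda> \<and> weight M \<le> N}" for N
  have QI: "b * monomial M \<in> Q N" if "b \<in> coradical" "set_mset M \<subseteq> \<Lambda>" "weight M \<le> N" for b M N
    unfolding Q_def using that by (intro span_base) blast
  have Qmono: "Q M \<subseteq> Q N" if "M \<le> N" for M N
    unfolding Q_def by (rule span_mono) (use le_trans[OF _ that] in blast)
  have sub: "subspace (Q N)" for N unfolding Q_def by (rule subspace_span)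
  have IH: "corad_filt (Suc n) \<subseteq> Q n" if "n < N" for n using less[OF that] unfolding Q_def .
  show ?case unfolding Q_def[symmetric]
  proof (cases N)
    case 0
    show "corad_filt (Suc N) \<subseteq> Q N"
      using QI[of _ "{#}" N] by (auto simp: 0 corad_filt_1 monomial_empty)
  next
    case (Suc n)
    then have N: "0 < N" by simp
    have low: "corad_filt N \<subseteq> Q N" using IH[of n] Qmono[of n N] Suc by auto
    have mon: "(b * monomial M) * (b' * monomial M') \<in> Q N"
      if *: "b \<in> coradical" "set_mset M \<subseteq> \<Lambda>" "b' \<in> coradical" "set_mset M' \<subseteq> \<Lambda>" "weight M + weight M' \<le> N"
      for b M b' M'
    proof -
      let ?bb = "b * b'"
      have bb: "?bb \<in> coradical" using * coradical_mult by blast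
      have "monomial M * monomial M' - monomial (M + M') \<in> corad_filt (weight M + weight M')"
        using prod_list_monomial[of "ord M @ ord M'"] ord_in * mset_ord by (simp add: monomial_def)
      then have "?bb * (monomial M * monomial M' - monomial (M + M')) \<in> Q N"
        using corad_filt_coradical_mult(1)[OF bb] corad_filt_monoD[OF _ *(5)] low by blast
      moreover have "?bb * monomial (M + M') \<in> Q N" by (rule QI) (use bb * in auto)
      ultimately have "?bb * (monomial M * monomial M') \<in> Q N"
        using subspace_add[OF sub] by (fastforce simp: right_diff_distrib)
      moreover have "(b * monomial M) * (b' * monomial M') = ?bb * (monomial M * monomial M')"
        using coradical_commute[OF *(3), of "monomial M"] by (metis mult.assoc)
      ultimately show ?thesis by simp
    qed
    have dec: "x \<in> Q N" if "x \<in> decomposables N" for x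
    proof -
      obtain y z i j where x: "x = y * z" "i + j = N" "0 < i" "0 < j"
        and y: "y \<in> corad_filt (Suc i)" and z: "z \<in> corad_filt (Suc j)"
        using \<open>x \<in> decomposables N\<close> unfolding decomposables_def by blast
      have "i < N" "j < N" using x by auto
      then have "y \<in> Q i" "z \<in> Q j" using IH y z by blast+
      have "y * (b' * monomial M') \<in> Q N" if "b' \<in> coradical" "set_mset M' \<subseteq> \<Lambda>" "weight M' \<le> j" for b' M'
        by (rule endo_span[OF endo_mult_right[OF endo_id] sub _ \<open>y \<in> Q i\<close>[unfolded Q_def]])
          (use that mon x in auto)
      then show "x \<in> Q N"
        unfolding x
        by (intro endo_span[OF endo_mult_left[OF endo_id] sub _ \<open>z \<in> Q j\<close>[unfolded Q_def]]) auto
    qed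
    have gen: "b * a \<in> Q N" if "b \<in> coradical" "a \<in> gens N" for b a
    proof -
      have "a \<in> \<Lambda>" using that N by (auto simp: \<Lambda>_eq)
      then show ?thesis
        using QI[of b "{#a#}" N] that deg_eq[OF N that(2)] by (simp add: monomial_singleton)
    qed
    have "span ({b * a | b a. b \<in> coradical \<and> a \<in> gens N} \<union> decomposables N \<union> corad_filt N) \<subseteq> Q N"
      by (rule span_minimal[OF _ sub]) (use gen dec low in auto)
    then show "corad_filt (Suc N) \<subseteq> Q N" using gens_span[OF N] by blast
  qed
qed

text \<open>For independence, take among the nonzero coefficients the largest weight N and then the
  smallest size m. Every other term lies in \<open>gr_power (Suc m) N\<close>: smaller weight puts
  it into H_(N-1), larger size into a higher power.\<close>

lemma monomials_module_basis:
  "is_module_basis coradical (monomial ` {M. set_mset M \<subseteq> \<Lambda>})" (is "is_module_basis _ ?P")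
  unfolding is_module_basis_def
proof (intro conjI allI impI)
  fix x
  define S where "S = {x. \<exists>F c. finite F \<and> F \<subseteq> ?P \<and> c ` F \<subseteq> coradical \<and> x = (\<Sum>p\<in>F. c p * p)}"
  have SI: "(\<Sum>p\<in>F. c p * p) \<in> S" if "finite F" "F \<subseteq> ?P" "\<And>p. p \<in> F \<Longrightarrow> c p \<in> coradical" for F c
    unfolding S_def by (intro CollectI exI[of _ F] exI[of _ c]) (use that in auto)
  have "subspace S"
    unfolding subspace_def
  proof (intro conjI ballI allI)
    show "0 \<in> S" using SI[of "{}"] by simp
    show "x + y \<in> S" if xy: "x \<in> S" "y \<in> S" for x y
    proof -
      obtain F c where F: "finite F" "F \<subseteq> ?P" "c ` F \<subseteq> coradical" "x = (\<Sum>p\<in>F. c p * p)"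
        using xy(1) unfolding S_def by blast
      obtain G e where G: "finite G" "G \<subseteq> ?P" "e ` G \<subseteq> coradical" "y = (\<Sum>p\<in>G. e p * p)"
        using xy(2) unfolding S_def by blast
      define g where "g p = (if p \<in> F then c p else 0) + (if p \<in> G then e p else 0)" for p
      have "(\<Sum>p\<in>F \<union> G. g p * p) = (\<Sum>p\<in>F \<union> G. (if p \<in> F then c p * p else 0))
          + (\<Sum>p\<in>F \<union> G. (if p \<in> G then e p * p else 0))"
        unfolding g_def sum.distrib[symmetric] by (rule sum.cong) (auto simp: distrib_right)
      also have "\<dots> = x + y"
        unfolding F(4) G(4) using F(1) G(1)
        by (intro arg_cong2[of _ _ _ _ "(+)"] sum.mono_neutral_cong_right) auto
      finally have "x + y = (\<Sum>p\<in>F \<union> G. g p * p)" ..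
      also have "\<dots> \<in> S"
        by (rule SI) (use F G in \<open>auto simp: g_def subspace_0[OF subspace_coradical]
            intro!: subspace_add[OF subspace_coradical]\<close>)
      finally show ?thesis .
    qed
    show "scale k x \<in> S" if x: "x \<in> S" for k x
    proof -
      obtain F c where F: "finite F" "F \<subseteq> ?P" "c ` F \<subseteq> coradical" "x = (\<Sum>p\<in>F. c p * p)"
        using x unfolding S_def by blast
      have "scale k x = (\<Sum>p\<in>F. scale k (c p) * p)" unfolding F(4) by (simp add: scale_sum_right scale_mult)
      also have "\<dots> \<in> S"
        by (rule SI) (use F in \<open>auto intro: subspace_scale[OF subspace_coradical]\<close>)
      finally show ?thesis .
    qed
  qed
  moreover have "b * monomial M \<in> S" if "b \<in> coradical" "set_mset M \<subseteq> \<Lambda>" for b M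
    using SI[of "{monomial M}" "\<lambda>_. b"] that by simp
  ultimately have "span {b * monomial M | b M. b \<in> coradical \<and> set_mset M \<subseteq> \<Lambda> \<and> weight M \<le> N} \<subseteq> S" for N
    by (intro span_minimal) auto
  moreover obtain n where "x \<in> corad_filt (Suc n)"
    using corad_filt_exhaustive[of x] corad_filt_Suc_mono by blast
  ultimately have "x \<in> S" using corad_filt_span_monomials by blast
  then show "\<exists>F c. finite F \<and> F \<subseteq> ?P \<and> c ` F \<subseteq> coradical \<and> x = (\<Sum>p\<in>F. c p * p)"
    unfolding S_def by blast
next
  fix F c assume *: "finite F \<and> F \<subseteq> ?P \<and> c ` F \<subseteq> coradical \<and> (\<Sum>p\<in>F. c p * p) = 0"
  have "\<forall>p\<in>F. \<exists>M. set_mset M \<subseteq> \<Lambda> \<and> p = monomial M" using * by blast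
  \<comment> \<open>The basis is a set of ring elements, so each p is given one multiset;
    \<open>\<mu>\<close> is injective because \<open>monomial\<close> recovers p from it.\<close>
  then obtain \<mu> where \<mu>: "\<And>p. p \<in> F \<Longrightarrow> set_mset (\<mu> p) \<subseteq> \<Lambda>" "\<And>p. p \<in> F \<Longrightarrow> p = monomial (\<mu> p)"
    by metis
  define F' where "F' = {p\<in>F. c p \<noteq> 0}"
  have "F' = {}"
  proof (rule ccontr)
    assume ne: "F' \<noteq> {}"
    have fin: "finite F'" using * unfolding F'_def by simp
    have c: "c p \<in> coradical" if "p \<in> F'" for p using that * unfolding F'_def by auto
    define N where "N = Max ((\<lambda>p. weight (\<mu> p)) ` F')"
    have N: "weight (\<mu> p) \<le> N" if "p \<in> F'" for p unfolding N_def using that fin by simp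
    define G where "G = {p\<in>F'. weight (\<mu> p) = N}"
    have "N \<in> (\<lambda>p. weight (\<mu> p)) ` F'" unfolding N_def using fin ne by (intro Max_in) auto
    then have Gne: "G \<noteq> {}" unfolding G_def by auto
    have finG: "finite G" unfolding G_def using fin by simp
    define m where "m = Min ((\<lambda>p. size (\<mu> p)) ` G)"
    have m: "m \<le> size (\<mu> p)" if "p \<in> G" for p unfolding m_def using that finG by simp
    have "m \<in> (\<lambda>p. size (\<mu> p)) ` G" unfolding m_def using finG Gne by (intro Min_in) auto
    then obtain p0 where p0: "p0 \<in> G" "size (\<mu> p0) = m" by auto
    define K where "K = {p\<in>G. size (\<mu> p) = m}"
    have KF: "K \<subseteq> F'" "K \<subseteq> F" unfolding K_def G_def F'_def by auto
    have inj: "inj_on \<mu> K" by (rule inj_onI) (metis \<mu>(2) KF(2) subsetD)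
    have rest: "c p * p \<in> gr_power (Suc m) N" if p: "p \<in> F' - K" for p
    proof -
      have pF: "p \<in> F" "p \<in> F'" using p unfolding F'_def by auto
      have "p \<in> gr_power (Suc m) N"
      proof (cases "p \<in> G")
        case True
        then have "Suc m \<le> size (\<mu> p)" using m[OF True] p unfolding K_def by auto
        then show ?thesis
          using monomial_gr_power[OF \<mu>(1)[OF pF(1)]] \<mu>(2)[OF pF(1)] True gr_power_antimono
          unfolding G_def by auto
      next
        case False
        then have "Suc (weight (\<mu> p)) \<le> N" using N[OF pF(2)] pF unfolding G_def by auto
        then have "p \<in> corad_filt N"
          using monomial_corad_filt[OF \<mu>(1)[OF pF(1)]] \<mu>(2)[OF pF(1)] corad_filt_monoD by metis
        then show ?thesis using corad_filt_subset_gr_power by blast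
      qed
      then show ?thesis using gr_power_mult_coradical c pF by blast
    qed
    have "(\<Sum>p\<in>F'. c p * p) = (\<Sum>p\<in>F. c p * p)"
      unfolding F'_def using * by (intro sum.mono_neutral_left) auto
    then have "(\<Sum>p\<in>K. c p * p) + (\<Sum>p\<in>F' - K. c p * p) = 0"
      using sum.subset_diff[OF KF(1) fin, of "\<lambda>p. c p * p"] * by (simp add: add.commute)
    then have "(\<Sum>p\<in>K. c p * p) = - (\<Sum>p\<in>F' - K. c p * p)" by (simp add: eq_neg_iff_add_eq_0)
    also have "\<dots> \<in> gr_power (Suc m) N"
      by (intro subspace_neg[OF subspace_gr_power] subspace_sum[OF subspace_gr_power] rest)
    finally have sumK: "(\<Sum>p\<in>K. c p * p) \<in> gr_power (Suc m) N" .
    have "(\<Sum>M\<in>\<mu> ` K. c (monomial M) * monomial M) = (\<Sum>p\<in>K. c p * p)"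
      unfolding sum.reindex[OF inj] comp_def
      by (rule sum.cong) (use \<mu>(2) KF in \<open>auto simp flip: \<mu>(2)\<close>)
    then have "(\<Sum>M\<in>\<mu> ` K. c (monomial M) * monomial M) \<in> gr_power (Suc m) N" using sumK by simp
    then have "c (monomial (\<mu> p0)) = 0"
    proof (rule monomials_independent_graded[rotated 3])
      show "finite (\<mu> ` K)" using finG unfolding K_def by simp
      show "\<mu> p0 \<in> \<mu> ` K" using p0 unfolding K_def by blast
      fix M assume "M \<in> \<mu> ` K"
      then obtain p where p: "p \<in> K" "M = \<mu> p" by blast
      then show "set_mset M \<subseteq> \<Lambda> \<and> size M = m \<and> weight M = N"
        using \<mu>(1) KF unfolding K_def G_def by auto
      have "p \<in> F" "p \<in> F'" using p(1) KF by auto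
      then show "c (monomial M) \<in> coradical" using p(2) \<mu>(2)[of p] c[of p] by simp
    qed
    then show False using p0(1) \<mu>(2)[of p0] unfolding G_def F'_def by simp
  qed
  then show "\<forall>p\<in>F. c p = 0" unfolding F'_def by blast
qed

lemma generates_over_gens: "generates_over coradical \<Lambda>"
  unfolding generates_over_def hull_def
proof (rule equalityI[OF subset_UNIV], rule subsetI, rule InterI, elim CollectE conjE)
  fix x T assume T: "1 \<in> T" "\<forall>x\<in>T. \<forall>y\<in>T. x - y \<in> T \<and> x * y \<in> T" "coradical \<union> \<Lambda> \<subseteq> T"
  have T0: "0 \<in> T" using T(1,2) by (metis diff_self)
  have Tadd: "x + y \<in> T" if "x \<in> T" "y \<in> T" for x y
    using T(2) T0 that by (metis diff_0 diff_minus_eq_add)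
  have Tprod: "prod_list xs \<in> T" if "set xs \<subseteq> \<Lambda>" for xs
    using that T by (induction xs) auto
  obtain F c where F: "finite F" "F \<subseteq> monomial ` {M. set_mset M \<subseteq> \<Lambda>}" "c ` F \<subseteq> coradical"
    "x = (\<Sum>p\<in>F. c p * p)"
    using monomials_module_basis unfolding is_module_basis_def by meson
  have "c p * p \<in> T" if "p \<in> F" for p
  proof -
    obtain M where "set_mset M \<subseteq> \<Lambda>" "p = monomial M" using F(2) \<open>p \<in> F\<close> by blast
    then have "p \<in> T" unfolding monomial_def using Tprod ord_in by blast
    moreover have "c p \<in> T" using F(3) T(3) \<open>p \<in> F\<close> by blast
    ultimately show ?thesis using T(2) by blast
  qed
  with F(1) have "(\<Sum>p\<in>F. c p * p) \<in> T"
    by (induction F) (auto simp: T0 Tadd)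
  then show "x \<in> T" using F(4) by simp
qed

end

context hopf_central_coradical
begin

theorem has_pbw_basis: "has_pbw_basis_over coradical"
proof -
  define gen_dual where "gen_dual d A \<delta> \<longleftrightarrow> A \<subseteq> corad_filt (Suc d) \<and> (\<forall>a\<in>A. indec_functional d (\<delta> a)) \<and>
      (\<forall>a\<in>A. \<forall>a'\<in>A. ract (\<delta> a) a' = (if a' = a then 1 else 0)) \<and>
      corad_filt (Suc d) \<subseteq> span ({b * a | b a. b \<in> coradical \<and> a \<in> A} \<union> decomposables d \<union> corad_filt d)"
    for d A \<delta>
  \<comment> \<open>Degree 0 carries no condition, so generators can be chosen uniformly for all
    d.\<close>
  have "\<forall>d. \<exists>A \<delta>. 0 < d \<longrightarrow> gen_dual d A \<delta>"
    using generators_exist unfolding gen_dual_def[symmetric] by blast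
  then obtain gens dual where "\<And>d. 0 < d \<Longrightarrow> gen_dual d (gens d) (dual d)" by metis
  then have g: "\<And>d. 0 < d \<Longrightarrow> gens d \<subseteq> corad_filt (Suc d)"
      "\<And>d a. 0 < d \<Longrightarrow> a \<in> gens d \<Longrightarrow> indec_functional d (dual d a)"
      "\<And>d a a'. 0 < d \<Longrightarrow> a \<in> gens d \<Longrightarrow> a' \<in> gens d \<Longrightarrow> ract (dual d a) a' = (if a' = a then 1 else 0)"
      "\<And>d. 0 < d \<Longrightarrow> corad_filt (Suc d)
        \<subseteq> span ({b * a | b a. b \<in> coradical \<and> a \<in> gens d} \<union> decomposables d \<union> corad_filt d)"
    unfolding gen_dual_def by simp_all
  define \<Lambda> where "\<Lambda> = (\<Union>d\<in>{0<..}. gens d)"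
  \<comment> \<open>Any well-order of the generators serves; they are indexed by themselves.\<close>
  obtain r where r: "well_order_on \<Lambda> r" using well_order_on by blast
  obtain ord where ord: "\<And>M. set_mset M \<subseteq> \<Lambda> \<Longrightarrow> mset (ord M) = M"
    and pbw: "pbw_set \<Lambda> r (\<lambda>x. x) = (\<lambda>M. prod_list (ord M)) ` {M. set_mset M \<subseteq> \<Lambda>}"
    using pbw_set_eq_monomials[OF r] by blast
  interpret graded_generators scale comult counit antipode gens dual \<Lambda> ord
    using g ord \<Lambda>_def by unfold_locales
  have "is_module_basis coradical (pbw_set \<Lambda> r (\<lambda>x. x))"
    using monomials_module_basis unfolding pbw monomial_def[abs_def] .
  then show ?thesis
    unfolding has_pbw_basis_over_def using r generates_over_gens
    by (intro exI[of _ \<Lambda>] exI[of _ r] exI[of _ "\<lambda>x. x"]) simp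
qed

end

theorem mainTheorem1:
  fixes scale :: "'k::field_char_0 \<Rightarrow> 'h::ring_1 \<Rightarrow> 'h"
    and comult :: "'h \<Rightarrow> ('h \<times> 'h \<Rightarrow>\<^sub>0 'k) set"
    and counit :: "'h \<Rightarrow> 'k"
    and antipode :: "'h \<Rightarrow> 'h"
  assumes "hopf_algebra scale comult counit antipode"
    and "hopf_algebra.hopf_subalgebra scale comult antipode
           (coalgebra.coradical scale comult)"
    and "coalgebra.coradical scale comult \<subseteq> ring_center"
  shows "has_pbw_basis_over (coalgebra.coradical scale comult)"
proof -
  interpret hopf_algebra scale comult counit antipode by fact
  interpret hopf_central_coradical scale comult counit antipode
    using assms(2,3) by unfold_locales
  show ?thesis by (rule has_pbw_basis)
qed

end
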